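(* Let $A$ be a finite-dimensional involutory Hopf algebra over $\mathbb{C}$ and let $M$ be a closed oriented triangulated 3-manifold whose vertices are numbered arbitrarily $1,2,\dots,N_0$, with the arrow on each 1-simplex directed from the vertex with the larger number to the one with the smaller number. Let $$F(M)=|X|^{-2N_2-N_0}\sum_{\phi}\prod_{t=1}^{N_3}W_t^{\kappa_t},$$ where the sum is over all colorings $\phi$ of $M$, $N_i$ is the number of $i$-simplices of $M$, and $W_t^{\kappa_t}$ is the weight of the $t$-th tetrahedron as defined in the context. Then $$F(M)=Z_A(M),$$ where $Z_A(M)$ is the Chung–Fukuma–Shapere invariant of $M$.
   Context: **Algebra.** $A$ is a finite-dimensional Hopf algebra over $\mathbb{C}$ with antipode $S$, $S^2=\mathrm{id}$, basis $\{\phi_x\}_{x\in X}$, $|X|=\dim A$. Repeated indices are summed over $X$. Structure constants: $\phi_x\phi_y=C_{xy}{}^{z}\phi_z$, $\Delta(\phi_x)=\Delta_x{}^{yz}\phi_y\otimes\phi_z$, $S(\phi_x)=S^{y}{}_{x}\phi_y$. Put $C_{x_1\cdots x_n}=C_{a_1x_1}{}^{a_2}C_{a_2x_2}{}^{a_3}\cdots C_{a_nx_n}{}^{a_1}$, $\Delta^{x_1\cdots x_n}=\Delta_{a_1}{}^{x_1a_2}\Delta_{a_2}{}^{x_2a_3}\cdots\Delta_{a_n}{}^{x_na_1}$ (both cyclically symmetric), and $h^{xy}=\Delta_u{}^{vx}\Delta_v{}^{uy}$. The matrix $h^{xy}$ is invertible, with inverse $h_{xy}$. Put $\Delta^{xyz}{}_{w}=\Delta^{xyzv}h_{vw}$.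 **The invariant $Z_A$.** A lattice $L$ representing a closed oriented 3-manifold is a 3-dimensional cell complex in which every 2-cell is a polygon and every 1-cell is in the boundary of at least three 2-cells. Let $N_i(L)$ be its number of $i$-cells. Choose an orientation of each 2-cell (face) $f$; it induces an arrow on each edge of $f$. To an $n$-gonal face with edges $1,\dots,n$ in cyclic order along the orientation, with index $x_r\in X$ on the $r$-th edge of the face, assign $C_{x_1x_2\cdots x_n}$. (Each pair (edge, face) thus carries its own index.) To each 1-cell (hinge) incident to $m$ faces: choose a direction of the 1-cell, list the incident faces clockwise around this direction, with indices $y_1,\dots,y_m$, and assign $\Delta^{y_1\cdots y_m}$; where the arrow coming from a face with index $x$ is opposite to the chosen direction, use instead an auxiliary index $x'$ in $\Delta$ at that place and multiply by $S^{x}{}_{x'}$. Then $Z_A(L)$ is $|X|^{-N_1(L)-N_3(L)}$ times the product of all face factors and hinge factors, summed over all indices. It is a known theorem (Chung–Fukuma–Shapere) that $Z_A(L)$ does not depend on the choices made and depends only on the manifold $M$ represented by $L$; it is denoted $Z_A(M)$. In particular it may be computed by taking for $L$ the triangulation itself. **Colorings.** A coloring $\phi$ of $M$ assigns an element of $X$ to each pair $(E,F)$ with $E$ a 1-simplex and $F$ a 2-simplex of $M$, $E\subset F$. **Weight of a tetrahedron.** Inside a tetrahedron $T$ with an arrow on each edge, each edge $e$ lies in two faces of $T$. Rotating clockwise around the arrow of $e$ through $T$, one passes from one of these faces to the other; the color of ($e$, first face) is denoted $e_-$ and that of ($e$, second face) is denoted $e_+$. (Clockwise, here and for $Z_A$,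 means as seen looking in the direction of the arrow; if the vertices $(p,q,r,s)$ are positively ordered for the orientation, the clockwise rotation about $p\to q$ through $T$ takes face $pqr$ to face $pqs$.) Let $a>b>c>d$ be the vertices of $T$. $T\in U^+$ if $(a,b,c,d)$ is positively oriented, $T\in U^-$ otherwise; $\kappa=\pm$ accordingly. Name the edges: for $U^+$: $i=bd,\ j=cd,\ k=bc,\ l=ac,\ m=ab,\ n=ad$; for $U^-$: $i=bd,\ j=bc,\ k=cd,\ l=ac,\ m=ad,\ n=ab$. With $D=\prod_{(E,e)}S^{E'}{}_{E''}\,\Delta^{E''E\,e_+}{}_{e_-}$, the product over $(E,e)=(I,i),(J,j),(K,k),(L,l),(M,m),(N,n)$, the weights are $$W^+=C_{I'KJ}\,C_{K'M'L}\,C_{J'L'N}\,C_{IN'M}\,D,\qquad W^-=C_{IK'J'}\,C_{KM'L}\,C_{JL'N}\,C_{I'N'M}\,D,$$ all capital indices $I,I',I'',J,\dots$ being summed over $X$. *)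

theory Defs
  imports "HOL-Analysis.Analysis"
begin

section \<open>Involutory Hopf algebras with a basis\<close>

definition coord ::
  "(complex \<Rightarrow> 'a::ring_1 \<Rightarrow> 'a) \<Rightarrow> ('x \<Rightarrow> 'a) \<Rightarrow> 'a \<Rightarrow> 'x \<Rightarrow> complex"
  where "coord scl \<phi> a x = module.representation scl (range \<phi>) a (\<phi> x)"

text \<open>
  The algebra \<open>A\<close> is the whole type \<open>'a\<close>; its ring structure gives associativity and the unit.
  An element \<open>\<Sum>y z. t y z \<phi>\<^sub>y \<otimes> \<phi>\<^sub>z\<close> of \<open>A \<otimes> A\<close> is represented by its coordinate
  function \<open>t\<close>, so \<open>comult a y z\<close> is the coefficient of \<open>\<phi>\<^sub>y \<otimes> \<phi>\<^sub>z\<close> in \<open>\<Delta>(a)\<close>.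
\<close>

locale involutory_hopf_algebra = vector_space scl
  for scl :: "complex \<Rightarrow> 'a::ring_1 \<Rightarrow> 'a" +
  fixes \<phi> :: "'x::finite \<Rightarrow> 'a"
    and comult :: "'a \<Rightarrow> 'x \<Rightarrow> 'x \<Rightarrow> complex"
    and counit :: "'a \<Rightarrow> complex"
    and antipode :: "'a \<Rightarrow> 'a"
  assumes basis_inj: "inj \<phi>"
    and basis_independent: "independent (range \<phi>)"
    and basis_span: "span (range \<phi>) = UNIV"
    and scl_mult_left: "scl c a * b = scl c (a * b)"
    and scl_mult_right: "a * scl c b = scl c (a * b)"
    and comult_linear: "Vector_Spaces.linear scl (*) (\<lambda>a. comult a y z)"
    and counit_linear: "Vector_Spaces.linear scl (*) counit"
    and antipode_linear: "Vector_Spaces.linear scl scl antipode"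
    and coassociative:
      "(\<Sum>u\<in>UNIV. comult a u z * comult (\<phi> u) x y) =
       (\<Sum>u\<in>UNIV. comult a x u * comult (\<phi> u) y z)"
    and counit_left: "(\<Sum>y\<in>UNIV. \<Sum>z\<in>UNIV. scl (comult a y z * counit (\<phi> y)) (\<phi> z)) = a"
    and counit_right: "(\<Sum>y\<in>UNIV. \<Sum>z\<in>UNIV. scl (comult a y z * counit (\<phi> z)) (\<phi> y)) = a"
    and comult_mult:
      "comult (a * b) p q =
       (\<Sum>y\<in>UNIV. \<Sum>z\<in>UNIV. \<Sum>y'\<in>UNIV. \<Sum>z'\<in>UNIV. comult a y z * comult b y' z' *
          coord scl \<phi> (\<phi> y * \<phi> y') p * coord scl \<phi> (\<phi> z * \<phi> z') q)"
    and comult_one: "comult 1 p q = coord scl \<phi> 1 p * coord scl \<phi> 1 q"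
    and counit_mult: "counit (a * b) = counit a * counit b"
    and counit_one: "counit 1 = 1"
    and antipode_left:
      "(\<Sum>y\<in>UNIV. \<Sum>z\<in>UNIV. scl (comult a y z) (antipode (\<phi> y) * \<phi> z)) = scl (counit a) 1"
    and antipode_right:
      "(\<Sum>y\<in>UNIV. \<Sum>z\<in>UNIV. scl (comult a y z) (\<phi> y * antipode (\<phi> z))) = scl (counit a) 1"
    and involutory: "antipode (antipode a) = a"

text \<open>
  Structure constants, with arguments in the order \<open>C\<^sub>x\<^sub>y\<^sup>z\<close>, \<open>\<Delta>\<^sub>x\<^sup>y\<^sup>z\<close> and \<open>S\<^sup>y\<^sub>x\<close>
  (so \<open>antipode_const scl \<phi> antipode y x\<close> is the coefficient of \<open>\<phi>\<^sub>y\<close> in \<open>S(\<phi>\<^sub>x)\<close>).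
\<close>

definition mult_const ::
  "(complex \<Rightarrow> 'a::ring_1 \<Rightarrow> 'a) \<Rightarrow> ('x \<Rightarrow> 'a) \<Rightarrow> 'x \<Rightarrow> 'x \<Rightarrow> 'x \<Rightarrow> complex"
  where "mult_const scl \<phi> x y z = coord scl \<phi> (\<phi> x * \<phi> y) z"

definition comult_const ::
  "('x \<Rightarrow> 'a) \<Rightarrow> ('a \<Rightarrow> 'x \<Rightarrow> 'x \<Rightarrow> complex) \<Rightarrow> 'x \<Rightarrow> 'x \<Rightarrow> 'x \<Rightarrow> complex"
  where "comult_const \<phi> comult x y z = comult (\<phi> x) y z"

definition antipode_const ::
  "(complex \<Rightarrow> 'a::ring_1 \<Rightarrow> 'a) \<Rightarrow> ('x \<Rightarrow> 'a) \<Rightarrow> ('a \<Rightarrow> 'a) \<Rightarrow> 'x \<Rightarrow> 'x \<Rightarrow> complex"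
  where "antipode_const scl \<phi> antipode y x = coord scl \<phi> (antipode (\<phi> x)) y"

text \<open>
  For a list \<open>xs = [x\<^sub>1, \<dots>, x\<^sub>n]\<close> with \<open>n > 0\<close>, \<open>cyclic_contraction C xs\<close> is
  \<open>C\<^bsub>x\<^sub>1\<dots>x\<^sub>n\<^esub>\<close>, and \<open>cyclic_contraction \<Delta> xs\<close> is \<open>\<Delta>\<^bsup>x\<^sub>1\<dots>x\<^sub>n\<^esup>\<close>:
  in both the contracted index is in the first and third argument position.
\<close>

definition cyclic_contraction ::
  "('x \<Rightarrow> 'x \<Rightarrow> 'x \<Rightarrow> complex) \<Rightarrow> 'x::finite list \<Rightarrow> complex"
  where "cyclic_contraction T xs =
    (\<Sum>as | length as = length xs.
       \<Prod>r<length xs. T (as ! r) (xs ! r) (as ! ((r + 1) mod length xs)))"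

definition h_upper :: "('x \<Rightarrow> 'x \<Rightarrow> 'x \<Rightarrow> complex) \<Rightarrow> 'x::finite \<Rightarrow> 'x \<Rightarrow> complex"
  where "h_upper \<Delta> x y = (\<Sum>u\<in>UNIV. \<Sum>v\<in>UNIV. \<Delta> u v x * \<Delta> v u y)"

definition h_lower :: "('x \<Rightarrow> 'x \<Rightarrow> 'x \<Rightarrow> complex) \<Rightarrow> 'x::finite \<Rightarrow> 'x \<Rightarrow> complex"
  where "h_lower \<Delta> x y = matrix_inv (\<chi> i j. h_upper \<Delta> i j) $ x $ y"

definition comult_lowered ::
  "('x \<Rightarrow> 'x \<Rightarrow> 'x \<Rightarrow> complex) \<Rightarrow> 'x::finite \<Rightarrow> 'x \<Rightarrow> 'x \<Rightarrow> 'x \<Rightarrow> complex"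
  where "comult_lowered \<Delta> x y z w =
    (\<Sum>v\<in>UNIV. cyclic_contraction \<Delta> [x, y, z, v] * h_lower \<Delta> v w)"


section \<open>Closed oriented triangulated 3-manifolds\<close>

text \<open>
  A triangulated manifold is given as a geometric simplicial complex \<open>K\<close> in some Euclidean
  space; the manifold is \<open>\<Union>K\<close>, which is automatically compact and Hausdorff.
\<close>

definition closed_triangulated_3_manifold :: "'v::euclidean_space set set \<Rightarrow> bool"
  where "closed_triangulated_3_manifold K \<longleftrightarrow>
    simplicial_complex K \<and>
    (\<forall>x\<in>\<Union>K. \<exists>U W :: (real ^ 3) set.
       openin (top_of_set (\<Union>K)) U \<and> x \<in> U \<and> open W \<and> U homeomorphic W)"

definition simplices :: "nat \<Rightarrow> 'v::euclidean_space set set \<Rightarrow> 'v set set"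
  where "simplices n K = {\<sigma>\<in>K. int n simplex \<sigma>}"

definition vertices :: "'v::euclidean_space set set \<Rightarrow> 'v set"
  where "vertices K = {v. {v} \<in> K}"

text \<open>
  \<open>pos a b c d\<close> says that the ordering \<open>(a,b,c,d)\<close> of the vertices of a tetrahedron is positive;
  \<open>pos\<close> is irrelevant on other quadruples. The three adjacent transpositions make it an
  orientation of each tetrahedron. The last condition says that two tetrahedra sharing a
  triangle induce opposite orientations on it.
\<close>

definition orientation ::
  "'v::euclidean_space set set \<Rightarrow> ('v \<Rightarrow> 'v \<Rightarrow> 'v \<Rightarrow> 'v \<Rightarrow> bool) \<Rightarrow> bool"
  where "orientation K pos \<longleftrightarrow>
    (\<forall>a b c d. convex hull {a, b, c, d} \<in> simplices 3 K \<longrightarrow>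
       (pos b a c d \<longleftrightarrow> \<not> pos a b c d) \<and>
       (pos a c b d \<longleftrightarrow> \<not> pos a b c d) \<and>
       (pos a b d c \<longleftrightarrow> \<not> pos a b c d)) \<and>
    (\<forall>a b c d e. convex hull {a, b, c, d} \<in> simplices 3 K \<and>
       convex hull {a, b, c, e} \<in> simplices 3 K \<and> d \<noteq> e \<longrightarrow>
       (pos a b c e \<longleftrightarrow> \<not> pos a b c d))"


section \<open>The state sum over tetrahedra\<close>

definition flags :: "'v::euclidean_space set set \<Rightarrow> ('v set \<times> 'v set) set"
  where "flags K = {(E, F). E \<in> simplices 1 K \<and> F \<in> simplices 2 K \<and> E \<subseteq> F}"

definition colorings ::
  "'v::euclidean_space set set \<Rightarrow> ('v set \<times> 'v set \<Rightarrow> 'x) set"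
  where "colorings K = (flags K \<rightarrow>\<^sub>E UNIV)"

text \<open>
  \<open>e\<^sub>-\<close> and \<open>e\<^sub>+\<close> for the edge with arrow \<open>p \<rightarrow> q\<close> in the tetrahedron \<open>pqrs\<close>; both are symmetric
  in \<open>r\<close> and \<open>s\<close>.
\<close>

definition color_minus ::
  "('v::euclidean_space \<Rightarrow> 'v \<Rightarrow> 'v \<Rightarrow> 'v \<Rightarrow> bool) \<Rightarrow> ('v set \<times> 'v set \<Rightarrow> 'x) \<Rightarrow>
   'v \<times> 'v \<times> 'v \<times> 'v \<Rightarrow> 'x"
  where "color_minus pos col = (\<lambda>(p, q, r, s).
    col (convex hull {p, q}, convex hull (if pos p q r s then {p, q, r} else {p, q, s})))"

definition color_plus ::
  "('v::euclidean_space \<Rightarrow> 'v \<Rightarrow> 'v \<Rightarrow> 'v \<Rightarrow> bool) \<Rightarrow> ('v set \<times> 'v set \<Rightarrow> 'x) \<Rightarrow>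
   'v \<times> 'v \<times> 'v \<times> 'v \<Rightarrow> 'x"
  where "color_plus pos col = (\<lambda>(p, q, r, s).
    col (convex hull {p, q}, convex hull (if pos p q r s then {p, q, s} else {p, q, r})))"

text \<open>
  The six edge names \<open>i, \<dots>, n\<close>. Below, a capital index such as \<open>I\<close>, \<open>I'\<close>, \<open>I''\<close> is the value
  at \<open>ei\<close> of the functions \<open>E\<close>, \<open>E'\<close>, \<open>E''\<close>.
\<close>

datatype tet_edge = ei | ej | ek | el | em | en

instance tet_edge :: finite
proof
  have "(UNIV :: tet_edge set) = {ei, ej, ek, el, em, en}"
    by (auto intro: tet_edge.exhaust)
  then show "finite (UNIV :: tet_edge set)"
    by (metis finite.emptyI finite_insert)
qed

text \<open>An edge \<open>p \<rightarrow> q\<close> is listed together with the two remaining vertices.\<close>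

fun edge_U_plus :: "'v \<times> 'v \<times> 'v \<times> 'v \<Rightarrow> tet_edge \<Rightarrow> 'v \<times> 'v \<times> 'v \<times> 'v" where
  "edge_U_plus (a, b, c, d) ei = (b, d, a, c)"
| "edge_U_plus (a, b, c, d) ej = (c, d, a, b)"
| "edge_U_plus (a, b, c, d) ek = (b, c, a, d)"
| "edge_U_plus (a, b, c, d) el = (a, c, b, d)"
| "edge_U_plus (a, b, c, d) em = (a, b, c, d)"
| "edge_U_plus (a, b, c, d) en = (a, d, b, c)"

fun edge_U_minus :: "'v \<times> 'v \<times> 'v \<times> 'v \<Rightarrow> tet_edge \<Rightarrow> 'v \<times> 'v \<times> 'v \<times> 'v" where
  "edge_U_minus (a, b, c, d) ei = (b, d, a, c)"
| "edge_U_minus (a, b, c, d) ej = (b, c, a, d)"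
| "edge_U_minus (a, b, c, d) ek = (c, d, a, b)"
| "edge_U_minus (a, b, c, d) el = (a, c, b, d)"
| "edge_U_minus (a, b, c, d) em = (a, d, b, c)"
| "edge_U_minus (a, b, c, d) en = (a, b, c, d)"

definition weight_D ::
  "('x \<Rightarrow> 'x \<Rightarrow> 'x \<Rightarrow> complex) \<Rightarrow> ('x \<Rightarrow> 'x \<Rightarrow> complex) \<Rightarrow>
   (tet_edge \<Rightarrow> 'x::finite) \<Rightarrow> (tet_edge \<Rightarrow> 'x) \<Rightarrow>
   (tet_edge \<Rightarrow> 'x) \<Rightarrow> (tet_edge \<Rightarrow> 'x) \<Rightarrow> (tet_edge \<Rightarrow> 'x) \<Rightarrow> complex"
  where "weight_D \<Delta> S c_minus c_plus E E' E'' =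
    (\<Prod>e\<in>UNIV. S (E' e) (E'' e) * comult_lowered \<Delta> (E'' e) (E e) (c_plus e) (c_minus e))"

definition weight_plus ::
  "('x \<Rightarrow> 'x \<Rightarrow> 'x \<Rightarrow> complex) \<Rightarrow> ('x \<Rightarrow> 'x \<Rightarrow> 'x \<Rightarrow> complex) \<Rightarrow> ('x \<Rightarrow> 'x \<Rightarrow> complex) \<Rightarrow>
   (tet_edge \<Rightarrow> 'x::finite) \<Rightarrow> (tet_edge \<Rightarrow> 'x) \<Rightarrow> complex"
  where "weight_plus C \<Delta> S c_minus c_plus =
    (\<Sum>E\<in>UNIV. \<Sum>E'\<in>UNIV. \<Sum>E''\<in>UNIV.
       cyclic_contraction C [E' ei, E ek, E ej] *
       cyclic_contraction C [E' ek, E' em, E el] *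
       cyclic_contraction C [E' ej, E' el, E en] *
       cyclic_contraction C [E ei, E' en, E em] *
       weight_D \<Delta> S c_minus c_plus E E' E'')"

definition weight_minus ::
  "('x \<Rightarrow> 'x \<Rightarrow> 'x \<Rightarrow> complex) \<Rightarrow> ('x \<Rightarrow> 'x \<Rightarrow> 'x \<Rightarrow> complex) \<Rightarrow> ('x \<Rightarrow> 'x \<Rightarrow> complex) \<Rightarrow>
   (tet_edge \<Rightarrow> 'x::finite) \<Rightarrow> (tet_edge \<Rightarrow> 'x) \<Rightarrow> complex"
  where "weight_minus C \<Delta> S c_minus c_plus =
    (\<Sum>E\<in>UNIV. \<Sum>E'\<in>UNIV. \<Sum>E''\<in>UNIV.
       cyclic_contraction C [E ei, E' ek, E' ej] *
       cyclic_contraction C [E ek, E' em, E el] *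
       cyclic_contraction C [E ej, E' el, E en] *
       cyclic_contraction C [E' ei, E' en, E em] *
       weight_D \<Delta> S c_minus c_plus E E' E'')"

definition tet_weight ::
  "('x \<Rightarrow> 'x \<Rightarrow> 'x \<Rightarrow> complex) \<Rightarrow> ('x \<Rightarrow> 'x \<Rightarrow> 'x \<Rightarrow> complex) \<Rightarrow> ('x \<Rightarrow> 'x \<Rightarrow> complex) \<Rightarrow>
   ('v::euclidean_space \<Rightarrow> 'v \<Rightarrow> 'v \<Rightarrow> 'v \<Rightarrow> bool) \<Rightarrow> ('v set \<times> 'v set \<Rightarrow> 'x::finite) \<Rightarrow>
   'v \<times> 'v \<times> 'v \<times> 'v \<Rightarrow> complex"
  where "tet_weight C \<Delta> S pos col = (\<lambda>(a, b, c, d).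
    if pos a b c d
    then weight_plus C \<Delta> S (\<lambda>e. color_minus pos col (edge_U_plus (a, b, c, d) e))
                           (\<lambda>e. color_plus pos col (edge_U_plus (a, b, c, d) e))
    else weight_minus C \<Delta> S (\<lambda>e. color_minus pos col (edge_U_minus (a, b, c, d) e))
                            (\<lambda>e. color_plus pos col (edge_U_minus (a, b, c, d) e)))"

text \<open>
  Each tetrahedron, represented by its vertices \<open>a > b > c > d\<close> in the order given by the numbering.
\<close>

definition tetrahedra ::
  "'v::euclidean_space set set \<Rightarrow> ('v \<Rightarrow> nat) \<Rightarrow> ('v \<times> 'v \<times> 'v \<times> 'v) set"
  where "tetrahedra K num = {(a, b, c, d). convex hull {a, b, c, d} \<in> simplices 3 K \<and>
     num a > num b \<and> num b > num c \<and> num c > num d}"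

definition tetrahedral_state_sum ::
  "('x::finite \<Rightarrow> 'x \<Rightarrow> 'x \<Rightarrow> complex) \<Rightarrow> ('x \<Rightarrow> 'x \<Rightarrow> 'x \<Rightarrow> complex) \<Rightarrow> ('x \<Rightarrow> 'x \<Rightarrow> complex) \<Rightarrow>
   'v::euclidean_space set set \<Rightarrow> ('v \<Rightarrow> 'v \<Rightarrow> 'v \<Rightarrow> 'v \<Rightarrow> bool) \<Rightarrow> ('v \<Rightarrow> nat) \<Rightarrow> complex"
  where "tetrahedral_state_sum C \<Delta> S K pos num =
    of_nat CARD('x) powi
      (- 2 * int (card (simplices 2 K)) - int (card (simplices 0 K))) *
    (\<Sum>col\<in>colorings K. \<Prod>T\<in>tetrahedra K num. tet_weight C \<Delta> S pos col T)"


section \<open>The Chung--Fukuma--Shapere invariant\<close>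

text \<open>
  The factor of an edge. Each entry of the list is the index on an incident face together with
  whether the arrow from that face agrees with the direction of the edge. All indices of \<open>\<Delta>\<close>
  are auxiliary; those where the arrows agree are identified with the given index by a
  Kronecker delta.
\<close>

definition hinge_factor ::
  "('x \<Rightarrow> 'x \<Rightarrow> 'x \<Rightarrow> complex) \<Rightarrow> ('x \<Rightarrow> 'x \<Rightarrow> complex) \<Rightarrow> ('x::finite \<times> bool) list \<Rightarrow> complex"
  where "hinge_factor \<Delta> S xs =
    (\<Sum>ys | length ys = length xs.
       (\<Prod>r<length xs. if snd (xs ! r) then (if ys ! r = fst (xs ! r) then 1 else 0)
                       else S (fst (xs ! r)) (ys ! r)) *
       cyclic_contraction \<Delta> ys)"

text \<open>
  A lattice whose faces are oriented and whose edges are directed is given by its finite sets of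
  edges and faces, its number of 3-cells, for each face \<open>f\<close> the list \<open>bd f\<close> of its edges in
  cyclic order along its orientation, each paired with whether the arrow coming from \<open>f\<close> agrees
  with the direction of the edge, and for each edge \<open>e\<close> the list \<open>star e\<close> of its incident faces
  in clockwise order around its direction.
\<close>

definition cfs_sum ::
  "('x::finite \<Rightarrow> 'x \<Rightarrow> 'x \<Rightarrow> complex) \<Rightarrow> ('x \<Rightarrow> 'x \<Rightarrow> 'x \<Rightarrow> complex) \<Rightarrow> ('x \<Rightarrow> 'x \<Rightarrow> complex) \<Rightarrow>
   'e set \<Rightarrow> 'f set \<Rightarrow> nat \<Rightarrow> ('f \<Rightarrow> ('e \<times> bool) list) \<Rightarrow> ('e \<Rightarrow> 'f list) \<Rightarrow> complex"
  where "cfs_sum C \<Delta> S edges faces n3 bd star =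
    of_nat CARD('x) powi (- int (card edges) - int n3) *
    (\<Sum>z \<in> {(e, f). f \<in> faces \<and> e \<in> fst ` set (bd f)} \<rightarrow>\<^sub>E UNIV.
       (\<Prod>f\<in>faces. cyclic_contraction C (map (\<lambda>(e, _). z (e, f)) (bd f))) *
       (\<Prod>e\<in>edges. hinge_factor \<Delta> S (map (\<lambda>f. (z (e, f), (e, True) \<in> set (bd f))) (star e))))"

text \<open>
  The choices made for a triangulation: \<open>ori F = (p,q,r)\<close> orients the triangle \<open>F = pqr\<close> as
  \<open>p \<rightarrow> q \<rightarrow> r \<rightarrow> p\<close>, \<open>dir E = (p,q)\<close> directs the edge \<open>E\<close> as \<open>p \<rightarrow> q\<close>, and \<open>link E\<close> lists the
  vertices opposite \<open>E\<close> in the triangles containing \<open>E\<close>, clockwise around \<open>p \<rightarrow> q\<close>.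
\<close>

definition lattice_choices ::
  "'v::euclidean_space set set \<Rightarrow> ('v \<Rightarrow> 'v \<Rightarrow> 'v \<Rightarrow> 'v \<Rightarrow> bool) \<Rightarrow>
   ('v set \<Rightarrow> 'v \<times> 'v \<times> 'v) \<Rightarrow> ('v set \<Rightarrow> 'v \<times> 'v) \<Rightarrow> ('v set \<Rightarrow> 'v list) \<Rightarrow> bool"
  where "lattice_choices K pos ori dir link \<longleftrightarrow>
    (\<forall>F\<in>simplices 2 K. case ori F of (p, q, r) \<Rightarrow> F = convex hull {p, q, r}) \<and>
    (\<forall>E\<in>simplices 1 K. case dir E of (p, q) \<Rightarrow>
       E = convex hull {p, q} \<and>
       distinct (link E) \<and>
       set (link E) = {r. convex hull {p, q, r} \<in> simplices 2 K} \<and>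
       (\<forall>i<length (link E).
          let r = link E ! i; s = link E ! ((i + 1) mod length (link E))
          in convex hull {p, q, r, s} \<in> simplices 3 K \<and> pos p q r s))"

definition triangle_boundary ::
  "('v set \<Rightarrow> 'v \<times> 'v \<times> 'v) \<Rightarrow> ('v set \<Rightarrow> 'v \<times> 'v) \<Rightarrow>
   'v::euclidean_space set \<Rightarrow> ('v set \<times> bool) list"
  where "triangle_boundary ori dir F = (case ori F of (p, q, r) \<Rightarrow>
    map (\<lambda>(u, v). (convex hull {u, v}, dir (convex hull {u, v}) = (u, v)))
      [(p, q), (q, r), (r, p)])"

definition edge_star ::
  "('v set \<Rightarrow> 'v \<times> 'v) \<Rightarrow> ('v set \<Rightarrow> 'v list) \<Rightarrow> 'v::euclidean_space set \<Rightarrow> 'v set list"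
  where "edge_star dir link E = (case dir E of (p, q) \<Rightarrow>
    map (\<lambda>r. convex hull {p, q, r}) (link E))"

definition cfs_invariant ::
  "('x::finite \<Rightarrow> 'x \<Rightarrow> 'x \<Rightarrow> complex) \<Rightarrow> ('x \<Rightarrow> 'x \<Rightarrow> 'x \<Rightarrow> complex) \<Rightarrow> ('x \<Rightarrow> 'x \<Rightarrow> complex) \<Rightarrow>
   'v::euclidean_space set set \<Rightarrow>
   ('v set \<Rightarrow> 'v \<times> 'v \<times> 'v) \<Rightarrow> ('v set \<Rightarrow> 'v \<times> 'v) \<Rightarrow> ('v set \<Rightarrow> 'v list) \<Rightarrow> complex"
  where "cfs_invariant C \<Delta> S K ori dir link =
    cfs_sum C \<Delta> S (simplices 1 K) (simplices 2 K) (card (simplices 3 K))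
      (triangle_boundary ori dir) (edge_star dir link)"

end

theory Submission
  imports Defs
begin

text \<open>
  Lowering an index makes \<open>\<Delta>\<^sup>x\<^sup>y\<^sup>z\<^sub>w\<close> an iterated comultiplication, because \<open>h\<close> is the trace form of the dual
  algebra and \<open>S\<^sup>2 = id\<close> makes that form symmetric with an explicit inverse. Summing over the colors of
  \<open>F(M)\<close> therefore joins the factors \<open>\<Delta>\<close> around each edge into the cyclic tensor of the hinge, at the
  price of one extra coproduct for every pair (edge, face), which splits its index between the two
  tetrahedra at the face. So every triangle appears doubled, with opposite orientations. As the trace
  is an integral, such a pillow collapses to a single triangle times \<open>|X|\<close>, which gives the summand
  of \<open>Z\<^sub>A(M)\<close> and a factor \<open>|X|\<close> for each of the \<open>N\<^sub>2\<close> triangles. The auxiliary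
  choices in \<open>Z\<^sub>A(M)\<close> are immaterial because \<open>S\<close> reverses both cyclic tensors.

  The powers of \<open>|X|\<close> agree as \<open>N\<^sub>0 - N\<^sub>1 + N\<^sub>2 - N\<^sub>3 = 0\<close>. This holds because all vertex links have Euler
  characteristic 2: a punctured neighbourhood of a vertex is a punctured 3-ball, which is connected and
  on which every map to the circle has a logarithm, so the link is connected with \<open>H\<^sup>1 = 0\<close>, and
  the orientation gives \<open>H\<^sup>2 = \<int>\<close>.
\<close>

section \<open>Involutory Hopf algebras in coordinates\<close>

text \<open>Two obstacles shape the proof. The weights are grouped by tetrahedra, while
  \<open>Z_A\<close> is grouped by triangles and edges. What both share are the pairs (edge, face):
  such a flag is \<open>e_-\<close> for exactly one tetrahedron and \<open>e_+\<close> for exactly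
  one other. All index families can therefore be placed on the one set \<open>FL\<close>, and each
  regrouping of the sum is a bijection onto \<open>FL\<close>.

  Secondly, K is only locally Euclidean, so vertex links are not known to be spheres. That maximal
  simplices are tetrahedra and that links are connected and exact has to be extracted from charts.
  Homology groups never appear: the Euler characteristic of a link is bounded from either side by
  counting the unknowns of an integral linear system.

  On the algebraic side the axioms are kept as identities between tensors, which are stable under
  transposition. Facts about the trace and the product thus yield facts about the cyclic tensor of
  the coproduct, in particular the inverse of \<open>h\<close>, by instantiating them at the
  dual.\<close>

lemma sum_swap4:
  "(\<Sum>a\<in>UNIV. \<Sum>b\<in>UNIV. \<Sum>c\<in>UNIV. \<Sum>d\<in>UNIV. f a b c d) =
   (\<Sum>c\<in>UNIV. \<Sum>d\<in>UNIV. \<Sum>b\<in>UNIV. \<Sum>a\<in>UNIV. f a b c (d :: 'd::finite) :: 'x::comm_monoid_add)"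
  for f :: "'a::finite \<Rightarrow> 'b::finite \<Rightarrow> 'c::finite \<Rightarrow> _"
  unfolding sum.cartesian_product
  by (rule sum.reindex_bij_witness[of _ "\<lambda>(c, d, b, a). (a, b, c, d)" "\<lambda>(a, b, c, d). (c, d, b, a)"]) auto

lemma sum_swap4':
  "(\<Sum>a\<in>UNIV. \<Sum>b\<in>UNIV. \<Sum>c\<in>UNIV. \<Sum>d\<in>UNIV. f a b c d) =
   (\<Sum>d\<in>UNIV. \<Sum>a\<in>UNIV. \<Sum>b\<in>UNIV. \<Sum>c\<in>UNIV. f a b c (d :: 'd::finite) :: 'x::comm_monoid_add)"
  for f :: "'a::finite \<Rightarrow> 'b::finite \<Rightarrow> 'c::finite \<Rightarrow> _"
  unfolding sum.cartesian_product
  by (rule sum.reindex_bij_witness[of _ "\<lambda>(d, a, b, c). (a, b, c, d)" "\<lambda>(a, b, c, d). (d, a, b, c)"]) auto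

lemma sum_swap3:
  "(\<Sum>a\<in>UNIV. \<Sum>b\<in>UNIV. \<Sum>c\<in>UNIV. f a b c) =
   (\<Sum>b\<in>UNIV. \<Sum>c\<in>UNIV. \<Sum>a\<in>UNIV. f a b (c :: 'c::finite) :: 'x::comm_monoid_add)"
  for f :: "'a::finite \<Rightarrow> 'b::finite \<Rightarrow> _"
  unfolding sum.cartesian_product
  by (rule sum.reindex_bij_witness[of _ "\<lambda>(b, c, a). (a, b, c)" "\<lambda>(a, b, c). (b, c, a)"]) auto

lemma sum_of_bool_mult:
  "(\<Sum>i\<in>UNIV. f i * (of_bool (i = k) * g i)) = f k * (g k :: complex)" for k :: "'a::finite"
  by (subst sum.remove[of _ k]) auto

section \<open>Hopf algebra tensors and Sweedler calculus\<close>

text \<open>Only the structure tensors are kept, not the algebra they come from, so that the dual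
  Hopf algebra is another instance over the same index type.\<close>

locale hopf_tensors =
  fixes C :: "'x::finite \<Rightarrow> 'x \<Rightarrow> 'x \<Rightarrow> complex"
    and \<eta> :: "'x \<Rightarrow> complex"
    and \<Delta> :: "'x \<Rightarrow> 'x \<Rightarrow> 'x \<Rightarrow> complex"
    and \<epsilon> :: "'x \<Rightarrow> complex"
    and S :: "'x \<Rightarrow> 'x \<Rightarrow> complex"
  assumes assoc: "(\<Sum>u\<in>UNIV. C x y u * C u z w) = (\<Sum>u\<in>UNIV. C y z u * C x u w)"
    and unit_left: "(\<Sum>u\<in>UNIV. \<eta> u * C u x y) = of_bool (x = y)"
    and unit_right: "(\<Sum>u\<in>UNIV. \<eta> u * C x u y) = of_bool (x = y)"
    and coassoc: "(\<Sum>u\<in>UNIV. \<Delta> w u z * \<Delta> u x y) = (\<Sum>u\<in>UNIV. \<Delta> w x u * \<Delta> u y z)"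
    and counit_left: "(\<Sum>u\<in>UNIV. \<epsilon> u * \<Delta> y u x) = of_bool (x = y)"
    and counit_right: "(\<Sum>u\<in>UNIV. \<epsilon> u * \<Delta> y x u) = of_bool (x = y)"
    and bialgebra: "(\<Sum>u\<in>UNIV. C x y u * \<Delta> u p q) =
      (\<Sum>a\<in>UNIV. \<Sum>b\<in>UNIV. \<Sum>c\<in>UNIV. \<Sum>d\<in>UNIV. \<Delta> x a b * \<Delta> y c d * C a c p * C b d q)"
    and comult_unit: "(\<Sum>u\<in>UNIV. \<eta> u * \<Delta> u p q) = \<eta> p * \<eta> q"
    and counit_mult: "(\<Sum>u\<in>UNIV. \<epsilon> u * C p q u) = \<epsilon> p * \<epsilon> q"
    and counit_unit: "(\<Sum>u\<in>UNIV. \<eta> u * \<epsilon> u) = 1"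
    and antipode_left: "(\<Sum>a\<in>UNIV. \<Sum>b\<in>UNIV. \<Sum>c\<in>UNIV. \<Delta> x a b * S c a * C c b y) = \<epsilon> x * \<eta> y"
    and antipode_right: "(\<Sum>a\<in>UNIV. \<Sum>b\<in>UNIV. \<Sum>c\<in>UNIV. \<Delta> x a b * S c b * C a c y) = \<epsilon> x * \<eta> y"
    and involution: "(\<Sum>u\<in>UNIV. S x u * S u y) = of_bool (x = y)"
begin

text \<open>
  Sweedler calculus: \<open>D\<close>, \<open>M\<close>, \<open>A\<close>, \<open>U\<close> are comultiplication, multiplication, antipode and unit in
  continuation-passing style, so that \<open>D x (\<lambda>a b. F a b)\<close> stands for \<open>F(x\<^sub>1 \<otimes> x\<^sub>2)\<close> with \<open>F\<close> given on
  the basis and extended linearly.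
\<close>

definition D :: "'x \<Rightarrow> ('x \<Rightarrow> 'x \<Rightarrow> complex) \<Rightarrow> complex"
  where "D x F = (\<Sum>a\<in>UNIV. \<Sum>b\<in>UNIV. \<Delta> x a b * F a b)"

definition M :: "'x \<Rightarrow> 'x \<Rightarrow> ('x \<Rightarrow> complex) \<Rightarrow> complex"
  where "M x y G = (\<Sum>u\<in>UNIV. C x y u * G u)"

definition A :: "'x \<Rightarrow> ('x \<Rightarrow> complex) \<Rightarrow> complex"
  where "A x G = (\<Sum>y\<in>UNIV. S y x * G y)"

definition U :: "('x \<Rightarrow> complex) \<Rightarrow> complex"
  where "U G = (\<Sum>u\<in>UNIV. \<eta> u * G u)"

lemma D_scale: "D x (\<lambda>a b. k * F a b) = k * D x F" "D x (\<lambda>a b. F a b * k) = D x F * k"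
  by (simp_all add: D_def sum_distrib_left sum_distrib_right mult_ac)

lemma M_scale: "M x y (\<lambda>a. k * G a) = k * M x y G" "M x y (\<lambda>a. G a * k) = M x y G * k"
  by (simp_all add: M_def sum_distrib_left sum_distrib_right mult_ac)

lemma A_scale: "A x (\<lambda>a. k * G a) = k * A x G" "A x (\<lambda>a. G a * k) = A x G * k"
  by (simp_all add: A_def sum_distrib_left sum_distrib_right mult_ac)

lemma U_scale: "U (\<lambda>a. k * G a) = k * U G" "U (\<lambda>a. G a * k) = U G * k"
  by (simp_all add: U_def sum_distrib_left sum_distrib_right mult_ac)

lemmas scale = D_scale M_scale A_scale U_scale

lemma D_sum: "D x (\<lambda>a b. \<Sum>k\<in>I. F k a b) = (\<Sum>k\<in>I. D x (F k))"
  unfolding D_def by (simp add: sum_distrib_left sum.swap[of _ _ I])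

lemma M_sum: "M x y (\<lambda>a. \<Sum>k\<in>I. G k a) = (\<Sum>k\<in>I. M x y (G k))"
  unfolding M_def by (simp add: sum_distrib_left sum.swap[of _ _ I])

lemma A_sum: "A x (\<lambda>a. \<Sum>k\<in>I. G k a) = (\<Sum>k\<in>I. A x (G k))"
  unfolding A_def by (simp add: sum_distrib_left sum.swap[of _ _ I])

lemma U_sum: "U (\<lambda>a. \<Sum>k\<in>I. G k a) = (\<Sum>k\<in>I. U (G k))"
  unfolding U_def by (simp add: sum_distrib_left sum.swap[of _ _ I])

lemmas sums = D_sum M_sum A_sum U_sum

text \<open>These exchange laws hold because every operation is a finite linear combination of
  values of its continuation. They allow independent variables to be processed in any order.\<close>

lemma D_D: "D x (\<lambda>a b. D y (\<lambda>c d. F a b c d)) = D y (\<lambda>c d. D x (\<lambda>a b. F a b c d))"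
  by (subst (2) D_def) (simp add: sums scale, simp add: D_def)

lemma D_M: "D x (\<lambda>a b. M y z (\<lambda>c. F a b c)) = M y z (\<lambda>c. D x (\<lambda>a b. F a b c))"
  by (subst M_def) (simp add: sums scale, simp add: M_def)

lemma D_A: "D x (\<lambda>a b. A y (\<lambda>c. F a b c)) = A y (\<lambda>c. D x (\<lambda>a b. F a b c))"
  by (subst A_def) (simp add: sums scale, simp add: A_def)

lemma M_M: "M w x (\<lambda>a. M y z (\<lambda>c. F a c)) = M y z (\<lambda>c. M w x (\<lambda>a. F a c))"
  by (subst (2) M_def) (simp add: sums scale, simp add: M_def)

lemma M_A: "M w x (\<lambda>a. A y (\<lambda>c. F a c)) = A y (\<lambda>c. M w x (\<lambda>a. F a c))"
  by (subst A_def) (simp add: sums scale, simp add: A_def)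

lemma A_A: "A x (\<lambda>a. A y (\<lambda>c. F a c)) = A y (\<lambda>c. A x (\<lambda>a. F a c))"
  by (subst (2) A_def) (simp add: sums scale, simp add: A_def)

lemma D_coassoc: "D x (\<lambda>u z. D u (\<lambda>p q. T p q z)) = D x (\<lambda>p u. D u (\<lambda>q z. T p q z))"
proof -
  have "D x (\<lambda>u z. D u (\<lambda>p q. T p q z)) =
      (\<Sum>p\<in>UNIV. \<Sum>q\<in>UNIV. \<Sum>z\<in>UNIV. (\<Sum>u\<in>UNIV. \<Delta> x u z * \<Delta> u p q) * T p q z)"
    unfolding D_def sum_distrib_left sum_distrib_right mult.assoc by (rule sum_swap4)
  also have "\<dots> = (\<Sum>p\<in>UNIV. \<Sum>q\<in>UNIV. \<Sum>z\<in>UNIV. (\<Sum>u\<in>UNIV. \<Delta> x p u * \<Delta> u q z) * T p q z)"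
    by (simp add: coassoc)
  also have "\<dots> = D x (\<lambda>p u. D u (\<lambda>q z. T p q z))"
    unfolding D_def sum_distrib_left sum_distrib_right mult.assoc
    by (subst (2) sum_swap3) simp
  finally show ?thesis .
qed

lemma M_assoc: "M x y (\<lambda>u. M u z G) = M y z (\<lambda>u. M x u G)"
proof -
  have "M x y (\<lambda>u. M u z G) = (\<Sum>w\<in>UNIV. (\<Sum>u\<in>UNIV. C x y u * C u z w) * G w)"
    unfolding M_def sum_distrib_left sum_distrib_right mult.assoc by (rule sum.swap)
  also have "\<dots> = M y z (\<lambda>u. M x u G)"
    unfolding assoc M_def sum_distrib_left sum_distrib_right mult.assoc by (rule sum.swap)
  finally show ?thesis .
qed

lemma M_assoc3: "M b d (\<lambda>q. M q s (\<lambda>r. M r t G)) = M d s (\<lambda>r. M r t (\<lambda>q. M b q G))"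
  by (subst M_assoc) (simp only: M_assoc)

lemma D_counit: "D x (\<lambda>a b. \<epsilon> a * G b) = G x" "D x (\<lambda>a b. \<epsilon> b * G a) = G x"
proof -
  have "D x (\<lambda>a b. \<epsilon> a * G b) = (\<Sum>b\<in>UNIV. (\<Sum>a\<in>UNIV. \<epsilon> a * \<Delta> x a b) * G b)"
    unfolding D_def sum_distrib_right by (subst sum.swap) (simp add: mult_ac)
  then show "D x (\<lambda>a b. \<epsilon> a * G b) = G x"
    by (simp add: counit_left)
  have "D x (\<lambda>a b. \<epsilon> b * G a) = (\<Sum>a\<in>UNIV. (\<Sum>b\<in>UNIV. \<epsilon> b * \<Delta> x a b) * G a)"
    unfolding D_def sum_distrib_right by (simp add: mult_ac)
  then show "D x (\<lambda>a b. \<epsilon> b * G a) = G x"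
    by (simp add: counit_right)
qed

lemma M_unit: "U (\<lambda>u. M u x G) = G x" "U (\<lambda>u. M x u G) = G x"
proof -
  have "U (\<lambda>u. M u x G) = (\<Sum>y\<in>UNIV. (\<Sum>u\<in>UNIV. \<eta> u * C u x y) * G y)"
    unfolding U_def M_def sum_distrib_left sum_distrib_right mult.assoc by (rule sum.swap)
  then show "U (\<lambda>u. M u x G) = G x"
    by (simp add: unit_left)
  have "U (\<lambda>u. M x u G) = (\<Sum>y\<in>UNIV. (\<Sum>u\<in>UNIV. \<eta> u * C x u y) * G y)"
    unfolding U_def M_def sum_distrib_left sum_distrib_right mult.assoc by (rule sum.swap)
  then show "U (\<lambda>u. M x u G) = G x"
    by (simp add: unit_right)
qed

lemma M_D: "M x y (\<lambda>u. D u F) = D x (\<lambda>a b. D y (\<lambda>c d. M a c (\<lambda>p. M b d (\<lambda>q. F p q))))"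
proof -
  have "M x y (\<lambda>u. D u F) = (\<Sum>p\<in>UNIV. \<Sum>q\<in>UNIV. (\<Sum>u\<in>UNIV. C x y u * \<Delta> u p q) * F p q)"
    unfolding M_def D_def sum_distrib_left sum_distrib_right mult.assoc by (rule sum_swap3)
  also have "\<dots> = (\<Sum>p\<in>UNIV. \<Sum>q\<in>UNIV. D x (\<lambda>a b. D y (\<lambda>c d. C a c p * (C b d q * F p q))))"
    unfolding bialgebra D_def by (simp add: sum_distrib_left sum_distrib_right mult_ac)
  also have "\<dots> = D x (\<lambda>a b. D y (\<lambda>c d. M a c (\<lambda>p. M b d (\<lambda>q. F p q))))"
    unfolding M_def by (simp add: sums sum_distrib_left)
  finally show ?thesis .
qed

lemma U_D: "U (\<lambda>u. D u F) = U (\<lambda>p. U (\<lambda>q. F p q))"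
proof -
  have "U (\<lambda>u. D u F) = (\<Sum>p\<in>UNIV. \<Sum>q\<in>UNIV. (\<Sum>u\<in>UNIV. \<eta> u * \<Delta> u p q) * F p q)"
    unfolding U_def D_def sum_distrib_left sum_distrib_right mult.assoc by (rule sum_swap3)
  then show ?thesis
    unfolding comult_unit U_def by (simp add: sum_distrib_left mult_ac)
qed

lemma M_counit: "M x y \<epsilon> = \<epsilon> x * \<epsilon> y"
  unfolding M_def by (simp add: counit_mult[symmetric] mult_ac)

lemma U_counit: "U \<epsilon> = 1"
  unfolding U_def by (simp add: counit_unit)

lemma D_antipode: "D x (\<lambda>a b. A a (\<lambda>c. M c b G)) = \<epsilon> x * U G"
    "D x (\<lambda>a b. A b (\<lambda>c. M a c G)) = \<epsilon> x * U G"
proof -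
  have "D x (\<lambda>a b. A a (\<lambda>c. M c b G)) =
      (\<Sum>y\<in>UNIV. \<Sum>a\<in>UNIV. \<Sum>b\<in>UNIV. \<Sum>c\<in>UNIV. \<Delta> x a b * S c a * C c b y * G y)"
    unfolding D_def A_def M_def sum_distrib_left mult.assoc
    by (rule sum_swap4')
  then show "D x (\<lambda>a b. A a (\<lambda>c. M c b G)) = \<epsilon> x * U G"
    unfolding U_def by (simp only: sum_distrib_right[symmetric] antipode_left) (simp add: sum_distrib_left mult_ac)
  have "D x (\<lambda>a b. A b (\<lambda>c. M a c G)) =
      (\<Sum>y\<in>UNIV. \<Sum>a\<in>UNIV. \<Sum>b\<in>UNIV. \<Sum>c\<in>UNIV. \<Delta> x a b * S c b * C a c y * G y)"
    unfolding D_def A_def M_def sum_distrib_left mult.assoc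
    by (rule sum_swap4')
  then show "D x (\<lambda>a b. A b (\<lambda>c. M a c G)) = \<epsilon> x * U G"
    unfolding U_def by (simp only: sum_distrib_right[symmetric] antipode_right) (simp add: sum_distrib_left mult_ac)
qed

section \<open>The antipode as an involutory anti-automorphism\<close>

lemma A_A_id: "A x (\<lambda>y. A y G) = G x"
proof -
  have "A x (\<lambda>y. A y G) = (\<Sum>z\<in>UNIV. (\<Sum>y\<in>UNIV. S z y * S y x) * G z)"
    unfolding A_def sum_distrib_left sum_distrib_right by (subst sum.swap) (simp add: mult_ac)
  then show ?thesis
    by (simp add: involution)
qed

lemma U_A: "U (\<lambda>u. A y (\<lambda>c. F u c)) = A y (\<lambda>c. U (\<lambda>u. F u c))"
  by (subst A_def) (simp add: sums scale, simp add: A_def)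

text \<open>Uniqueness of convolution inverses, made explicit: S(y) S(x) is expanded to S(x1 y1) x2
  y2 S(y3) S(x3), and the inner pairs y2 S(y3) and then x2 S(x3) cancel, leaving S(x y).\<close>

lemma A_mult: "M x y (\<lambda>u. A u G) = A y (\<lambda>s. A x (\<lambda>t. M s t G))"
proof -
  define \<Phi> where "\<Phi> x2 y2 z = A y2 (\<lambda>s. A x2 (\<lambda>t. M s t (\<lambda>w. M z w G)))" for x2 y2 z
  have U\<Phi>: "U (\<lambda>z. \<Phi> x2 y2 z) = A y2 (\<lambda>s. A x2 (\<lambda>t. M s t G))" for x2 y2
  proof -
    have "U (\<lambda>z. \<Phi> x2 y2 z) = A y2 (\<lambda>s. A x2 (\<lambda>t. U (\<lambda>z. M s t (\<lambda>w. M z w G))))"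
      by (simp only: \<Phi>_def U_A)
    also have "\<dots> = A y2 (\<lambda>s. A x2 (\<lambda>t. M s t G))"
      by (simp only: M_assoc[symmetric] M_unit)
    finally show ?thesis .
  qed
  have counit: "M x1 y1 (\<lambda>u. D u (\<lambda>p q. A p (\<lambda>c. M c q (\<lambda>z. \<Phi> x2 y2 z)))) =
      \<epsilon> x1 * (\<epsilon> y1 * A y2 (\<lambda>s. A x2 (\<lambda>t. M s t G)))" for x1 x2 y1 y2
    by (simp only: D_antipode scale M_counit U\<Phi> mult.assoc)
  \<comment> \<open>Reassociation that puts \<open>d\<close> directly before \<open>s\<close>, the
    antipode of \<open>y2\<close>, so that after coassociativity \<open>D_antipode\<close> cancels
    this pair first.\<close>
  have bracket: "M b d (\<lambda>q. A p (\<lambda>e. M e q (\<lambda>z. \<Phi> x2 y2 z))) =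
      A p (\<lambda>e. A y2 (\<lambda>s. M d s (\<lambda>r. A x2 (\<lambda>t. M r t (\<lambda>q. M b q (\<lambda>v. M e v G))))))"
    for b d p x2 y2
  proof -
    have "M e q (\<lambda>z. \<Phi> x2 y2 z) = A y2 (\<lambda>s. A x2 (\<lambda>t. M q s (\<lambda>r. M r t (\<lambda>v. M e v G))))" for e q
    proof -
      have "M e q (\<lambda>z. \<Phi> x2 y2 z) = A y2 (\<lambda>s. A x2 (\<lambda>t. M s t (\<lambda>w. M e q (\<lambda>z. M z w G))))"
        by (simp only: \<Phi>_def M_A M_M[of e q])
      also have "\<dots> = A y2 (\<lambda>s. A x2 (\<lambda>t. M s t (\<lambda>w. M q w (\<lambda>v. M e v G))))"
        by (simp only: M_assoc)
      finally show ?thesis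
        by (simp only: M_assoc)
    qed
    then have "M b d (\<lambda>q. A p (\<lambda>e. M e q (\<lambda>z. \<Phi> x2 y2 z))) =
      A p (\<lambda>e. A y2 (\<lambda>s. A x2 (\<lambda>t. M b d (\<lambda>q. M q s (\<lambda>r. M r t (\<lambda>v. M e v G))))))"
      by (simp only: M_A)
    also have "\<dots> = A p (\<lambda>e. A y2 (\<lambda>s. A x2 (\<lambda>t. M d s (\<lambda>r. M r t (\<lambda>q. M b q (\<lambda>v. M e v G))))))"
      by (simp only: M_assoc3)
    finally show ?thesis
      by (simp only: M_A)
  qed
  have "A y (\<lambda>s. A x (\<lambda>t. M s t G)) =
      D x (\<lambda>x1 x2. \<epsilon> x1 * D y (\<lambda>y1 y2. \<epsilon> y1 * A y2 (\<lambda>s. A x2 (\<lambda>t. M s t G))))"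
    by (simp only: D_counit)
  also have "\<dots> = D x (\<lambda>x1 x2. D y (\<lambda>y1 y2. M x1 y1 (\<lambda>u. D u (\<lambda>p q. A p (\<lambda>c. M c q (\<lambda>z. \<Phi> x2 y2 z))))))"
    by (simp only: counit scale)
  also have "\<dots> = D x (\<lambda>x1 x2. D x1 (\<lambda>a b. D y (\<lambda>y1 y2. D y1 (\<lambda>c d. M a c (\<lambda>p. M b d (\<lambda>q.
      A p (\<lambda>c. M c q (\<lambda>z. \<Phi> x2 y2 z))))))))"
    by (simp only: M_D D_D[of y])
  also have "\<dots> = D x (\<lambda>a x'. D x' (\<lambda>b x2. D y (\<lambda>c y'. D y' (\<lambda>d y2. M a c (\<lambda>p.
      A p (\<lambda>e. A y2 (\<lambda>s. M d s (\<lambda>r. A x2 (\<lambda>t. M r t (\<lambda>q. M b q (\<lambda>v. M e v G))))))))))) "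
    by (simp only: D_coassoc bracket)
  also have "\<dots> = D x (\<lambda>a x'. D x' (\<lambda>b x2. D y (\<lambda>c y'. M a c (\<lambda>p. A p (\<lambda>e.
      D y' (\<lambda>d y2. A y2 (\<lambda>s. M d s (\<lambda>r. A x2 (\<lambda>t. M r t (\<lambda>q. M b q (\<lambda>v. M e v G)))))))))))"
    by (simp only: D_M D_A)
  also have "\<dots> = D x (\<lambda>a x'. D x' (\<lambda>b x2. M a y (\<lambda>p. A p (\<lambda>e. A x2 (\<lambda>t. M b t (\<lambda>v. M e v G))))))"
    by (simp only: D_antipode scale D_counit U_A M_unit)
  also have "\<dots> = D x (\<lambda>a x'. M a y (\<lambda>p. A p (\<lambda>e. D x' (\<lambda>b x2. A x2 (\<lambda>t. M b t (\<lambda>v. M e v G))))))"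
    by (simp only: D_M D_A)
  also have "\<dots> = M x y (\<lambda>u. A u G)"
    by (simp only: D_antipode scale D_counit M_unit)
  finally show ?thesis ..
qed

lemma A_unit: "U (\<lambda>u. A u G) = U G"
proof -
  have "U (\<lambda>x. D x (\<lambda>a b. A a (\<lambda>c. M c b G))) = U G"
    by (simp only: D_antipode scale U_counit mult_1)
  then show ?thesis
    by (simp only: U_D U_A M_unit)
qed

text \<open>Applying S to S(x1) x2 reverses the product to S(x2) S(S(x1)), which is S(x2) x1 as S is
  an involution. For a general bijective antipode the inverse of S would stand here.\<close>

lemma D_skew_antipode: "D x (\<lambda>a b. A b (\<lambda>c. M c a G)) = \<epsilon> x * U G"
proof -
  have "A a (\<lambda>c. M c b (\<lambda>t. A t G)) = A b (\<lambda>s. M s a G)" for a b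
    by (simp only: A_mult, subst A_A) (simp only: A_A_id)
  then have "D x (\<lambda>a b. A b (\<lambda>s. M s a G)) = D x (\<lambda>a b. A a (\<lambda>c. M c b (\<lambda>t. A t G)))"
    by (simp only:)
  then show ?thesis
    by (simp only: D_antipode A_unit)
qed

text \<open>The coordinate form of \<open>A_mult\<close>, which \<open>dual\<close> turns into
  compatibility of S with the coproduct (\<open>A_D\<close>).\<close>

lemma A_mult_index: "(\<Sum>u\<in>UNIV. C x y u * S v u) = (\<Sum>s\<in>UNIV. \<Sum>t\<in>UNIV. S s y * S t x * C s t v)"
  using A_mult[of x y "\<lambda>w. of_bool (w = v)"]
  by (simp add: A_def M_def of_bool_def if_distrib cong: if_cong)
     (simp add: sum_distrib_left mult_ac)

text \<open>Reading every tensor backwards exchanges product and coproduct, unit and counit, so each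
  identity proved in this locale also holds in transposed form.\<close>

lemma dual: "hopf_tensors (\<lambda>x y z. \<Delta> z x y) \<epsilon> (\<lambda>x y z. C y z x) \<eta> (\<lambda>x y. S y x)"
proof
  fix x y z w p q
  show "(\<Sum>u\<in>UNIV. \<Delta> u x y * \<Delta> w u z) = (\<Sum>u\<in>UNIV. \<Delta> u y z * \<Delta> w x u)"
    using coassoc[of w z x y] by (simp add: mult_ac)
  show "(\<Sum>u\<in>UNIV. C u z w * C x y u) = (\<Sum>u\<in>UNIV. C x u w * C y z u)"
    using assoc[of x y z w] by (simp add: mult_ac)
  show "(\<Sum>u\<in>UNIV. \<Delta> u x y * C p q u) =
       (\<Sum>a\<in>UNIV. \<Sum>b\<in>UNIV. \<Sum>c\<in>UNIV. \<Sum>d\<in>UNIV. C a b x * C c d y * \<Delta> p a c * \<Delta> q b d)"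
    unfolding mult.commute[of "\<Delta> _ x y"] bialgebra
    by (rule sum.cong[OF refl], subst sum.swap) (simp add: mult_ac)
  show "(\<Sum>u\<in>UNIV. \<epsilon> u * \<eta> u) = 1"
    using counit_unit by (simp add: mult.commute)
  show "(\<Sum>u\<in>UNIV. S u x * S y u) = of_bool (x = y)"
    using involution[of y x] by (simp add: mult.commute eq_commute)
  have "(\<Sum>a\<in>UNIV. \<Sum>b\<in>UNIV. \<Sum>c\<in>UNIV. C a b x * S a c * \<Delta> y c b) =
      (\<Sum>c\<in>UNIV. \<Sum>b\<in>UNIV. \<Sum>a\<in>UNIV. \<Delta> y c b * S a c * C a b x)"
    by (subst sum_swap3, subst sum.swap) (simp add: mult_ac)
  then show "(\<Sum>a\<in>UNIV. \<Sum>b\<in>UNIV. \<Sum>c\<in>UNIV. C a b x * S a c * \<Delta> y c b) = \<eta> x * \<epsilon> y"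
    by (simp only: antipode_left) (rule mult.commute)
  have "(\<Sum>a\<in>UNIV. \<Sum>b\<in>UNIV. \<Sum>c\<in>UNIV. C a b x * S b c * \<Delta> y a c) =
      (\<Sum>a\<in>UNIV. \<Sum>c\<in>UNIV. \<Sum>b\<in>UNIV. \<Delta> y a c * S b c * C a b x)"
    by (rule sum.cong[OF refl], subst sum.swap) (simp add: mult_ac)
  then show "(\<Sum>a\<in>UNIV. \<Sum>b\<in>UNIV. \<Sum>c\<in>UNIV. C a b x * S b c * \<Delta> y a c) = \<eta> x * \<epsilon> y"
    by (simp only: antipode_right) (rule mult.commute)
qed (rule counit_left counit_right unit_left unit_right comult_unit counit_mult)+

text \<open>The traces of right and of left multiplication; they coincide (\<open>trl_eq_tr\<close>) as \<open>S\<^sup>2 = id\<close>.\<close>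

definition tr :: "'x \<Rightarrow> complex"
  where "tr x = (\<Sum>k\<in>UNIV. M k x (\<lambda>u. of_bool (u = k)))"

definition trl :: "'x \<Rightarrow> complex"
  where "trl x = (\<Sum>k\<in>UNIV. M x k (\<lambda>u. of_bool (u = k)))"

section \<open>The trace as a two-sided integral\<close>

text \<open>Cyclicity of a partial trace: P and Q may emit extra outputs \<open>r\<close> and
  \<open>s\<close>, which are passed on to H. In \<open>tr_integral\<close> such an output carries
  the second tensor factor.\<close>

lemma trace_cyclic:
  fixes p :: "'x \<Rightarrow> 'x \<Rightarrow> 'r::finite \<Rightarrow> complex" and q :: "'x \<Rightarrow> 'x \<Rightarrow> 's::finite \<Rightarrow> complex"
  assumes P: "\<And>k F. P k F = (\<Sum>m\<in>UNIV. \<Sum>r\<in>UNIV. p k m r * F m r)"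
    and Q: "\<And>m F. Q m F = (\<Sum>k\<in>UNIV. \<Sum>s\<in>UNIV. q m k s * F k s)"
  shows "(\<Sum>k\<in>UNIV. P k (\<lambda>m r. Q m (\<lambda>k' s. of_bool (k' = k) * H r s))) =
    (\<Sum>m\<in>UNIV. Q m (\<lambda>k s. P k (\<lambda>m' r. of_bool (m' = m) * H r s)))"
proof -
  have Q': "Q m (\<lambda>k' s. of_bool (k' = k) * H r s) = (\<Sum>s\<in>UNIV. q m k s * H r s)" for k m r
    unfolding Q by (subst sum.swap) (simp add: sum_of_bool_mult)
  have P': "P k (\<lambda>m' r. of_bool (m' = m) * H r s) = (\<Sum>r\<in>UNIV. p k m r * H r s)" for k m s
    unfolding P by (subst sum.swap) (simp add: sum_of_bool_mult)
  have "(\<Sum>k\<in>UNIV. P k (\<lambda>m r. Q m (\<lambda>k' s. of_bool (k' = k) * H r s))) =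
      (\<Sum>k\<in>UNIV. \<Sum>m\<in>UNIV. \<Sum>r\<in>UNIV. \<Sum>s\<in>UNIV. p k m r * (q m k s * H r s))"
    unfolding Q' unfolding P sum_distrib_left ..
  also have "\<dots> = (\<Sum>m\<in>UNIV. \<Sum>k\<in>UNIV. \<Sum>s\<in>UNIV. \<Sum>r\<in>UNIV. p k m r * (q m k s * H r s))"
    by (subst sum.swap) (subst (3) sum.swap, rule refl)
  also have "\<dots> = (\<Sum>m\<in>UNIV. Q m (\<lambda>k s. P k (\<lambda>m' r. of_bool (m' = m) * H r s)))"
    unfolding P' unfolding Q sum_distrib_left by (simp add: mult_ac)
  finally show ?thesis .
qed

lemma trace_cyclic':
  fixes p q :: "'x \<Rightarrow> 'x \<Rightarrow> complex"
  assumes P: "\<And>k F. P k F = (\<Sum>m\<in>UNIV. p k m * F m)"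
    and Q: "\<And>m F. Q m F = (\<Sum>k\<in>UNIV. q m k * F k)"
  shows "(\<Sum>k\<in>UNIV. P k (\<lambda>m. Q m (\<lambda>k'. of_bool (k' = k)))) =
    (\<Sum>m\<in>UNIV. Q m (\<lambda>k. P k (\<lambda>m'. of_bool (m' = m))))"
  using trace_cyclic[of "\<lambda>k F. P k (\<lambda>m. F m ())" "\<lambda>k m _. p k m"
      "\<lambda>m F. Q m (\<lambda>k. F k ())" "\<lambda>m k _. q m k" "\<lambda>_ _. 1"]
  by (simp add: P Q UNIV_unit)

lemma M_A_eq: "M x m (\<lambda>u. A u F) = (\<Sum>k\<in>UNIV. (\<Sum>u\<in>UNIV. C x m u * S k u) * F k)"
  unfolding M_def A_def sum_distrib_left sum_distrib_right by (subst sum.swap) (simp add: mult_ac)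

lemma D_M_eq: "D k (\<lambda>k1 k2. M k1 x (\<lambda>m. F m k2)) =
    (\<Sum>m\<in>UNIV. \<Sum>r\<in>UNIV. (\<Sum>a\<in>UNIV. \<Delta> k a r * C a x m) * F m r)"
  unfolding D_def M_def sum_distrib_left sum_distrib_right
  by (subst sum_swap3, subst sum.swap, subst sum_swap3) (simp add: mult_ac)

text \<open>
  Up to the trace, right multiplication by \<open>x\<^sub>1\<close> tensored with \<open>x\<^sub>2\<close> is conjugate to right
  multiplication by \<open>x\<close>, since
  \<open>a x\<^sub>1 \<otimes> x\<^sub>2 = (a\<^sub>1 x)\<^sub>1 \<otimes> S(a\<^sub>2) (a\<^sub>1 x)\<^sub>2\<close>. This is where \<open>S\<^sup>2 = id\<close> enters.
\<close>

lemma M_D_conjugate: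
  "D x (\<lambda>a b. M k a (\<lambda>u. G u b)) =
   D k (\<lambda>k1 k2. M k1 x (\<lambda>m. D m (\<lambda>m1 m2. A k2 (\<lambda>s. M s m2 (\<lambda>t. G m1 t)))))"
proof -
  have "D k (\<lambda>k1 k2. M k1 x (\<lambda>m. D m (\<lambda>m1 m2. A k2 (\<lambda>s. M s m2 (\<lambda>t. G m1 t))))) =
    D k (\<lambda>k1 k2. D k1 (\<lambda>p q. D x (\<lambda>a b. M p a (\<lambda>m1. A k2 (\<lambda>s. M q b (\<lambda>m2. M s m2 (\<lambda>t. G m1 t)))))))"
    by (simp only: M_D M_A)
  also have "\<dots> = D k (\<lambda>p u. D u (\<lambda>q k2. D x (\<lambda>a b. M p a (\<lambda>m1. A k2 (\<lambda>s. M s q (\<lambda>w. M w b (\<lambda>t. G m1 t)))))))"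
    by (simp only: D_coassoc M_assoc)
  also have "\<dots> = D k (\<lambda>p u. D x (\<lambda>a b. M p a (\<lambda>m1. D u (\<lambda>q k2. A k2 (\<lambda>s. M s q (\<lambda>w. M w b (\<lambda>t. G m1 t)))))))"
  proof -
    have "D u (\<lambda>q k2. D x (\<lambda>a b. M p a (\<lambda>m1. A k2 (\<lambda>s. M s q (\<lambda>w. M w b (\<lambda>t. G m1 t)))))) =
        D x (\<lambda>a b. M p a (\<lambda>m1. D u (\<lambda>q k2. A k2 (\<lambda>s. M s q (\<lambda>w. M w b (\<lambda>t. G m1 t))))))" for p u
      by (subst D_D) (simp only: D_M)
    then show ?thesis
      by (simp only:)
  qed
  also have "\<dots> = D x (\<lambda>a b. M k a (\<lambda>u. G u b))"
    by (simp only: D_skew_antipode M_unit scale D_counit)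
  finally show ?thesis ..
qed

text \<open>After conjugation, cyclicity of the trace moves the coproduct of m in front of that of
  k. Coassociativity then makes S(k2) m2 an antipode pair, which collapses to counit and unit and
  leaves the trace of right multiplication by x.\<close>

lemma tr_integral: "D x (\<lambda>a b. tr a * f b) = tr x * U f"
proof -
  have "D x (\<lambda>a b. tr a * f b) = (\<Sum>k\<in>UNIV. D x (\<lambda>a b. M k a (\<lambda>u. of_bool (u = k) * f b)))"
    unfolding tr_def sum_distrib_right by (simp only: sums scale)
  also have "\<dots> = (\<Sum>k\<in>UNIV. D k (\<lambda>k1 k2. M k1 x (\<lambda>m. D m (\<lambda>m1 m2.
      of_bool (m1 = k) * A k2 (\<lambda>s. M s m2 f)))))"
    by (subst M_D_conjugate) (simp only: scale)
  also have "\<dots> = (\<Sum>m\<in>UNIV. D m (\<lambda>m1 m2. D m1 (\<lambda>k1 k2. M k1 x (\<lambda>m'.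
      of_bool (m' = m) * A k2 (\<lambda>s. M s m2 f)))))"
    by (rule trace_cyclic[where P = "\<lambda>k F. D k (\<lambda>k1 k2. M k1 x (\<lambda>m. F m k2))" and Q = D,
          OF D_M_eq D_def])
  also have "\<dots> = (\<Sum>m\<in>UNIV. D m (\<lambda>k1 u. M k1 x (\<lambda>m'. of_bool (m' = m) *
      D u (\<lambda>k2 m2. A k2 (\<lambda>s. M s m2 f)))))"
    by (simp only: D_coassoc D_M D_scale)
  also have "\<dots> = tr x * U f"
    unfolding tr_def sum_distrib_right by (simp only: D_antipode scale mult.assoc[symmetric] D_counit)
       (simp only: mult.commute[of _ "\<epsilon> _"] scale D_counit mult.assoc)
  finally show ?thesis .
qed

text \<open>S conjugates right multiplication by S(x) into left multiplication by x, since k S(x) =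
  S(x S(k)).\<close>

lemma tr_antipode_trl: "A x tr = trl x"
proof -
  have "A x tr = (\<Sum>k\<in>UNIV. A x (\<lambda>s. M k s (\<lambda>u. of_bool (u = k))))"
    unfolding tr_def by (simp only: sums)
  also have "\<dots> = (\<Sum>k\<in>UNIV. A k (\<lambda>k'. M x k' (\<lambda>u. A u (\<lambda>v. of_bool (v = k)))))"
    by (simp only: A_mult A_A_id)
  also have "\<dots> = (\<Sum>m\<in>UNIV. M x m (\<lambda>u. A u (\<lambda>k. A k (\<lambda>m'. of_bool (m' = m)))))"
    by (rule trace_cyclic'[where P = A and Q = "\<lambda>m F. M x m (\<lambda>u. A u F)", OF A_def M_A_eq])
  also have "\<dots> = trl x"
    by (simp only: A_A_id trl_def)
  finally show ?thesis .
qed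

lemma A_D: "A v (\<lambda>u. D u F) = D v (\<lambda>s t. A s (\<lambda>y. A t (\<lambda>x. F x y)))"
proof -
  have index: "(\<Sum>u\<in>UNIV. \<Delta> u x y * S u v) = (\<Sum>s\<in>UNIV. \<Sum>t\<in>UNIV. S y s * S x t * \<Delta> v s t)" for x y
    using hopf_tensors.A_mult_index[OF dual] .
  have "A v (\<lambda>u. D u F) = (\<Sum>x\<in>UNIV. \<Sum>y\<in>UNIV. (\<Sum>u\<in>UNIV. \<Delta> u x y * S u v) * F x y)"
    unfolding A_def D_def sum_distrib_left sum_distrib_right by (subst sum_swap3) (simp add: mult_ac)
  also have "\<dots> = (\<Sum>x\<in>UNIV. \<Sum>y\<in>UNIV. D v (\<lambda>s t. S y s * (S x t * F x y)))"
    unfolding index D_def by (simp add: sum_distrib_left sum_distrib_right mult_ac)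
  also have "\<dots> = D v (\<lambda>s t. A s (\<lambda>y. A t (\<lambda>x. F x y)))"
    unfolding A_def sum_distrib_left by (subst sum.swap) (simp add: sums)
  finally show ?thesis .
qed

lemma trl_integral: "D x (\<lambda>a b. f a * trl b) = trl x * U f"
proof -
  have "D x (\<lambda>a b. f a * trl b) = D x (\<lambda>a b. A a (\<lambda>q. A b (\<lambda>p. tr p * A q f)))"
    by (simp only: tr_antipode_trl[symmetric] scale A_A_id mult.commute)
  also have "\<dots> = A x (\<lambda>u. D u (\<lambda>p q. tr p * A q f))"
    by (simp only: A_D)
  also have "\<dots> = trl x * U f"
    by (simp only: tr_integral scale tr_antipode_trl A_unit)
  finally show ?thesis .
qed

lemma U_tr: "U tr = of_nat CARD('x)" "U trl = of_nat CARD('x)"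
  unfolding tr_def trl_def by (simp_all only: sums M_unit) simp_all

text \<open>The convolution of \<open>tr\<close> with \<open>trl\<close> is evaluated twice:
  \<open>tr\<close> is an integral from one side, \<open>trl\<close> from the other, and both take
  the nonzero value dim A at the unit.\<close>

lemma trl_eq_tr: "trl = tr"
proof
  fix x
  have "tr x * U trl = trl x * U tr"
    using tr_integral[of x trl] trl_integral[of x tr] by simp
  then show "trl x = tr x"
    by (simp add: U_tr)
qed

lemma A_tr: "A x tr = tr x"
  by (simp add: tr_antipode_trl trl_eq_tr)

lemma D_tr_tr: "D x (\<lambda>a b. tr a * tr b) = of_nat CARD('x) * tr x"
  by (simp add: tr_integral U_tr)

lemma tr_integral': "D x (\<lambda>a b. f a * tr b) = tr x * U f"
  using trl_integral by (simp add: trl_eq_tr)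

lemma tr_commute: "M x y tr = M y x tr"
proof -
  have "M x y tr = (\<Sum>k\<in>UNIV. M k x (\<lambda>v. M v y (\<lambda>u. of_bool (u = k))))"
    unfolding tr_def by (simp only: sums M_assoc)
  also have "\<dots> = (\<Sum>m\<in>UNIV. M m y (\<lambda>v. M v x (\<lambda>u. of_bool (u = m))))"
    by (rule trace_cyclic'[where P = "\<lambda>k. M k x" and Q = "\<lambda>m. M m y", OF M_def M_def])
  also have "\<dots> = M y x tr"
    unfolding tr_def by (simp only: sums M_assoc)
  finally show ?thesis .
qed

definition tr3 :: "'x \<Rightarrow> 'x \<Rightarrow> 'x \<Rightarrow> complex"
  where "tr3 x y z = M x y (\<lambda>u. M u z tr)"

lemma tr3_cyclic: "tr3 x y z = tr3 y z x"
proof -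
  have "tr3 x y z = M y z (\<lambda>u. M x u tr)"
    by (simp only: tr3_def M_assoc)
  then show ?thesis
    by (simp only: tr3_def tr_commute[of x])
qed

lemma tr3_reverse: "tr3 x y z = A x (\<lambda>x'. A y (\<lambda>y'. A z (\<lambda>z'. tr3 z' y' x')))"
proof -
  have "tr3 x y z = M x y (\<lambda>u. M u z (\<lambda>t. A t tr))"
    by (simp only: tr3_def A_tr)
  also have "\<dots> = A z (\<lambda>z'. A y (\<lambda>y'. A x (\<lambda>x'. M y' x' (\<lambda>t. M z' t tr))))"
    by (simp only: A_mult M_A)
  also have "\<dots> = A z (\<lambda>z'. A y (\<lambda>y'. A x (\<lambda>x'. tr3 z' y' x')))"
    by (simp only: tr3_def M_assoc)
  also have "\<dots> = A y (\<lambda>y'. A x (\<lambda>x'. A z (\<lambda>z'. tr3 z' y' x')))"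
    by (subst A_A) (subst (2) A_A, rule refl)
  also have "\<dots> = A x (\<lambda>x'. A y (\<lambda>y'. A z (\<lambda>z'. tr3 z' y' x')))"
    by (rule A_A)
  finally show ?thesis .
qed

text \<open>Reversal by S, with S applied once more to one index: an antipode on one edge of a
  triangle equals antipodes on the other two edges of the oppositely oriented triangle. This makes
  the orientation chosen for a face immaterial.\<close>

lemma tr3_flip: "A a3 (\<lambda>d. tr3 b1 b2 d) = A b1 (\<lambda>c1. A b2 (\<lambda>c2. tr3 c2 c1 a3))"
proof -
  have "A a3 (\<lambda>d. tr3 b1 b2 d) = A a3 (\<lambda>d. A d (\<lambda>z. A b1 (\<lambda>c1. A b2 (\<lambda>c2. tr3 z c2 c1))))"
    by (subst tr3_reverse) (subst A_A, subst (2) A_A, rule refl)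
  also have "\<dots> = A b1 (\<lambda>c1. A b2 (\<lambda>c2. tr3 a3 c2 c1))"
    by (rule A_A_id)
  finally show ?thesis
    by (simp only: tr3_cyclic[of a3])
qed

text \<open>
  The pillow: two parallel triangles with opposite orientations collapse to one, because
  \<open>tr\<close> is idempotent up to the factor \<open>dim A\<close> for the convolution product.
\<close>

lemma tr3_pillow:
  "D w1 (\<lambda>a1 b1. D w2 (\<lambda>a2 b2. D w3 (\<lambda>a3 b3. A b1 (\<lambda>c1. A b2 (\<lambda>c2. A b3 (\<lambda>c3.
     tr3 c2 c1 a3 * tr3 a1 a2 c3)))))) = of_nat CARD('x) * A w3 (\<lambda>y. tr3 w1 w2 y)"
proof -
  have prod: "A b3 (\<lambda>c3. tr3 a1 a2 c3) * A a3 (\<lambda>d. tr3 b1 b2 d) =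
      A b1 (\<lambda>c1. A b2 (\<lambda>c2. A b3 (\<lambda>c3. tr3 c2 c1 a3 * tr3 a1 a2 c3)))" for a1 a2 a3 b1 b2 b3
    by (simp only: tr3_flip[of a3] scale) (rule mult.commute)
  \<comment> \<open>For v = w1 w2 S(w3) the factor dim A times tr(v) is opened up as tr(v1) tr(v2).
    Multiplicativity of the coproduct and its reversal by S then split all three indices.\<close>
  have "of_nat CARD('x) * A w3 (\<lambda>y. tr3 w1 w2 y) =
      A w3 (\<lambda>y. M w1 w2 (\<lambda>u. M u y (\<lambda>v. D v (\<lambda>p q. tr p * tr q))))"
    by (simp only: D_tr_tr tr3_def scale)
  also have "\<dots> = M w1 w2 (\<lambda>u. D u (\<lambda>a b. A w3 (\<lambda>y. D y (\<lambda>c d. M a c tr * M b d tr))))"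
    by (simp only: M_D M_A[symmetric] D_A[symmetric] scale)
  also have "\<dots> = D w1 (\<lambda>a1 b1. D w2 (\<lambda>a2 b2. D w3 (\<lambda>a3 b3. A b3 (\<lambda>c3. tr3 a1 a2 c3) * A a3 (\<lambda>d. tr3 b1 b2 d))))"
    by (simp only: M_D A_D tr3_def scale M_A D_M[symmetric])
  finally show ?thesis
    by (simp only: prod)
qed

section \<open>The cointegral and the inverse of the trace form\<close>

text \<open>G is evaluated on the element of A that is the trace of the dual algebra. By
  \<open>coint_M\<close> this element is a two-sided integral in A.\<close>

definition coint :: "('x \<Rightarrow> complex) \<Rightarrow> complex"
  where "coint G = (\<Sum>x\<in>UNIV. (\<Sum>k\<in>UNIV. \<Delta> k k x) * G x)"

lemma coint_index:
  "(\<Sum>a\<in>UNIV. \<Sum>b\<in>UNIV. C a b x * ((\<Sum>k\<in>UNIV. \<Delta> k k a) * f b)) =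
     (\<Sum>k\<in>UNIV. \<Delta> k k x) * (\<Sum>u\<in>UNIV. \<epsilon> u * f u)" (is ?right)
  "(\<Sum>a\<in>UNIV. \<Sum>b\<in>UNIV. C a b x * (f a * (\<Sum>k\<in>UNIV. \<Delta> k k b))) =
     (\<Sum>k\<in>UNIV. \<Delta> k k x) * (\<Sum>u\<in>UNIV. \<epsilon> u * f u)" (is ?left)
proof -
  interpret d: hopf_tensors "\<lambda>x y z. \<Delta> z x y" \<epsilon> "\<lambda>x y z. C y z x" \<eta> "\<lambda>x y. S y x"
    by (rule dual)
  have tr: "d.tr x = (\<Sum>k\<in>UNIV. \<Delta> k k x)" for x
    by (simp add: d.tr_def d.M_def sum_of_bool_mult[where g = "\<lambda>_. 1", simplified])
  show ?right
    using d.tr_integral[of x f] by (simp add: tr d.D_def d.U_def)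
  show ?left
    using d.tr_integral'[of x f] by (simp add: tr d.D_def d.U_def)
qed

lemma coint_scale: "coint (\<lambda>a. k * G a) = k * coint G" "coint (\<lambda>a. G a * k) = coint G * k"
  by (simp_all add: coint_def sum_distrib_left sum_distrib_right mult_ac)

lemma coint_D: "coint (\<lambda>l. D x (\<lambda>a b. F l a b)) = D x (\<lambda>a b. coint (\<lambda>l. F l a b))"
  by (simp only: coint_def sums scale)

lemma coint_M: "coint (\<lambda>l. M l y G) = \<epsilon> y * coint G" "coint (\<lambda>l. M y l G) = \<epsilon> y * coint G"
proof -
  have "coint (\<lambda>l. M l y G) = (\<Sum>x\<in>UNIV. (\<Sum>a\<in>UNIV. C a y x * (\<Sum>k\<in>UNIV. \<Delta> k k a)) * G x)"
    unfolding coint_def M_def sum_distrib_left[where r = "\<Sum>k\<in>UNIV. \<Delta> k k _"] sum_distrib_right[where r = "G _"]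
    by (subst sum.swap) (simp add: mult_ac)
  also have "\<dots> = (\<Sum>x\<in>UNIV. ((\<Sum>k\<in>UNIV. \<Delta> k k x) * \<epsilon> y) * G x)"
    using coint_index(1)[of _ "\<lambda>b. of_bool (b = y)"]
    by (simp add: sum_of_bool_mult[where g = "\<lambda>_. 1", simplified] mult.assoc[symmetric])
  finally show "coint (\<lambda>l. M l y G) = \<epsilon> y * coint G"
    by (simp add: coint_def sum_distrib_left mult_ac)
  have "coint (\<lambda>l. M y l G) = (\<Sum>x\<in>UNIV. (\<Sum>b\<in>UNIV. C y b x * (\<Sum>k\<in>UNIV. \<Delta> k k b)) * G x)"
    unfolding coint_def M_def sum_distrib_left[where r = "\<Sum>k\<in>UNIV. \<Delta> k k _"] sum_distrib_right[where r = "G _"]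
    by (subst sum.swap) (simp add: mult_ac)
  also have "\<dots> = (\<Sum>x\<in>UNIV. ((\<Sum>k\<in>UNIV. \<Delta> k k x) * \<epsilon> y) * G x)"
  proof -
    have "(\<Sum>b\<in>UNIV. C y b x * (\<Sum>k\<in>UNIV. \<Delta> k k b)) =
       (\<Sum>a\<in>UNIV. \<Sum>b\<in>UNIV. C a b x * (of_bool (a = y) * (\<Sum>k\<in>UNIV. \<Delta> k k b)))" for x
      by (subst sum.swap) (simp add: sum_of_bool_mult)
    then show ?thesis
      by (simp add: coint_index(2) sum_of_bool_mult[where g = "\<lambda>_. 1", simplified])
  qed
  finally show "coint (\<lambda>l. M y l G) = \<epsilon> y * coint G"
    by (simp add: coint_def sum_distrib_left mult_ac)
qed

text \<open>Multiplying the integral by a basis element k leaves the factor \<epsilon>(k), so the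
  pairing reduces to the counit of the integral, which the counit axiom turns into the trace of the
  identity.\<close>

lemma coint_tr: "coint tr = of_nat CARD('x)"
proof -
  have "coint tr = (\<Sum>k\<in>UNIV. \<epsilon> k * (\<Sum>j\<in>UNIV. \<Delta> j j k))"
    unfolding tr_def coint_def sum_distrib_left[of "sum _ _"]
    apply (subst sum.swap)
    apply (fold coint_def)
    apply (simp only: coint_M)
    apply (simp add: coint_def sum_of_bool_mult[where g = "\<lambda>_. 1", simplified])
    done
  also have "\<dots> = (\<Sum>j\<in>UNIV. \<Sum>k\<in>UNIV. \<epsilon> k * \<Delta> j j k)"
    unfolding sum_distrib_left by (rule sum.swap)
  finally show ?thesis
    by (simp add: counit_right)
qed

text \<open>Writing l1 x \<otimes> l2 as l1 x1 \<otimes> l2 x2 S(x3) makes the coproduct of l x1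
  appear. Invariance of the integral absorbs x1 and leaves tr(m1) G(m2 S(x)), and the integral
  property of \<open>tr\<close> separates this into tr(m) and G(S(x)).\<close>

lemma frobenius: "coint (\<lambda>l. D l (\<lambda>p q. M p x (\<lambda>u. tr u * G q))) = of_nat CARD('x) * A x G"
proof -
  define H where "H u t = tr u * G t" for u t
  have expand: "D x (\<lambda>x1 x'. D x' (\<lambda>x2 x3. M p x1 (\<lambda>u. M q x2 (\<lambda>r. A x3 (\<lambda>s. M r s (H u)))))) =
      M p x (\<lambda>u. H u q)" for p q
  proof -
    have "M q x2 (\<lambda>r. A x3 (\<lambda>s. M r s (H u))) = A x3 (\<lambda>s. M x2 s (\<lambda>e. M q e (H u)))" for x2 x3 u
      by (simp only: M_A M_assoc)
    then have "D x (\<lambda>x1 x'. D x' (\<lambda>x2 x3. M p x1 (\<lambda>u. M q x2 (\<lambda>r. A x3 (\<lambda>s. M r s (H u)))))) =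
        D x (\<lambda>x1 x'. M p x1 (\<lambda>u. D x' (\<lambda>x2 x3. A x3 (\<lambda>s. M x2 s (\<lambda>e. M q e (H u))))))"
      by (simp only: D_M)
    also have "\<dots> = M p x (\<lambda>u. H u q)"
      by (simp only: D_antipode M_unit scale D_counit)
    finally show ?thesis .
  qed
  have "coint (\<lambda>l. D l (\<lambda>p q. M p x (\<lambda>u. H u q))) =
      coint (\<lambda>l. D x (\<lambda>y x3. D l (\<lambda>p q. D y (\<lambda>x1 x2. M p x1 (\<lambda>u. M q x2 (\<lambda>r. A x3 (\<lambda>s. M r s (H u))))))))"
    by (simp only: expand[symmetric] D_coassoc[symmetric] D_D[where y = x])
  also have "\<dots> = D x (\<lambda>y x3. coint (\<lambda>l. M l y (\<lambda>m. D m (\<lambda>u r. A x3 (\<lambda>s. M r s (H u))))))"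
    by (simp only: M_D coint_D)
  also have "\<dots> = coint (\<lambda>m. A x (\<lambda>s. D m (\<lambda>u r. M r s (H u))))"
    by (simp only: coint_M D_counit D_A)
  also have "\<dots> = coint (\<lambda>m. A x (\<lambda>s. tr m * U (\<lambda>r. M r s G)))"
  proof -
    have "M r s (H u) = tr u * M r s G" for r s u
      unfolding H_def by (rule M_scale)
    then show ?thesis
      by (simp only: tr_integral scale)
  qed
  also have "\<dots> = of_nat CARD('x) * A x G"
    by (simp only: M_unit scale coint_scale coint_tr)
  finally show ?thesis
    by (simp only: H_def)
qed

text \<open>
  The tensor \<open>h\<close> is this trace form for the dual Hopf algebra, so its inverse is explicit; this turns
  \<open>comult_lowered\<close> into an iterated comultiplication.
\<close>

lemma trace_form_inverse:
  "(\<Sum>p\<in>UNIV. (\<Sum>q\<in>UNIV. coint (\<lambda>l. \<Delta> l p q) * S y q) / of_nat CARD('x) * M p x tr) = of_bool (y = x)"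
proof -
  define L where "L l = (\<Sum>k\<in>UNIV. \<Delta> k k l)" for l
  have coint_def': "coint G = (\<Sum>l\<in>UNIV. L l * G l)" for G
    by (simp add: coint_def L_def)
  have "(\<Sum>p\<in>UNIV. (\<Sum>q\<in>UNIV. coint (\<lambda>l. \<Delta> l p q) * S y q) * M p x tr) =
      coint (\<lambda>l. D l (\<lambda>p q. M p x (\<lambda>u. tr u * A q (\<lambda>z. of_bool (z = y)))))"
  proof -
    have delta: "A q (\<lambda>z. of_bool (z = y)) = S y q" for q
      by (simp add: A_def sum_of_bool_mult[where g = "\<lambda>_. 1", simplified])
    show ?thesis
      unfolding scale delta unfolding D_def coint_def' sum_distrib_left sum_distrib_right
      by (subst sum_swap3[symmetric]) (simp add: mult_ac)
  qed
  also have "\<dots> = of_nat CARD('x) * of_bool (x = y)"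
    by (simp only: frobenius A_A_id)
  finally show ?thesis
    by (subst eq_commute[of y]) (simp add: sum_divide_distrib[symmetric])
qed

end

section \<open>Cyclic tensors as traces of matrix products\<close>

text \<open>The entry in row a and column b of the product of the matrices \<open>T _ x _\<close>.
  In this form conjugation by S and invariance of the trace become applicable to lists of any
  length.\<close>

fun chain :: "('x \<Rightarrow> 'y \<Rightarrow> 'x \<Rightarrow> complex) \<Rightarrow> 'y list \<Rightarrow> 'x::finite \<Rightarrow> 'x \<Rightarrow> complex" where
  "chain T [] a b = of_bool (a = b)"
| "chain T (x # xs) a b = (\<Sum>c\<in>UNIV. T a x c * chain T xs c b)"

lemma sum_of_bool: "(\<Sum>i\<in>UNIV. f i * of_bool (i = k)) = (f k :: complex)"
    "(\<Sum>i\<in>UNIV. f i * of_bool (k = i)) = f k"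
    "(\<Sum>i\<in>UNIV. of_bool (i = k) * f i) = f k"
    "(\<Sum>i\<in>UNIV. of_bool (k = i) * f i) = f k" for k :: "'a::finite"
  using sum_of_bool_mult[of f k "\<lambda>_. 1"] sum_of_bool_mult[of "\<lambda>_. 1" k f]
  by (simp_all add: eq_commute)

lemma sum_lists_Suc:
  "(\<Sum>xs | length xs = Suc n. f xs) = (\<Sum>x\<in>UNIV. \<Sum>xs | length xs = n. f (x # xs))"
  for f :: "'x::finite list \<Rightarrow> complex"
proof -
  have "{xs :: 'x list. length xs = Suc n} = (\<lambda>(x, xs). x # xs) ` (UNIV \<times> {xs. length xs = n})"
    by (auto simp: length_Suc_conv image_iff)
  moreover have "inj_on (\<lambda>(x, xs). x # xs) (UNIV \<times> {xs :: 'x list. length xs = n})"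
    by (auto simp: inj_on_def)
  ultimately show ?thesis
    by (simp add: sum.reindex sum.cartesian_product split_def)
qed

lemma chain_eq_sum:
  "chain T xs a b = (\<Sum>as | length as = length xs.
      (\<Prod>r<length xs. T ((a # as) ! r) (xs ! r) (as ! r)) * of_bool ((a # as) ! length xs = b))"
proof (induction xs arbitrary: a)
  case Nil
  then show ?case by simp
next
  case (Cons x xs)
  show ?case
    by (simp add: sum_lists_Suc Cons sum_distrib_left prod.lessThan_Suc_shift mult_ac del: prod.lessThan_Suc)
qed

text \<open>The empty list has to be excluded: its contraction is 1, whereas the trace of the empty
  chain is the number of indices.\<close>

lemma cyclic_contraction_chain:
  assumes "xs \<noteq> []"
  shows "cyclic_contraction T xs = (\<Sum>a\<in>UNIV. chain T xs a a)"
proof -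
  obtain x ys where xs: "xs = x # ys"
    using assms by (cases xs) auto
  define n where "n = length ys"
  have "(\<Sum>a\<in>UNIV. chain T xs a a) = (\<Sum>as | length as = Suc n. \<Sum>a\<in>UNIV.
     (\<Prod>r<Suc n. T ((a # as) ! r) (xs ! r) (as ! r)) * of_bool (as ! n = a))"
    unfolding chain_eq_sum by (subst sum.swap) (simp add: xs n_def)
  also have "\<dots> = (\<Sum>as | length as = Suc n. (\<Prod>r<Suc n. T ((as ! n # as) ! r) (xs ! r) (as ! r)))"
    by (simp only: sum_of_bool)
  \<comment> \<open>A rotation by one place: in the chain \<open>as ! r\<close> follows the r-th
    factor, in the contraction it precedes it.\<close>
  also have "\<dots> = (\<Sum>as | length as = Suc n. (\<Prod>r<Suc n. T (as ! r) (xs ! r) (as ! ((r + 1) mod Suc n))))"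
  proof (rule sum.reindex_bij_witness[of _ "\<lambda>as. tl as @ [hd as]" "\<lambda>as. last as # butlast as"])
    fix as :: "'a list" assume "as \<in> {as. length as = Suc n}"
    then have l: "length as = Suc n" by simp
    then have ne: "as \<noteq> []" by auto
    then have last: "last as = as ! n" by (simp add: last_conv_nth l)
    show "tl (last as # butlast as) @ [hd (last as # butlast as)] = as" "last as # butlast as \<in> {as. length as = Suc n}"
      using ne l by auto
    show "(\<Prod>r<Suc n. T ((last as # butlast as) ! r) (xs ! r) ((last as # butlast as) ! ((r + 1) mod Suc n))) =
      (\<Prod>r<Suc n. T ((as ! n # as) ! r) (xs ! r) (as ! r))"
    proof (rule prod.cong[OF refl])
      fix r assume r: "r \<in> {..<Suc n}"
      have "(last as # butlast as) ! r = (as ! n # as) ! r"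
        using r l by (cases r) (auto simp: last nth_butlast)
      moreover have "(last as # butlast as) ! ((r + 1) mod Suc n) = as ! r"
        using r l by (cases "r = n") (auto simp: last nth_butlast)
      ultimately show "T ((last as # butlast as) ! r) (xs ! r) ((last as # butlast as) ! ((r + 1) mod Suc n)) =
          T ((as ! n # as) ! r) (xs ! r) (as ! r)"
        by simp
    qed
  next
    fix as :: "'a list" assume "as \<in> {as. length as = Suc n}"
    then show "last (tl as @ [hd as]) # butlast (tl as @ [hd as]) = as" "tl as @ [hd as] \<in> {as. length as = Suc n}"
      by (cases as; auto)+
  qed
  finally show ?thesis
    by (simp add: cyclic_contraction_def xs n_def)
qed

lemma sum_lists_chain:
  "(\<Sum>xs | length xs = length ys. (\<Prod>r<length ys. m (ys ! r) (xs ! r)) * chain T xs a b) =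
   chain (\<lambda>a y b. \<Sum>x\<in>UNIV. m y x * T a x b) ys a b" for T :: "'x::finite \<Rightarrow> 'x \<Rightarrow> 'x \<Rightarrow> complex"
proof (induction ys arbitrary: a)
  case (Cons y ys)
  have "(\<Sum>xs | length xs = length (y # ys). (\<Prod>r<length (y # ys). m ((y # ys) ! r) (xs ! r)) * chain T xs a b) =
    (\<Sum>x\<in>UNIV. \<Sum>xs | length xs = length ys. \<Sum>c\<in>UNIV.
        m y x * T a x c * ((\<Prod>r<length ys. m (ys ! r) (xs ! r)) * chain T xs c b))"
    by (simp add: sum_lists_Suc prod.lessThan_Suc_shift sum_distrib_left mult_ac del: prod.lessThan_Suc)
  also have "\<dots> = (\<Sum>c\<in>UNIV. \<Sum>x\<in>UNIV. \<Sum>xs | length xs = length ys.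
        m y x * T a x c * ((\<Prod>r<length ys. m (ys ! r) (xs ! r)) * chain T xs c b))"
    by (rule trans[OF sum.cong[OF refl sum.swap] sum.swap])
  also have "\<dots> = chain (\<lambda>a y b. \<Sum>x\<in>UNIV. m y x * T a x b) (y # ys) a b"
    by (simp add: Cons sum_distrib_right flip: sum_distrib_left)
  finally show ?case .
qed simp

lemma sum_lists_cyclic_contraction:
  assumes "ys \<noteq> []"
  shows "(\<Sum>xs | length xs = length ys. (\<Prod>r<length ys. m (ys ! r) (xs ! r)) * cyclic_contraction T xs) =
   (\<Sum>a\<in>UNIV. chain (\<lambda>a y b. \<Sum>x\<in>UNIV. m y x * T a x b) ys a a)"
proof -
  have "(\<Sum>xs | length xs = length ys. (\<Prod>r<length ys. m (ys ! r) (xs ! r)) * cyclic_contraction T xs) =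
    (\<Sum>xs | length xs = length ys. \<Sum>a\<in>UNIV. (\<Prod>r<length ys. m (ys ! r) (xs ! r)) * chain T xs a a)"
    using assms by (intro sum.cong refl, subst cyclic_contraction_chain) (auto simp: sum_distrib_left)
  then show ?thesis
    by (simp only: sum_lists_chain[symmetric]) (rule sum.swap)
qed

lemma chain_conjugate:
  assumes inv: "\<And>a b. (\<Sum>c\<in>UNIV. Q a c * P c b) = of_bool (a = b)" "\<And>a b. (\<Sum>c\<in>UNIV. P a c * Q c b) = of_bool (a = b)"
    and T': "\<And>a y b. T' a y b = (\<Sum>u\<in>UNIV. \<Sum>v\<in>UNIV. P a u * T u y v * Q v b)"
  shows "chain T' ys a b = (\<Sum>u\<in>UNIV. \<Sum>v\<in>UNIV. P a u * chain T ys u v * Q v b)"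
proof (induction ys arbitrary: a)
  case Nil
  then show ?case
    by (simp add: inv sum_of_bool mult.assoc flip: sum_distrib_left)
next
  case (Cons y ys)
  define Z where "Z w = (\<Sum>z\<in>UNIV. chain T ys w z * Q z b)" for w
  have "chain T' (y # ys) a b = (\<Sum>c\<in>UNIV. (\<Sum>u\<in>UNIV. \<Sum>v\<in>UNIV. P a u * T u y v * Q v c) *
      (\<Sum>w\<in>UNIV. P c w * Z w))"
    by (simp add: Cons T' Z_def sum_distrib_left mult.assoc)
  also have "\<dots> = (\<Sum>c\<in>UNIV. \<Sum>w\<in>UNIV. (\<Sum>u\<in>UNIV. \<Sum>v\<in>UNIV. P a u * T u y v * Q v c) * (P c w * Z w))"
    by (simp only: sum_distrib_left)
  also have "\<dots> = (\<Sum>c\<in>UNIV. \<Sum>w\<in>UNIV. \<Sum>u\<in>UNIV. \<Sum>v\<in>UNIV. P a u * T u y v * (Q v c * P c w) * Z w)"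
    by (simp only: sum_distrib_right mult.assoc)
  also have "\<dots> = (\<Sum>w\<in>UNIV. \<Sum>u\<in>UNIV. \<Sum>v\<in>UNIV. \<Sum>c\<in>UNIV. P a u * T u y v * (Q v c * P c w) *
      Z w)"
    by (subst sum.swap, rule sum.cong[OF refl], rule sum_swap3)
  also have "\<dots> = (\<Sum>w\<in>UNIV. \<Sum>u\<in>UNIV. \<Sum>v\<in>UNIV. P a u * T u y v * of_bool (v = w) *
      Z w)"
    by (simp only: sum_distrib_left[symmetric] sum_distrib_right[symmetric] inv)
  also have "\<dots> = (\<Sum>w\<in>UNIV. \<Sum>u\<in>UNIV. P a u * T u y w * Z w)"
    by (simp only: sum_of_bool sum_distrib_right[symmetric])
  also have "\<dots> = (\<Sum>u\<in>UNIV. \<Sum>z\<in>UNIV. \<Sum>w\<in>UNIV. P a u * T u y w * (chain T ys w z * Q z b))"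
    unfolding Z_def sum_distrib_left by (rule sum_swap3)
  finally show ?case
    by (simp add: sum_distrib_left sum_distrib_right mult_ac)
qed

lemma trace_chain_conjugate:
  assumes inv: "\<And>a b. (\<Sum>c\<in>UNIV. Q a c * P c b) = of_bool (a = b)" "\<And>a b. (\<Sum>c\<in>UNIV. P a c * Q c b) = of_bool (a = b)"
    and T': "\<And>a y b. T' a y b = (\<Sum>u\<in>UNIV. \<Sum>v\<in>UNIV. P a u * T u y v * Q v b)"
  shows "(\<Sum>a\<in>UNIV. chain T' ys a a) = (\<Sum>u\<in>UNIV. chain T ys u u)"
proof -
  have "(\<Sum>a\<in>UNIV. chain T' ys a a) = (\<Sum>u\<in>UNIV. \<Sum>v\<in>UNIV. \<Sum>a\<in>UNIV. (Q v a * P a u) * chain T ys u v)"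
    unfolding chain_conjugate[OF assms] by (subst sum_swap3) (simp add: mult_ac)
  also have "\<dots> = (\<Sum>u\<in>UNIV. chain T ys u u)"
    by (simp only: sum_distrib_right[symmetric] inv sum_of_bool)
  finally show ?thesis .
qed

fun list_product :: "('x::finite \<Rightarrow> 'x \<Rightarrow> 'x \<Rightarrow> complex) \<Rightarrow> ('x \<Rightarrow> complex) \<Rightarrow> 'x list \<Rightarrow> 'x \<Rightarrow> complex" where
  "list_product C \<eta> [] u = \<eta> u"
| "list_product C \<eta> (x # xs) u = (\<Sum>v\<in>UNIV. list_product C \<eta> xs v * C x v u)"

context hopf_tensors
begin

lemma list_product_snoc:
  "list_product C \<eta> (xs @ [x]) u = (\<Sum>v\<in>UNIV. list_product C \<eta> xs v * C v x u)"
proof (induction xs arbitrary: u)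
  case Nil
  then show ?case
    by (simp add: unit_left unit_right)
next
  case (Cons y ys)
  have "list_product C \<eta> ((y # ys) @ [x]) u =
      (\<Sum>v\<in>UNIV. list_product C \<eta> ys v * (\<Sum>w\<in>UNIV. C v x w * C y w u))"
    unfolding append_Cons list_product.simps Cons sum_distrib_right sum_distrib_left
    by (subst sum.swap) (simp add: mult_ac)
  also have "\<dots> = (\<Sum>w\<in>UNIV. list_product C \<eta> (y # ys) w * C w x u)"
    unfolding assoc[symmetric] list_product.simps sum_distrib_right sum_distrib_left
    by (subst sum.swap) (simp add: mult_ac)
  finally show ?case .
qed

lemma chain_left: "chain (\<lambda>a x b. C x b a) xs a b = (\<Sum>v\<in>UNIV. list_product C \<eta> xs v * C v b a)"
proof (induction xs arbitrary: a)
  case Nil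
  then show ?case
    by (simp add: unit_left eq_commute)
next
  case (Cons x xs)
  have "chain (\<lambda>a x b. C x b a) (x # xs) a b =
      (\<Sum>v\<in>UNIV. list_product C \<eta> xs v * (\<Sum>c\<in>UNIV. C v b c * C x c a))"
    unfolding chain.simps Cons sum_distrib_left by (subst sum.swap) (simp add: mult_ac)
  also have "\<dots> = (\<Sum>w\<in>UNIV. list_product C \<eta> (x # xs) w * C w b a)"
    unfolding assoc[symmetric] list_product.simps sum_distrib_right sum_distrib_left
    by (subst sum.swap) (simp add: mult_ac)
  finally show ?case .
qed

text \<open>The chain runs from a to b, but the multiplications act from b towards a, so right
  multiplication meets the list backwards.\<close>

lemma chain_right: "chain (\<lambda>a x b. C b x a) xs a b = (\<Sum>v\<in>UNIV. list_product C \<eta> (rev xs) v * C b v a)"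
proof (induction xs arbitrary: a)
  case Nil
  then show ?case
    by (simp add: unit_right eq_commute)
next
  case (Cons x xs)
  have "chain (\<lambda>a x b. C b x a) (x # xs) a b =
      (\<Sum>v\<in>UNIV. list_product C \<eta> (rev xs) v * (\<Sum>c\<in>UNIV. C b v c * C c x a))"
    unfolding chain.simps Cons sum_distrib_left by (subst sum.swap) (simp add: mult_ac)
  also have "\<dots> = (\<Sum>w\<in>UNIV. list_product C \<eta> (rev (x # xs)) w * C b w a)"
    unfolding assoc rev.simps list_product_snoc sum_distrib_right sum_distrib_left
    by (subst sum.swap) (simp add: mult_ac)
  finally show ?case .
qed

lemma tr_eq: "tr x = (\<Sum>k\<in>UNIV. C k x k)" "tr x = (\<Sum>k\<in>UNIV. C x k k)"
  unfolding trl_eq_tr[symmetric] by (simp add: trl_eq_tr tr_def M_def sum_of_bool)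
    (simp add: trl_def M_def sum_of_bool)

text \<open>Both sides are traces of multiplication by the same product, that of the reversed list,
  once from the left and once from the right.\<close>

lemma trace_chain_left_right:
  "(\<Sum>a\<in>UNIV. chain (\<lambda>a x b. C x b a) (rev xs) a a) = (\<Sum>a\<in>UNIV. chain (\<lambda>a x b. C b x a) xs a a)"
  unfolding chain_left chain_right
  by (subst (1 2) sum.swap) (simp add: tr_eq[symmetric] flip: sum_distrib_left)

text \<open>As S(y) b = S(S(b) y), conjugation by S carries left multiplication by S(y) to right
  multiplication by y.\<close>

lemma trace_chain_antipode:
  "(\<Sum>a\<in>UNIV. chain (\<lambda>a y b. \<Sum>x\<in>UNIV. S x y * C x b a) xs a a) =
   (\<Sum>a\<in>UNIV. chain (\<lambda>a x b. C b x a) xs a a)"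
proof (rule trace_chain_conjugate[OF involution involution])
  fix a y b
  have "A y (\<lambda>x. M x b (\<lambda>u. of_bool (u = a))) = A b (\<lambda>b'. M b' y (\<lambda>u. A u (\<lambda>u. of_bool (u = a))))"
    by (simp only: A_mult A_A[of y] A_A_id)
  then show "(\<Sum>x\<in>UNIV. S x y * C x b a) = (\<Sum>u\<in>UNIV. \<Sum>v\<in>UNIV. S a u * C v y u * S v b)"
    by (subst sum.swap) (simp add: A_def M_def sum_of_bool sum_distrib_left mult_ac)
qed

lemma cyclic_contraction_tr3: "cyclic_contraction C [x, y, z] = tr3 x y z"
proof -
  have "tr3 x y z = (\<Sum>a\<in>UNIV. M x y (\<lambda>u. M u z (\<lambda>t. M a t (\<lambda>e. of_bool (e = a)))))"
    unfolding tr3_def tr_def by (simp only: sums)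
  also have "\<dots> = (\<Sum>a\<in>UNIV. M a x (\<lambda>c. M c y (\<lambda>d. M d z (\<lambda>e. of_bool (e = a)))))"
    by (simp only: M_assoc[symmetric])
  finally show ?thesis
    by (simp add: cyclic_contraction_chain M_def sum_of_bool)
qed

text \<open>The counterpart of \<open>tr3_reverse\<close> for hinges with any number of faces, read
  off from the two preceding trace identities in the dual.\<close>

lemma cyclic_contraction_comult:
  assumes "ys \<noteq> []"
  shows "(\<Sum>xs | length xs = length ys. (\<Prod>r<length ys. S (ys ! r) (xs ! r)) * cyclic_contraction \<Delta> xs) =
    cyclic_contraction \<Delta> (rev ys)"
  unfolding sum_lists_cyclic_contraction[OF assms]
  using hopf_tensors.trace_chain_antipode[OF dual, of ys] hopf_tensors.trace_chain_left_right[OF dual, of ys] assms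
  by (simp add: cyclic_contraction_chain)

text \<open>Flipping a flag composes its matrix with S, in both cases because S squares to the
  identity. Flipping all flags thus applies S to every index of \<Delta>, and this reverses the
  cyclic tensor.\<close>

lemma hinge_factor_toggle:
  assumes "xs \<noteq> []"
  shows "hinge_factor \<Delta> S (map (apsnd Not) xs) = hinge_factor \<Delta> S (rev xs)"
proof -
  define m where "m = (\<lambda>(z, s) y. if s then of_bool (y = z) else S z y)"
  have hinge: "hinge_factor \<Delta> S zs = (\<Sum>ys | length ys = length zs. (\<Prod>r<length zs. m (zs ! r) (ys ! r)) * cyclic_contraction \<Delta> ys)" for zs
    unfolding hinge_factor_def
    by (intro sum.cong prod.cong arg_cong2[where f = "(*)"] refl) (auto simp: m_def split: prod.splits)
  have toggle: "m (apsnd Not x) y = (\<Sum>w\<in>UNIV. m x w * S w y)" for x y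
    by (cases x) (auto simp: m_def sum_of_bool involution eq_commute)
  define T where "T a y b = (\<Sum>x\<in>UNIV. S y x * \<Delta> a x b)" for a y b
  let ?xs = "map (apsnd Not) xs"
  have rev: "hinge_factor \<Delta> S (rev zs) = (\<Sum>ys | length ys = length zs. (\<Prod>r<length zs. m (zs ! r) (ys ! r)) * cyclic_contraction \<Delta> (rev ys))" for zs
    unfolding hinge
  proof (rule sum.reindex_bij_witness[of _ rev rev])
    fix ys :: "'x list" assume "ys \<in> {ys. length ys = length (rev zs)}"
    then have l: "length ys = length zs" by simp
    have "(\<Prod>r<length zs. m (zs ! r) (rev ys ! r)) = (\<Prod>r<length zs. m (rev zs ! r) (ys ! r))"
      by (rule prod.reindex_bij_witness[of _ "\<lambda>r. length zs - Suc r" "\<lambda>r. length zs - Suc r"])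
        (auto simp: rev_nth l)
    then show "(\<Prod>r<length zs. m (zs ! r) (rev ys ! r)) * cyclic_contraction \<Delta> (rev (rev ys)) =
       (\<Prod>r<length (rev zs). m (rev zs ! r) (ys ! r)) * cyclic_contraction \<Delta> ys"
      by simp
  qed auto
  have "hinge_factor \<Delta> S ?xs = (\<Sum>a\<in>UNIV. chain (\<lambda>a x b. \<Sum>y\<in>UNIV. m (apsnd Not x) y * \<Delta> a y b) xs a a)"
    unfolding hinge using sum_lists_cyclic_contraction[OF assms, of "\<lambda>x. m (apsnd Not x)" \<Delta>] by simp
  also have "\<dots> = (\<Sum>a\<in>UNIV. chain (\<lambda>a x b. \<Sum>w\<in>UNIV. m x w * T a w b) xs a a)"
    unfolding toggle T_def sum_distrib_left sum_distrib_right by (subst sum.swap) (simp add: mult_ac)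
  also have "\<dots> = (\<Sum>ws | length ws = length xs. (\<Prod>r<length xs. m (xs ! r) (ws ! r)) * (\<Sum>a\<in>UNIV. chain T ws a a))"
    unfolding sum_distrib_left by (subst sum.swap) (simp only: sum_lists_chain)
  also have "\<dots> = (\<Sum>ws | length ws = length xs. (\<Prod>r<length xs. m (xs ! r) (ws ! r)) * cyclic_contraction \<Delta> (rev ws))"
  proof (intro sum.cong refl arg_cong2[where f = "(*)"])
    fix ws :: "'x list" assume "ws \<in> {ws. length ws = length xs}"
    then have "ws \<noteq> []" using assms by auto
    then show "(\<Sum>a\<in>UNIV. chain T ws a a) = cyclic_contraction \<Delta> (rev ws)"
      using cyclic_contraction_comult[of ws] sum_lists_cyclic_contraction[of ws S \<Delta>]
      by (simp add: T_def[abs_def])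
  qed
  also have "\<dots> = hinge_factor \<Delta> S (rev xs)"
    by (rule rev[symmetric])
  finally show ?thesis .
qed

text \<open>The left side is what reversing the direction of a hinge does: every comparison of
  arrows changes and the clockwise order is read backwards.\<close>

lemma hinge_factor_reverse:
  assumes "xs \<noteq> []"
  shows "hinge_factor \<Delta> S (rev (map (apsnd Not) xs)) = hinge_factor \<Delta> S xs"
  using hinge_factor_toggle[of "rev xs"] assms by (simp add: rev_map)

lemma comult_lowered_eq:
  "comult_lowered \<Delta> x y z w = (\<Sum>u\<in>UNIV. \<Delta> w x u * \<Delta> u y z)"
proof -
  interpret d: hopf_tensors "\<lambda>x y z. \<Delta> z x y" \<epsilon> "\<lambda>x y z. C y z x" \<eta> "\<lambda>x y. S y x"
    by (rule dual)
  define g where "g x y = d.M x y d.tr" for x y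
  have g_sym: "g x y = g y x" for x y
    unfolding g_def by (rule d.tr_commute)
  have h: "h_upper \<Delta> x y = g x y" for x y
  proof -
    have "g x y = (\<Sum>k\<in>UNIV. d.M k x (\<lambda>v. d.M v y (\<lambda>u. of_bool (u = k))))"
      unfolding g_def d.tr_def by (simp only: d.sums d.M_assoc)
    then show ?thesis
      by (subst (asm) d.M_def, subst (asm) d.M_def) (simp add: h_upper_def sum_of_bool, subst sum.swap, simp)
  qed
  define inv where "inv y p = (\<Sum>q\<in>UNIV. d.coint (\<lambda>l. C p q l) * S q y) / of_nat CARD('x)" for y p
  have inv: "(\<Sum>p\<in>UNIV. inv y p * g p x) = of_bool (y = x)" for x y
    unfolding inv_def g_def by (rule d.trace_form_inverse)
  define G where "G = (\<chi> i j. g i j)"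
  define I where "I = (\<chi> i j. inv i j)"
  have "I ** G = mat 1"
    by (simp add: I_def G_def matrix_matrix_mult_def inv mat_def of_bool_def vec_eq_iff)
  then have GI: "G ** I = mat 1" "I ** G = mat 1"
    using matrix_left_right_inverse by auto
  have "matrix_inv G = I"
  proof -
    have "G ** matrix_inv G = mat 1"
      unfolding matrix_inv_def using someI[of "\<lambda>A. G ** A = mat 1 \<and> A ** G = mat 1" I] GI by auto
    then show ?thesis
      by (metis GI(2) matrix_mul_assoc matrix_mul_lid matrix_mul_rid)
  qed
  then have lower: "h_lower \<Delta> v w = inv v w" for v w
    by (simp add: h_lower_def h G_def I_def)
  have ginv: "(\<Sum>v\<in>UNIV. g q v * inv v w) = of_bool (q = w)" for q w
    using GI(1) by (simp add: G_def I_def matrix_matrix_mult_def mat_def of_bool_def vec_eq_iff)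
  \<comment> \<open>In the dual algebra this tensor is the trace of the product x y z v, hence the
    form \<open>g\<close> evaluated at x y z and v. Contraction with the inverse of \<open>g\<close>
    then frees the last index.\<close>
  have cyc: "cyclic_contraction \<Delta> [x, y, z, v] = (\<Sum>q\<in>UNIV. (\<Sum>p\<in>UNIV. \<Delta> p x y * \<Delta> q p z) * g q v)" for v
  proof -
    have "cyclic_contraction \<Delta> [x, y, z, v] = (\<Sum>a\<in>UNIV. d.M v a (\<lambda>b. d.M z b (\<lambda>c. d.M y c (\<lambda>e. d.M x e (\<lambda>u. of_bool (u = a))))))"
      unfolding cyclic_contraction_chain[OF list.distinct(2)]
      by (simp add: d.M_def sum_of_bool sum_distrib_left)
         (subst (2) sum_swap3, subst (3) sum.swap, simp add: mult_ac)
    also have "\<dots> = (\<Sum>a\<in>UNIV. d.M x y (\<lambda>p. d.M p z (\<lambda>q. d.M q v (\<lambda>t. d.M t a (\<lambda>u. of_bool (u = a))))))"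
      by (simp only: d.M_assoc d.M_M[where y = v] d.M_M[where y = z])
    also have "\<dots> = d.M x y (\<lambda>p. d.M p z (\<lambda>q. g q v))"
      unfolding g_def d.trl_eq_tr[symmetric] d.trl_def by (simp only: d.sums)
    also have "\<dots> = (\<Sum>q\<in>UNIV. (\<Sum>p\<in>UNIV. \<Delta> p x y * \<Delta> q p z) * g q v)"
      unfolding d.M_def sum_distrib_left sum_distrib_right by (subst sum.swap) (simp add: mult_ac)
    finally show ?thesis .
  qed
  have "comult_lowered \<Delta> x y z w = (\<Sum>q\<in>UNIV. (\<Sum>p\<in>UNIV. \<Delta> p x y * \<Delta> q p z) * (\<Sum>v\<in>UNIV. g q v * inv v w))"
    unfolding comult_lowered_def cyc lower sum_distrib_right[where A = UNIV and r = "inv _ w"] sum_distrib_left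
    by (subst sum.swap) (simp add: mult_ac)
  also have "\<dots> = (\<Sum>u\<in>UNIV. \<Delta> w x u * \<Delta> u y z)"
    using coassoc[of w z x y] by (simp add: ginv sum_of_bool mult.commute)
  finally show ?thesis .
qed

end

section \<open>The structure constants of a Hopf algebra with basis\<close>

context involutory_hopf_algebra
begin

abbreviation co :: "'a \<Rightarrow> 'x \<Rightarrow> complex"
  where "co \<equiv> coord scl \<phi>"

lemma coord_expand: "(\<Sum>x\<in>UNIV. scl (co a x) (\<phi> x)) = a"
proof -
  have "(\<Sum>b\<in>range \<phi>. scl (representation (range \<phi>) a b) b) = a"
    using basis_independent basis_span by (intro sum_representation_eq) auto
  then show ?thesis
    by (simp add: coord_def sum.reindex[OF basis_inj])
qed

lemma coord_add: "co (a + b) x = co a x + co b x"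
  unfolding coord_def using basis_independent basis_span by (simp add: representation_add)

lemma coord_scale: "co (scl k a) x = k * co a x"
  unfolding coord_def using basis_independent basis_span by (simp add: representation_scale)

lemma coord_sum: "co (sum f I) x = (\<Sum>i\<in>I. co (f i) x)"
  unfolding coord_def using basis_independent basis_span by (simp add: representation_sum)

lemma coord_basis: "co (\<phi> y) x = of_bool (x = y)"
  unfolding coord_def using representation_basis[OF basis_independent, of "\<phi> y"] inj_eq[OF basis_inj]
  by (auto simp: of_bool_def)

lemma linear_expand:
  assumes "\<And>a b. f (a + b) = f a + f b" "\<And>k a. f (scl k a) = k * f a"
  shows "f a = (\<Sum>x\<in>UNIV. co a x * f (\<phi> x))"
proof -
  have "f (sum g I) = (\<Sum>i\<in>I. f (g i))" if "finite I" for g :: "'x \<Rightarrow> 'a" and I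
    using that
  proof (induction I rule: finite_induct)
    case empty
    show ?case using assms(2)[of 0 0] by simp
  qed (simp add: assms)
  then have "f (\<Sum>x\<in>UNIV. scl (co a x) (\<phi> x)) = (\<Sum>x\<in>UNIV. co a x * f (\<phi> x))"
    by (simp add: assms)
  then show ?thesis
    by (simp add: coord_expand)
qed

lemma linear_functional_expand:
  assumes "Vector_Spaces.linear scl (*) f"
  shows "f a = (\<Sum>x\<in>UNIV. co a x * f (\<phi> x))"
proof -
  interpret Vector_Spaces.linear scl "(*)" f by (rule assms)
  show ?thesis by (rule linear_expand) (simp_all add: add scale)
qed

lemma coord_mult_left: "co (a * b) w = (\<Sum>u\<in>UNIV. co a u * co (\<phi> u * b) w)"
  by (rule linear_expand) (simp_all add: distrib_right scl_mult_left coord_add coord_scale)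

lemma coord_mult_right: "co (a * b) w = (\<Sum>u\<in>UNIV. co b u * co (a * \<phi> u) w)"
  by (rule linear_expand) (simp_all add: distrib_left scl_mult_right coord_add coord_scale)

lemma coord_antipode: "co (antipode a) w = (\<Sum>u\<in>UNIV. co a u * co (antipode (\<phi> u)) w)"
proof -
  interpret S: Vector_Spaces.linear scl scl antipode by (rule antipode_linear)
  show ?thesis by (rule linear_expand) (simp_all add: S.add S.scale coord_add coord_scale)
qed

lemma hopf_tensors:
  "hopf_tensors (mult_const scl \<phi>) (co 1) (comult_const \<phi> comult) (\<lambda>x. counit (\<phi> x))
     (antipode_const scl \<phi> antipode)"
proof
  fix x y z w p q
  show "(\<Sum>u\<in>UNIV. mult_const scl \<phi> x y u * mult_const scl \<phi> u z w) =
      (\<Sum>u\<in>UNIV. mult_const scl \<phi> y z u * mult_const scl \<phi> x u w)"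
    unfolding mult_const_def coord_mult_left[symmetric] coord_mult_right[symmetric] by (simp add: mult.assoc)
  show "(\<Sum>u\<in>UNIV. co 1 u * mult_const scl \<phi> u x y) = of_bool (x = y)"
    unfolding mult_const_def coord_mult_left[symmetric] by (auto simp: coord_basis)
  show "(\<Sum>u\<in>UNIV. co 1 u * mult_const scl \<phi> x u y) = of_bool (x = y)"
    unfolding mult_const_def coord_mult_right[symmetric] by (auto simp: coord_basis)
  show "(\<Sum>u\<in>UNIV. comult_const \<phi> comult w u z * comult_const \<phi> comult u x y) =
      (\<Sum>u\<in>UNIV. comult_const \<phi> comult w x u * comult_const \<phi> comult u y z)"
    unfolding comult_const_def by (rule coassociative)
  show "(\<Sum>u\<in>UNIV. counit (\<phi> u) * comult_const \<phi> comult y u x) = of_bool (x = y)"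
    using arg_cong[OF counit_left, of "\<lambda>a. co a x" "\<phi> y"]
    by (simp add: coord_sum coord_scale coord_basis comult_const_def sum_of_bool mult.commute)
  show "(\<Sum>u\<in>UNIV. counit (\<phi> u) * comult_const \<phi> comult y x u) = of_bool (x = y)"
    using arg_cong[OF counit_right, of "\<lambda>a. co a x" "\<phi> y"]
    by (subst (asm) sum.swap)
       (simp add: coord_sum coord_scale coord_basis comult_const_def sum_of_bool mult.commute)
  show "(\<Sum>u\<in>UNIV. mult_const scl \<phi> x y u * comult_const \<phi> comult u p q) =
     (\<Sum>a\<in>UNIV. \<Sum>b\<in>UNIV. \<Sum>c\<in>UNIV. \<Sum>d\<in>UNIV. comult_const \<phi> comult x a b * comult_const \<phi> comult y c d *
        mult_const scl \<phi> a c p * mult_const scl \<phi> b d q)"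
    unfolding mult_const_def comult_const_def linear_functional_expand[OF comult_linear, symmetric]
    by (rule comult_mult)
  show "(\<Sum>u\<in>UNIV. co 1 u * comult_const \<phi> comult u p q) = co 1 p * co 1 q"
    unfolding comult_const_def linear_functional_expand[OF comult_linear, symmetric] by (rule comult_one)
  show "(\<Sum>u\<in>UNIV. counit (\<phi> u) * mult_const scl \<phi> p q u) = counit (\<phi> p) * counit (\<phi> q)"
    unfolding mult_const_def mult.commute[of "counit _" "co _ _"] linear_functional_expand[OF counit_linear, symmetric]
    by (rule counit_mult)
  show "(\<Sum>u\<in>UNIV. co 1 u * counit (\<phi> u)) = 1"
    unfolding linear_functional_expand[OF counit_linear, symmetric] by (rule counit_one)
  show "(\<Sum>a\<in>UNIV. \<Sum>b\<in>UNIV. \<Sum>c\<in>UNIV. comult_const \<phi> comult x a b * antipode_const scl \<phi> antipode c a *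
      mult_const scl \<phi> c b y) = counit (\<phi> x) * co 1 y"
    using arg_cong[OF antipode_left, of "\<lambda>a. co a y" "\<phi> x"]
    by (simp add: coord_sum coord_scale comult_const_def antipode_const_def mult_const_def mult.assoc
         flip: sum_distrib_left coord_mult_left)
  show "(\<Sum>a\<in>UNIV. \<Sum>b\<in>UNIV. \<Sum>c\<in>UNIV. comult_const \<phi> comult x a b * antipode_const scl \<phi> antipode c b *
      mult_const scl \<phi> a c y) = counit (\<phi> x) * co 1 y"
    using arg_cong[OF antipode_right, of "\<lambda>a. co a y" "\<phi> x"]
    by (simp add: coord_sum coord_scale comult_const_def antipode_const_def mult_const_def mult.assoc
         flip: sum_distrib_left coord_mult_right)
  show "(\<Sum>u\<in>UNIV. antipode_const scl \<phi> antipode x u * antipode_const scl \<phi> antipode u y) = of_bool (x = y)"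
    unfolding antipode_const_def mult.commute[of "co (antipode (\<phi> _)) x"] coord_antipode[symmetric] involutory
    by (rule coord_basis)
qed

end

section \<open>State sums on oriented complexes\<close>

text \<open>Distributivity merges the independent labelings of the slots \<open>J i\<close> into one
  family, and the bijection \<open>m\<close> identifies the slots with the elements of
  \<open>L\<close>. Every regrouping of the state sum by tetrahedra, triangles or edges is an
  instance.\<close>

lemma prod_sum_PiE_reindex:
  fixes g :: "'i \<Rightarrow> ('k \<Rightarrow> 'x::finite) \<Rightarrow> 'c::comm_semiring_1"
  assumes "finite I" "\<And>i. i \<in> I \<Longrightarrow> finite (J i)"
    and bij: "bij_betw (\<lambda>(i, k). m i k) (Sigma I J) L"
  shows "(\<Prod>i\<in>I. \<Sum>E\<in>J i \<rightarrow>\<^sub>E UNIV. g i E) =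
    (\<Sum>\<alpha>\<in>L \<rightarrow>\<^sub>E UNIV. \<Prod>i\<in>I. g i (\<lambda>k\<in>J i. \<alpha> (m i k)))"
proof -
  define inv where "inv = the_inv_into (Sigma I J) (\<lambda>(i, k). m i k)"
  have inv_m: "inv (m i k) = (i, k)" if "i \<in> I" "k \<in> J i" for i k
    using the_inv_into_f_f[OF bij_betw_imp_inj_on[OF bij], of "(i, k)"] that by (simp add: inv_def)
  have m_inv: "m (fst (inv f)) (snd (inv f)) = f" "fst (inv f) \<in> I" "snd (inv f) \<in> J (fst (inv f))" if "f \<in> L" for f
  proof -
    have "f \<in> (\<lambda>(i, k). m i k) ` Sigma I J"
      using bij that by (simp add: bij_betw_def)
    then show "m (fst (inv f)) (snd (inv f)) = f" "fst (inv f) \<in> I" "snd (inv f) \<in> J (fst (inv f))"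
      by (auto simp: inv_m)
  qed
  have mL: "m i k \<in> L" if "i \<in> I" "k \<in> J i" for i k
    using bij_betw_imp_surj_on[OF bij] that by auto
  have "(\<Prod>i\<in>I. \<Sum>E\<in>J i \<rightarrow>\<^sub>E UNIV. g i E) = (\<Sum>h\<in>(\<Pi>\<^sub>E i\<in>I. J i \<rightarrow>\<^sub>E UNIV). \<Prod>i\<in>I. g i (h i))"
    using assms by (intro prod_sum_PiE) (auto intro: finite_PiE)
  also have "\<dots> = (\<Sum>\<alpha>\<in>L \<rightarrow>\<^sub>E UNIV. \<Prod>i\<in>I. g i (\<lambda>k\<in>J i. \<alpha> (m i k)))"
  proof (rule sum.reindex_bij_witness[of _ "\<lambda>\<alpha>. \<lambda>i\<in>I. \<lambda>k\<in>J i. \<alpha> (m i k)"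
        "\<lambda>h. \<lambda>f\<in>L. h (fst (inv f)) (snd (inv f))"])
    fix h :: "'i \<Rightarrow> 'k \<Rightarrow> 'x" assume h: "h \<in> (\<Pi>\<^sub>E i\<in>I. J i \<rightarrow>\<^sub>E UNIV)"
    show *: "(\<lambda>i\<in>I. \<lambda>k\<in>J i. (\<lambda>f\<in>L. h (fst (inv f)) (snd (inv f))) (m i k)) = h"
    proof (rule PiE_ext[OF _ h])
      fix i assume i: "i \<in> I"
      show "(\<lambda>i\<in>I. \<lambda>k\<in>J i. (\<lambda>f\<in>L. h (fst (inv f)) (snd (inv f))) (m i k)) i = h i"
        using i PiE_mem[OF h i] by (auto simp: mL inv_m fun_eq_iff PiE_def extensional_def)
    qed auto
    show "(\<Prod>i\<in>I. g i (\<lambda>k\<in>J i. (\<lambda>f\<in>L. h (fst (inv f)) (snd (inv f))) (m i k))) = (\<Prod>i\<in>I. g i (h i))"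
    proof (rule prod.cong[OF refl])
      fix i assume "i \<in> I"
      then show "g i (\<lambda>k\<in>J i. (\<lambda>f\<in>L. h (fst (inv f)) (snd (inv f))) (m i k)) = g i (h i)"
        using fun_cong[OF *, of i] by simp
    qed
  next
    fix \<alpha> :: "_ \<Rightarrow> 'x" assume \<alpha>: "\<alpha> \<in> L \<rightarrow>\<^sub>E UNIV"
    show "(\<lambda>f\<in>L. (\<lambda>i\<in>I. \<lambda>k\<in>J i. \<alpha> (m i k)) (fst (inv f)) (snd (inv f))) = \<alpha>"
      by (rule PiE_ext[OF _ \<alpha>]) (auto simp: m_inv)
  qed auto
  finally show ?thesis .
qed

lemma prod_sum_reindex:
  fixes g :: "'i \<Rightarrow> ('k::finite \<Rightarrow> 'x::finite) \<Rightarrow> 'c::comm_semiring_1"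
  assumes "finite I" "bij_betw (\<lambda>(i, k). m i k) (I \<times> UNIV) L"
  shows "(\<Prod>i\<in>I. \<Sum>E\<in>UNIV. g i E) = (\<Sum>\<alpha>\<in>L \<rightarrow>\<^sub>E UNIV. \<Prod>i\<in>I. g i (\<lambda>k. \<alpha> (m i k)))"
proof -
  have "(UNIV \<rightarrow>\<^sub>E UNIV) = (UNIV :: ('k \<Rightarrow> 'x) set)"
    by (auto simp: PiE_def)
  then show ?thesis
    using prod_sum_PiE_reindex[of I "\<lambda>_. UNIV" m L g] assms by (simp add: restrict_def)
qed

lemma sum_PiE_reindex:
  fixes G :: "('a \<Rightarrow> 'x) \<Rightarrow> 'c::comm_monoid_add"
  assumes bij: "bij_betw h A B"
  shows "(\<Sum>\<psi>\<in>A \<rightarrow>\<^sub>E UNIV. G \<psi>) = (\<Sum>\<phi>\<in>B \<rightarrow>\<^sub>E UNIV. G (\<lambda>a\<in>A. \<phi> (h a)))"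
proof (rule sum.reindex_bij_witness[of _ "\<lambda>\<phi>. \<lambda>a\<in>A. \<phi> (h a)" "\<lambda>\<psi>. \<lambda>b\<in>B. \<psi> (the_inv_into A h b)"])
  note inv = the_inv_into_f_f[OF bij_betw_imp_inj_on[OF bij]] bij_betw_apply[OF bij]
  fix \<psi> :: "_ \<Rightarrow> 'x" assume \<psi>: "\<psi> \<in> A \<rightarrow>\<^sub>E UNIV"
  show *: "(\<lambda>a\<in>A. (\<lambda>b\<in>B. \<psi> (the_inv_into A h b)) (h a)) = \<psi>"
    by (rule PiE_ext[OF _ \<psi>]) (auto simp: inv)
  show "G (\<lambda>a\<in>A. (\<lambda>b\<in>B. \<psi> (the_inv_into A h b)) (h a)) = G \<psi>"
    unfolding * ..
next
  fix \<phi> :: "_ \<Rightarrow> 'x" assume \<phi>: "\<phi> \<in> B \<rightarrow>\<^sub>E UNIV"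
  show "(\<lambda>b\<in>B. (\<lambda>a\<in>A. \<phi> (h a)) (the_inv_into A h b)) = \<phi>"
    using f_the_inv_into_f_bij_betw[OF bij] bij_betw_apply[OF bij_betw_the_inv_into[OF bij]]
    by (intro PiE_ext[OF _ \<phi>]) auto
qed auto

lemma prod_bij_sigma:
  assumes "bij_betw (\<lambda>(i, k). m i k) (Sigma I J) L" "finite I" "\<And>i. i \<in> I \<Longrightarrow> finite (J i)"
  shows "(\<Prod>i\<in>I. \<Prod>k\<in>J i. g (m i k)) = (\<Prod>f\<in>L. g f)"
  unfolding prod.reindex_bij_betw[OF assms(1), symmetric]
  using assms(2,3) by (simp add: prod.Sigma split_def)

lemma sum_lists_distinct:
  fixes G :: "'b list \<Rightarrow> 'c::comm_monoid_add"
  assumes "distinct xs"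
  shows "(\<Sum>ys | length ys = length xs. G ys) = (\<Sum>y\<in>set xs \<rightarrow>\<^sub>E UNIV. G (map y xs))"
proof (rule sum.reindex_bij_witness[of _ "\<lambda>y. map y xs" "\<lambda>ys. \<lambda>x\<in>set xs. ys ! (THE i. i < length xs \<and> xs ! i = x)"])
  have idx: "(THE j. j < length xs \<and> xs ! j = xs ! i) = i" if "i < length xs" for i
    using assms that by (intro the_equality) (auto simp: nth_eq_iff_index_eq)
  fix ys :: "'b list" assume "ys \<in> {ys. length ys = length xs}"
  then show *: "map (\<lambda>x\<in>set xs. ys ! (THE i. i < length xs \<and> xs ! i = x)) xs = ys"
    by (intro nth_equalityI) (auto simp: idx)
  show "G (map (\<lambda>x\<in>set xs. ys ! (THE i. i < length xs \<and> xs ! i = x)) xs) = G ys"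
    unfolding * ..
next
  have idx: "(THE j. j < length xs \<and> xs ! j = xs ! i) = i" if "i < length xs" for i
    using assms that by (intro the_equality) (auto simp: nth_eq_iff_index_eq)
  fix y assume y: "y \<in> set xs \<rightarrow>\<^sub>E (UNIV :: 'b set)"
  show "(\<lambda>x\<in>set xs. map y xs ! (THE i. i < length xs \<and> xs ! i = x)) = y"
    by (rule PiE_ext[OF _ y]) (auto simp: in_set_conv_nth idx)
qed auto

lemma cyclic_contraction_map:
  fixes w :: "'r \<Rightarrow> 'x::finite"
  assumes "distinct ls" and nxt: "\<And>i. i < length ls \<Longrightarrow> nxt (ls ! i) = ls ! ((i + 1) mod length ls)"
  shows "cyclic_contraction T (map w ls) = (\<Sum>u\<in>set ls \<rightarrow>\<^sub>E UNIV. \<Prod>r\<in>set ls. T (u r) (w r) (u (nxt r)))"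
proof -
  have "bij_betw (nth ls) {..<length ls} (set ls)"
    using assms(1) by (simp add: bij_betw_nth)
  moreover have "Suc i mod length ls < length ls" if "i < length ls" for i
    using that by (intro mod_less_divisor) auto
  ultimately have *: "(\<Prod>r\<in>set ls. T (u r) (w r) (u (nxt r))) =
      (\<Prod>i<length ls. T (map u ls ! i) (map w ls ! i) (map u ls ! ((i + 1) mod length ls)))" for u
    by (subst prod.reindex_bij_betw[symmetric])
      (auto intro!: prod.cong simp: nxt)
  show ?thesis
    by (simp only: cyclic_contraction_def length_map sum_lists_distinct[OF assms(1)] *)
qed

lemma hinge_factor_map:
  fixes z :: "'r \<Rightarrow> 'x::finite"
  assumes "distinct ls"
  shows "hinge_factor \<Delta> S (map (\<lambda>r. (z r, s r)) ls) = (\<Sum>y\<in>set ls \<rightarrow>\<^sub>E UNIV.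
    (\<Prod>r\<in>set ls. if s r then of_bool (y r = z r) else S (z r) (y r)) * cyclic_contraction \<Delta> (map y ls))"
proof -
  have "bij_betw (nth ls) {..<length ls} (set ls)"
    using assms(1) by (simp add: bij_betw_nth)
  then have "(\<Prod>r\<in>set ls. if s r then of_bool (y r = z r) else S (z r) (y r)) =
      (\<Prod>i<length ls. if snd (map (\<lambda>r. (z r, s r)) ls ! i)
        then (if map y ls ! i = fst (map (\<lambda>r. (z r, s r)) ls ! i) then 1 else 0)
        else S (fst (map (\<lambda>r. (z r, s r)) ls ! i)) (map y ls ! i))" for y
    by (subst prod.reindex_bij_betw[symmetric]) (auto intro!: prod.cong)
  then show ?thesis
    using sum_lists_distinct[OF assms(1)] by (simp add: hinge_factor_def)
qed

section \<open>Combinatorics of an oriented complex\<close>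

text \<open>An abstract complex on vertex sets, free of topology. The list \<open>lnk p q\<close> is
  given for both directions of an edge; \<open>link_set\<close> and \<open>link_step\<close>
  together say that the tetrahedra at an edge form a single cycle.\<close>

locale oriented_complex =
  fixes Sg :: "'v set set" and num :: "'v \<Rightarrow> nat" and pos :: "'v \<Rightarrow> 'v \<Rightarrow> 'v \<Rightarrow> 'v \<Rightarrow> bool"
    and lnk :: "'v \<Rightarrow> 'v \<Rightarrow> 'v list"
  assumes finite_complex: "finite Sg"
    and finite_simplex: "A \<in> Sg \<Longrightarrow> finite A"
    and face_closed: "A \<in> Sg \<Longrightarrow> B \<subseteq> A \<Longrightarrow> B \<noteq> {} \<Longrightarrow> B \<in> Sg"
    and num_inj: "inj_on num (\<Union>Sg)"
    and pure: "A \<in> Sg \<Longrightarrow> \<exists>B\<in>Sg. A \<subseteq> B \<and> card B = 4"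
    and pos_swap: "{a, b, c, d} \<in> Sg \<Longrightarrow> card {a, b, c, d} = 4 \<Longrightarrow>
       (pos b a c d \<longleftrightarrow> \<not> pos a b c d) \<and> (pos a c b d \<longleftrightarrow> \<not> pos a b c d) \<and> (pos a b d c \<longleftrightarrow> \<not> pos a b c d)"
    and pos_adjacent: "{a, b, c, d} \<in> Sg \<Longrightarrow> card {a, b, c, d} = 4 \<Longrightarrow>
       {a, b, c, e} \<in> Sg \<Longrightarrow> card {a, b, c, e} = 4 \<Longrightarrow> d \<noteq> e \<Longrightarrow> pos a b c e \<longleftrightarrow> \<not> pos a b c d"
    and link_distinct: "{p, q} \<in> Sg \<Longrightarrow> p \<noteq> q \<Longrightarrow> distinct (lnk p q)"
    and link_set: "{p, q} \<in> Sg \<Longrightarrow> p \<noteq> q \<Longrightarrow> set (lnk p q) = {r. {p, q, r} \<in> Sg \<and> card {p, q, r} = 3}"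
    and link_step: "{p, q} \<in> Sg \<Longrightarrow> p \<noteq> q \<Longrightarrow> i < length (lnk p q) \<Longrightarrow>
       {p, q, lnk p q ! i, lnk p q ! ((i + 1) mod length (lnk p q))} \<in> Sg \<and>
       card {p, q, lnk p q ! i, lnk p q ! ((i + 1) mod length (lnk p q))} = 4 \<and>
       pos p q (lnk p q ! i) (lnk p q ! ((i + 1) mod length (lnk p q)))"
begin

definition tet where "tet a b c d \<longleftrightarrow> {a, b, c, d} \<in> Sg \<and> distinct [a, b, c, d]"
definition tri where "tri a b c \<longleftrightarrow> {a, b, c} \<in> Sg \<and> distinct [a, b, c]"
definition edg where "edg a b \<longleftrightarrow> {a, b} \<in> Sg \<and> a \<noteq> b"

lemma card4: "card {a, b, c, d} = 4 \<longleftrightarrow> distinct [a, b, c, d]"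
  by (auto simp: card_insert_if)

lemma card3: "card {a, b, c} = 3 \<longleftrightarrow> distinct [a, b, c]"
  by (auto simp: card_insert_if)

lemma tet_sym: "tet a b c d \<Longrightarrow> tet b a c d" "tet a b c d \<Longrightarrow> tet a c b d" "tet a b c d \<Longrightarrow> tet a b d c"
  by (auto simp: tet_def insert_commute)

lemma tri_sym: "tri a b c \<Longrightarrow> tri b a c" "tri a b c \<Longrightarrow> tri a c b"
  by (auto simp: tri_def insert_commute)

lemma edg_sym: "edg a b \<Longrightarrow> edg b a"
  by (auto simp: edg_def insert_commute)

lemma tet_tri: "tet a b c d \<Longrightarrow> tri a b c"
  unfolding tet_def tri_def using face_closed[of "{a, b, c, d}" "{a, b, c}"] by auto

lemma tri_edg: "tri a b c \<Longrightarrow> edg a b"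
  unfolding edg_def tri_def using face_closed[of "{a, b, c}" "{a, b}"] by auto

lemma pos_swap1: "tet a b c d \<Longrightarrow> pos b a c d \<longleftrightarrow> \<not> pos a b c d"
  and pos_swap2: "tet a b c d \<Longrightarrow> pos a c b d \<longleftrightarrow> \<not> pos a b c d"
  and pos_swap3: "tet a b c d \<Longrightarrow> pos a b d c \<longleftrightarrow> \<not> pos a b c d"
  using pos_swap[of a b c d] card4[of a b c d] by (auto simp: tet_def)

lemma pos_unique: "tet p q r s \<Longrightarrow> tet p q r s' \<Longrightarrow> pos p q r s = pos p q r s' \<Longrightarrow> s = s'"
  using pos_adjacent[of p q r s s'] card4[of p q r s] card4[of p q r s'] by (auto simp: tet_def)

lemma set_link: "edg p q \<Longrightarrow> set (lnk p q) = {r. tri p q r}"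
  using link_set[of p q] card3[of p q] by (auto simp: edg_def tri_def)

lemma link_tet: "edg p q \<Longrightarrow> i < length (lnk p q) \<Longrightarrow>
    tet p q (lnk p q ! i) (lnk p q ! ((i + 1) mod length (lnk p q))) \<and>
    pos p q (lnk p q ! i) (lnk p q ! ((i + 1) mod length (lnk p q)))"
  using link_step[of p q i] unfolding edg_def tet_def card4 by blast

text \<open>The successor of r in the cyclic list spans the tetrahedron on the positive side, and
  exchanging p and q gives the negative side (\<open>ex_neg\<close>). With \<open>pos_unique\<close>
  a triangle lies in exactly two tetrahedra.\<close>

lemma ex_pos: assumes "tri p q r" shows "\<exists>s. tet p q r s \<and> pos p q r s"
proof -
  have "r \<in> set (lnk p q)" "edg p q"
    using assms tri_edg set_link by auto
  then show ?thesis
    using link_tet[of p q] by (metis in_set_conv_nth)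
qed

lemma ex_neg: assumes "tri p q r" shows "\<exists>s. tet p q r s \<and> \<not> pos p q r s"
  using ex_pos[OF tri_sym(1)[OF assms]] pos_swap1 tet_sym by blast

lemma tet_perm:
  assumes "tet a b c d"
  shows "tet b a c d" "tet a c b d" "tet a b d c" "tet b c a d" "tet b a d c" "tet c a b d" "tet a c d b" "tet a d b c"
    "tet c b a d" "tet b c d a" "tet b d a c" "tet c a d b" "tet a d c b" "tet d a b c" "tet c b d a" "tet b d c a"
    "tet d b a c" "tet c d a b" "tet d a c b" "tet c d b a" "tet d b c a" "tet d c a b" "tet d c b a"
  using assms by (auto simp: tet_def insert_commute)

text \<open>The full table of the 23 nontrivial permutations, so that all case distinctions inside a
  tetrahedron reduce to the sign of one ordering.\<close>

lemma pos_perm: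
  assumes "tet a b c d"
  shows "pos b a c d \<longleftrightarrow> \<not> pos a b c d"
    "pos a c b d \<longleftrightarrow> \<not> pos a b c d"
    "pos a b d c \<longleftrightarrow> \<not> pos a b c d"
    "pos b c a d \<longleftrightarrow> pos a b c d"
    "pos b a d c \<longleftrightarrow> pos a b c d"
    "pos c a b d \<longleftrightarrow> pos a b c d"
    "pos a c d b \<longleftrightarrow> pos a b c d"
    "pos a d b c \<longleftrightarrow> pos a b c d"
    "pos c b a d \<longleftrightarrow> \<not> pos a b c d"
    "pos b c d a \<longleftrightarrow> \<not> pos a b c d"
    "pos b d a c \<longleftrightarrow> \<not> pos a b c d"
    "pos c a d b \<longleftrightarrow> \<not> pos a b c d"
    "pos a d c b \<longleftrightarrow> \<not> pos a b c d"
    "pos d a b c \<longleftrightarrow> \<not> pos a b c d"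
    "pos c b d a \<longleftrightarrow> pos a b c d"
    "pos b d c a \<longleftrightarrow> pos a b c d"
    "pos d b a c \<longleftrightarrow> pos a b c d"
    "pos c d a b \<longleftrightarrow> pos a b c d"
    "pos d a c b \<longleftrightarrow> pos a b c d"
    "pos c d b a \<longleftrightarrow> \<not> pos a b c d"
    "pos d b c a \<longleftrightarrow> \<not> pos a b c d"
    "pos d c a b \<longleftrightarrow> \<not> pos a b c d"
    "pos d c b a \<longleftrightarrow> pos a b c d"
proof -
  note t = tet_perm[OF assms]
  show p_bacd: "pos b a c d \<longleftrightarrow> \<not> pos a b c d"
    by (simp only: pos_swap1[OF assms] not_not)
  show p_acbd: "pos a c b d \<longleftrightarrow> \<not> pos a b c d"
    by (simp only: pos_swap2[OF assms] not_not)
  show p_abdc: "pos a b d c \<longleftrightarrow> \<not> pos a b c d"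
    by (simp only: pos_swap3[OF assms] not_not)
  show p_bcad: "pos b c a d \<longleftrightarrow> pos a b c d"
    by (simp only: pos_swap2[OF t(1)] p_bacd not_not)
  show p_badc: "pos b a d c \<longleftrightarrow> pos a b c d"
    by (simp only: pos_swap3[OF t(1)] p_bacd not_not)
  show p_cabd: "pos c a b d \<longleftrightarrow> pos a b c d"
    by (simp only: pos_swap1[OF t(2)] p_acbd not_not)
  show p_acdb: "pos a c d b \<longleftrightarrow> pos a b c d"
    by (simp only: pos_swap3[OF t(2)] p_acbd not_not)
  show p_adbc: "pos a d b c \<longleftrightarrow> pos a b c d"
    by (simp only: pos_swap2[OF t(3)] p_abdc not_not)
  show p_cbad: "pos c b a d \<longleftrightarrow> \<not> pos a b c d"
    by (simp only: pos_swap1[OF t(4)] p_bcad not_not)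
  show p_bcda: "pos b c d a \<longleftrightarrow> \<not> pos a b c d"
    by (simp only: pos_swap3[OF t(4)] p_bcad not_not)
  show p_bdac: "pos b d a c \<longleftrightarrow> \<not> pos a b c d"
    by (simp only: pos_swap2[OF t(5)] p_badc not_not)
  show p_cadb: "pos c a d b \<longleftrightarrow> \<not> pos a b c d"
    by (simp only: pos_swap3[OF t(6)] p_cabd not_not)
  show p_adcb: "pos a d c b \<longleftrightarrow> \<not> pos a b c d"
    by (simp only: pos_swap2[OF t(7)] p_acdb not_not)
  show p_dabc: "pos d a b c \<longleftrightarrow> \<not> pos a b c d"
    by (simp only: pos_swap1[OF t(8)] p_adbc not_not)
  show p_cbda: "pos c b d a \<longleftrightarrow> pos a b c d"
    by (simp only: pos_swap3[OF t(9)] p_cbad not_not)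
  show p_bdca: "pos b d c a \<longleftrightarrow> pos a b c d"
    by (simp only: pos_swap2[OF t(10)] p_bcda not_not)
  show p_dbac: "pos d b a c \<longleftrightarrow> pos a b c d"
    by (simp only: pos_swap1[OF t(11)] p_bdac not_not)
  show p_cdab: "pos c d a b \<longleftrightarrow> pos a b c d"
    by (simp only: pos_swap2[OF t(12)] p_cadb not_not)
  show p_dacb: "pos d a c b \<longleftrightarrow> pos a b c d"
    by (simp only: pos_swap1[OF t(13)] p_adcb not_not)
  show p_cdba: "pos c d b a \<longleftrightarrow> \<not> pos a b c d"
    by (simp only: pos_swap2[OF t(15)] p_cbda not_not)
  show p_dbca: "pos d b c a \<longleftrightarrow> \<not> pos a b c d"
    by (simp only: pos_swap1[OF t(16)] p_bdca not_not)
  show p_dcab: "pos d c a b \<longleftrightarrow> \<not> pos a b c d"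
    by (simp only: pos_swap1[OF t(18)] p_cdab not_not)
  show p_dcba: "pos d c b a \<longleftrightarrow> pos a b c d"
    by (simp only: pos_swap1[OF t(20)] p_cdba not_not)
qed

lemma num_eq: "A \<in> Sg \<Longrightarrow> B \<in> Sg \<Longrightarrow> x \<in> A \<Longrightarrow> y \<in> B \<Longrightarrow> num x = num y \<Longrightarrow> x = y"
  using num_inj by (auto simp: inj_on_def)

text \<open>
  Simplices are represented by their vertices in decreasing order. A triple \<open>(p, q, r)\<close> of \<open>FL\<close> is the
  pair of the edge \<open>pq\<close>, with arrow \<open>p \<rightarrow> q\<close>, and the triangle \<open>pqr\<close>.
\<close>

definition T4 where "T4 = {(a, b, c, d). tet a b c d \<and> num a > num b \<and> num b > num c \<and> num c > num d}"
definition T3 where "T3 = {(a, b, c). tri a b c \<and> num a > num b \<and> num b > num c}"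
definition T2 where "T2 = {(a, b). edg a b \<and> num a > num b}"
definition FL where "FL = {(p, q, r). tri p q r \<and> num p > num q}"

lemma ex_max:
  assumes "A \<in> Sg" "B \<subseteq> A" "B \<noteq> {}"
  shows "\<exists>a\<in>B. \<forall>x\<in>B - {a}. num x < num a"
proof -
  have fin: "finite B" using assms finite_simplex finite_subset by blast
  then obtain a where a: "a \<in> B" "num a = Max (num ` B)"
    using assms(3) by (metis (no_types, lifting) Max_in finite_imageI image_iff image_is_empty)
  have "num x < num a" if "x \<in> B - {a}" for x
  proof -
    have "num x \<le> num a" using that fin a by auto
    moreover have "num x \<noteq> num a" using num_eq[OF assms(1) assms(1), of x a] that a assms by auto
    ultimately show ?thesis by simp
  qed
  then show ?thesis using a by blast
qed

lemma peel_max: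
  assumes "A \<in> Sg" "B \<subseteq> A" "card B = Suc n"
  shows "\<exists>a B'. B = insert a B' \<and> a \<notin> B' \<and> B' \<subseteq> A \<and> card B' = n \<and> (\<forall>x\<in>B'. num x < num a)"
proof -
  have "B \<noteq> {}" using assms(3) by auto
  then obtain a where a: "a \<in> B" "\<forall>x\<in>B - {a}. num x < num a"
    using ex_max[OF assms(1,2)] by blast
  then show ?thesis
    using assms by (intro exI[of _ a] exI[of _ "B - {a}"]) auto
qed

lemma sorted2:
  assumes "A \<in> Sg" "B \<subseteq> A" "card B = 2"
  shows "\<exists>a b. B = {a, b} \<and> num a > num b"
proof -
  obtain a B' where a: "B = insert a B'" "B' \<subseteq> A" "card B' = 1" "\<forall>x\<in>B'. num x < num a"
    using peel_max[OF assms(1,2), of 1] assms(3) by auto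
  obtain b where "B' = {b}" using a(3) by (rule card_1_singletonE)
  then show ?thesis using a by auto
qed

lemma sorted3:
  assumes "A \<in> Sg" "B \<subseteq> A" "card B = 3"
  shows "\<exists>a b c. B = {a, b, c} \<and> num a > num b \<and> num b > num c"
proof -
  obtain a B' where a: "B = insert a B'" "B' \<subseteq> A" "card B' = 2" "\<forall>x\<in>B'. num x < num a"
    using peel_max[OF assms(1,2), of 2] assms(3) by auto
  obtain b c where "B' = {b, c}" "num b > num c" using sorted2[OF assms(1) a(2,3)] by auto
  then show ?thesis using a by blast
qed

lemma sorted4:
  assumes "A \<in> Sg" "card A = 4"
  shows "\<exists>a b c d. (a, b, c, d) \<in> T4 \<and> A = {a, b, c, d}"
proof -
  obtain a B' where a: "A = insert a B'" "B' \<subseteq> A" "card B' = 3" "\<forall>x\<in>B'. num x < num a"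
    using peel_max[OF assms(1) subset_refl, of 3] assms(2) by auto
  obtain b c d where b: "B' = {b, c, d}" "num b > num c" "num c > num d" using sorted3[OF assms(1) a(2,3)] by auto
  then have "A = {a, b, c, d}" using a by simp
  moreover have "distinct [a, b, c, d]" using assms(2) calculation card4 by metis
  ultimately have "(a, b, c, d) \<in> T4" using a(4) b assms(1) by (simp add: T4_def tet_def)
  then show ?thesis using \<open>A = {a, b, c, d}\<close> by blast
qed

lemma sorted4_unique:
  assumes "(a, b, c, d) \<in> T4" "(a', b', c', d') \<in> T4" "{a, b, c, d} = {a', b', c', d'}"
  shows "a = a' \<and> b = b' \<and> c = c' \<and> d = d'"
proof -
  have n: "num a > num b" "num b > num c" "num c > num d" "num a' > num b'" "num b' > num c'" "num c' > num d'"
    using assms(1,2) by (auto simp: T4_def)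
  have mem: "a = a' \<or> a = b' \<or> a = c' \<or> a = d'" "b = a' \<or> b = b' \<or> b = c' \<or> b = d'"
    "c = a' \<or> c = b' \<or> c = c' \<or> c = d'" "d = a' \<or> d = b' \<or> d = c' \<or> d = d'"
    "a' = a \<or> a' = b \<or> a' = c \<or> a' = d" "b' = a \<or> b' = b \<or> b' = c \<or> b' = d"
    "c' = a \<or> c' = b \<or> c' = c \<or> c' = d" "d' = a \<or> d' = b \<or> d' = c \<or> d' = d"
    using assms(3) by blast+
  have "a = a' \<or> num a < num a'" "a = a' \<or> num a' < num a" using mem(1,5) n by auto
  then have 1: "a = a'" by auto
  have "d = d' \<or> num d > num d'" "d = d' \<or> num d' > num d" using mem(4,8) n by auto
  then have 2: "d = d'" by auto
  have "b = b' \<or> num b < num b'" "b = b' \<or> num b' < num b" using mem(2,6) n 1 by auto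
  then have 3: "b = b'" by auto
  have 4: "c = c'" using mem(3) n 1 2 3 by auto
  show ?thesis using 1 2 3 4 by blast
qed

definition tedge :: "'v \<times> 'v \<times> 'v \<times> 'v \<Rightarrow> tet_edge \<Rightarrow> 'v \<times> 'v \<times> 'v \<times> 'v"
  where "tedge = (\<lambda>(a, b, c, d). if pos a b c d then edge_U_plus (a, b, c, d) else edge_U_minus (a, b, c, d))"

text \<open>The pairs (edge, face) carrying the colors \<open>e\<^sub>-\<close> and \<open>e\<^sub>+\<close>.\<close>

definition mi :: "'v \<times> 'v \<times> 'v \<times> 'v \<Rightarrow> tet_edge \<Rightarrow> 'v \<times> 'v \<times> 'v"
  where "mi T e = (case tedge T e of (p, q, r, s) \<Rightarrow> (p, q, if pos p q r s then r else s))"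

definition pl :: "'v \<times> 'v \<times> 'v \<times> 'v \<Rightarrow> tet_edge \<Rightarrow> 'v \<times> 'v \<times> 'v"
  where "pl T e = (case tedge T e of (p, q, r, s) \<Rightarrow> (p, q, if pos p q r s then s else r))"

lemma mi_plus:
  assumes "tet a b c d" "pos a b c d"
  shows "mi (a, b, c, d) ei = (b, d, c)" "mi (a, b, c, d) ej = (c, d, a)" "mi (a, b, c, d) ek = (b, c, a)"
    "mi (a, b, c, d) el = (a, c, d)" "mi (a, b, c, d) em = (a, b, c)" "mi (a, b, c, d) en = (a, d, b)"
  using pos_perm[OF assms(1)] assms(2) by (simp_all add: mi_def tedge_def)

lemma pl_plus:
  assumes "tet a b c d" "pos a b c d"
  shows "pl (a, b, c, d) ei = (b, d, a)" "pl (a, b, c, d) ej = (c, d, b)" "pl (a, b, c, d) ek = (b, c, d)"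
    "pl (a, b, c, d) el = (a, c, b)" "pl (a, b, c, d) em = (a, b, d)" "pl (a, b, c, d) en = (a, d, c)"
  using pos_perm[OF assms(1)] assms(2) by (simp_all add: pl_def tedge_def)

lemma mi_minus:
  assumes "tet a b c d" "\<not> pos a b c d"
  shows "mi (a, b, c, d) ei = (b, d, a)" "mi (a, b, c, d) ek = (c, d, b)" "mi (a, b, c, d) ej = (b, c, d)"
    "mi (a, b, c, d) el = (a, c, b)" "mi (a, b, c, d) en = (a, b, d)" "mi (a, b, c, d) em = (a, d, c)"
  using pos_perm[OF assms(1)] assms(2) by (simp_all add: mi_def tedge_def)

lemma pl_minus:
  assumes "tet a b c d" "\<not> pos a b c d"
  shows "pl (a, b, c, d) ei = (b, d, c)" "pl (a, b, c, d) ek = (c, d, a)" "pl (a, b, c, d) ej = (b, c, a)"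
    "pl (a, b, c, d) el = (a, c, d)" "pl (a, b, c, d) en = (a, b, c)" "pl (a, b, c, d) em = (a, d, b)"
  using pos_perm[OF assms(1)] assms(2) by (simp_all add: pl_def tedge_def)

lemma tri_of_tet:
  assumes "tet a b c d"
  shows "tri a b c" "tri a b d" "tri a c b" "tri a c d" "tri a d b" "tri a d c" "tri b c a" "tri b c d"
    "tri b d a" "tri b d c" "tri c d a" "tri c d b"
  using tet_tri[OF assms] tet_tri[OF tet_sym(3)[OF assms]] tet_tri[OF tet_sym(3)[OF tet_sym(2)[OF assms]]]
    tet_tri[OF tet_sym(3)[OF tet_sym(2)[OF tet_sym(1)[OF assms]]]]
  by (blast intro: tri_sym)+

lemma T4_cases:
  assumes "tet p q r s" "num p > num q"
  shows "\<exists>a b c d. (a, b, c, d) \<in> T4 \<and> {a, b, c, d} = {p, q, r, s} \<and>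
    (p, q, r, s) \<in> {(b, d, a, c), (c, d, a, b), (b, c, a, d), (a, c, b, d), (a, b, c, d), (a, d, b, c),
       (b, d, c, a), (c, d, b, a), (b, c, d, a), (a, c, d, b), (a, b, d, c), (a, d, c, b)}"
proof -
  have d: "distinct [p, q, r, s]" using assms(1) by (simp add: tet_def)
  then obtain a b c d where T: "(a, b, c, d) \<in> T4" "{p, q, r, s} = {a, b, c, d}"
    using sorted4[of "{p, q, r, s}"] assms(1) card4[of p q r s] unfolding tet_def by metis
  have n: "num a > num b" "num b > num c" "num c > num d" using T by (auto simp: T4_def)
  have mem: "p = a \<or> p = b \<or> p = c \<or> p = d" "q = a \<or> q = b \<or> q = c \<or> q = d"
    "r = a \<or> r = b \<or> r = c \<or> r = d" "s = a \<or> s = b \<or> s = c \<or> s = d"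
    using T(2) by blast+
  have pq: "(p, q) \<in> {(b, d), (c, d), (b, c), (a, c), (a, b), (a, d)}"
    using mem(1,2) n assms(2) by auto
  have "(p, q, r, s) \<in> {(b, d, a, c), (c, d, a, b), (b, c, a, d), (a, c, b, d), (a, b, c, d), (a, d, b, c),
       (b, d, c, a), (c, d, b, a), (b, c, d, a), (a, c, d, b), (a, b, d, c), (a, d, c, b)}"
    using pq mem(3,4) d by (elim insertE emptyE disjE) auto
  then show ?thesis using T by metis
qed

lemma all_tet_edge: "(\<forall>e. P e) \<longleftrightarrow> P ei \<and> P ej \<and> P ek \<and> P el \<and> P em \<and> P en"
  by (metis tet_edge.exhaust)

text \<open>Whatever the sign of T, the flag carrying \<open>e_-\<close> sees T on its positive
  side, and the one carrying \<open>e_+\<close> sees it on its negative side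
  (\<open>pl_props\<close>). Hence T can be recovered from the flag.\<close>

lemma mi_props:
  assumes "(a, b, c, d) \<in> T4"
  shows "\<forall>e. \<exists>p q r s. mi (a, b, c, d) e = (p, q, r) \<and> num p > num q \<and> tet p q r s \<and> pos p q r s \<and>
     {p, q, r, s} = {a, b, c, d}"
proof (cases "pos a b c d")
  case True
  have t: "tet a b c d" and n: "num a > num b" "num b > num c" "num c > num d" using assms by (auto simp: T4_def)
  show ?thesis
    unfolding all_tet_edge mi_plus[OF t True]
    using t tet_perm[OF t] pos_perm[OF t] True n by (auto simp: insert_commute)
next
  case False
  have t: "tet a b c d" and n: "num a > num b" "num b > num c" "num c > num d" using assms by (auto simp: T4_def)
  show ?thesis
    unfolding all_tet_edge mi_minus[OF t False]
    using t tet_perm[OF t] pos_perm[OF t] False n by (auto simp: insert_commute)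
qed

lemma pl_props:
  assumes "(a, b, c, d) \<in> T4"
  shows "\<forall>e. \<exists>p q r s. pl (a, b, c, d) e = (p, q, r) \<and> num p > num q \<and> tet p q r s \<and> \<not> pos p q r s \<and>
     {p, q, r, s} = {a, b, c, d}"
proof (cases "pos a b c d")
  case True
  have t: "tet a b c d" and n: "num a > num b" "num b > num c" "num c > num d" using assms by (auto simp: T4_def)
  show ?thesis
    unfolding all_tet_edge pl_plus[OF t True]
    using t tet_perm[OF t] pos_perm[OF t] True n by (auto simp: insert_commute)
next
  case False
  have t: "tet a b c d" and n: "num a > num b" "num b > num c" "num c > num d" using assms by (auto simp: T4_def)
  show ?thesis
    unfolding all_tet_edge pl_minus[OF t False]
    using t tet_perm[OF t] pos_perm[OF t] False n by (auto simp: insert_commute)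
qed

lemma mi_inj: "(a, b, c, d) \<in> T4 \<Longrightarrow> mi (a, b, c, d) e = mi (a, b, c, d) e' \<Longrightarrow> e = e'"
  by (cases "pos a b c d"; cases e; cases e') (auto simp: T4_def mi_plus mi_minus tet_def)

lemma pl_inj: "(a, b, c, d) \<in> T4 \<Longrightarrow> pl (a, b, c, d) e = pl (a, b, c, d) e' \<Longrightarrow> e = e'"
  by (cases "pos a b c d"; cases e; cases e') (auto simp: T4_def pl_plus pl_minus tet_def)

text \<open>A flag is \<open>e_-\<close> exactly for the tetrahedron that the clockwise rotation
  about its edge enters at this face: \<open>ex_pos\<close> provides it and
  \<open>pos_unique\<close> makes it unique.\<close>

lemma bij_mi: "bij_betw (\<lambda>(T, e). mi T e) (T4 \<times> UNIV) FL"
proof (rule bij_betw_imageI)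
  show "inj_on (\<lambda>(T, e). mi T e) (T4 \<times> UNIV)"
  proof (rule inj_onI)
    fix x y assume "x \<in> T4 \<times> (UNIV :: tet_edge set)" "y \<in> T4 \<times> (UNIV :: tet_edge set)"
      and "(\<lambda>(T, e). mi T e) x = (\<lambda>(T, e). mi T e) y"
    moreover obtain a b c d e where x: "x = ((a, b, c, d), e)"
      by (cases x) auto
    moreover obtain a' b' c' d' e' where y: "y = ((a', b', c', d'), e')"
      by (cases y) auto
    ultimately have T: "(a, b, c, d) \<in> T4" and T': "(a', b', c', d') \<in> T4" and eq: "mi (a, b, c, d) e = mi (a', b', c', d') e'"
      by simp_all
    obtain p q r s where 1: "mi (a, b, c, d) e = (p, q, r)" "tet p q r s" "pos p q r s" "{p, q, r, s} = {a, b, c, d}"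
      using mi_props[OF T] by metis
    obtain s' where 2: "tet p q r s'" "pos p q r s'" "{p, q, r, s'} = {a', b', c', d'}"
      using mi_props[OF T'] eq 1(1) by (metis prod.inject)
    have "s = s'" using pos_unique 1 2 by metis
    then have "a = a' \<and> b = b' \<and> c = c' \<and> d = d'" using sorted4_unique[OF T T'] 1 2 by metis
    then show "x = y"
      using x y eq mi_inj[OF T] by simp
  qed
  show "(\<lambda>(T, e). mi T e) ` (T4 \<times> UNIV) = FL"
  proof (intro equalityI subsetI)
    fix f assume "f \<in> (\<lambda>(T, e). mi T e) ` (T4 \<times> UNIV)"
    then obtain a b c d e where T: "(a, b, c, d) \<in> T4" "f = mi (a, b, c, d) e" by auto
    then obtain p q r s where "f = (p, q, r)" "num p > num q" "tet p q r s"
      using mi_props[OF T(1)] by metis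
    then show "f \<in> FL"
      using tet_tri[of p q r s] by (simp add: FL_def)
  next
    fix f assume "f \<in> FL"
    then obtain p q r where f: "f = (p, q, r)" "tri p q r" "num p > num q" by (auto simp: FL_def)
    obtain s where s: "tet p q r s" "pos p q r s" using ex_pos f by blast
    obtain a b c d where T: "(a, b, c, d) \<in> T4" and
       cs: "(p, q, r, s) \<in> {(b, d, a, c), (c, d, a, b), (b, c, a, d), (a, c, b, d), (a, b, c, d), (a, d, b, c),
       (b, d, c, a), (c, d, b, a), (b, c, d, a), (a, c, d, b), (a, b, d, c), (a, d, c, b)}"
      using T4_cases[OF s(1) f(3)] by metis
    have t: "tet a b c d" using T by (simp add: T4_def)
    have "(p, q, r) \<in> {mi (a, b, c, d) ei, mi (a, b, c, d) ej, mi (a, b, c, d) ek, mi (a, b, c, d) el,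
       mi (a, b, c, d) em, mi (a, b, c, d) en}"
      using cs s(2) pos_perm[OF t] mi_plus[OF t] mi_minus[OF t]
      by (cases "pos a b c d") (elim insertE emptyE; simp)+
    then obtain e where "(p, q, r) = mi (a, b, c, d) e" by blast
    then show "f \<in> (\<lambda>(T, e). mi T e) ` (T4 \<times> UNIV)"
      using T f(1) by (intro image_eqI[where x = "((a, b, c, d), e)"]) auto
  qed
qed

lemma bij_pl: "bij_betw (\<lambda>(T, e). pl T e) (T4 \<times> UNIV) FL"
proof (rule bij_betw_imageI)
  show "inj_on (\<lambda>(T, e). pl T e) (T4 \<times> UNIV)"
  proof (rule inj_onI)
    fix x y assume "x \<in> T4 \<times> (UNIV :: tet_edge set)" "y \<in> T4 \<times> (UNIV :: tet_edge set)"
      and "(\<lambda>(T, e). pl T e) x = (\<lambda>(T, e). pl T e) y"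
    moreover obtain a b c d e where x: "x = ((a, b, c, d), e)"
      by (cases x) auto
    moreover obtain a' b' c' d' e' where y: "y = ((a', b', c', d'), e')"
      by (cases y) auto
    ultimately have T: "(a, b, c, d) \<in> T4" and T': "(a', b', c', d') \<in> T4" and eq: "pl (a, b, c, d) e = pl (a', b', c', d') e'"
      by simp_all
    obtain p q r s where 1: "pl (a, b, c, d) e = (p, q, r)" "tet p q r s" "\<not> pos p q r s" "{p, q, r, s} = {a, b, c, d}"
      using pl_props[OF T] by metis
    obtain s' where 2: "tet p q r s'" "\<not> pos p q r s'" "{p, q, r, s'} = {a', b', c', d'}"
      using pl_props[OF T'] eq 1(1) by (metis prod.inject)
    have "s = s'" using pos_unique 1 2 by metis
    then have "a = a' \<and> b = b' \<and> c = c' \<and> d = d'" using sorted4_unique[OF T T'] 1 2 by metis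
    then show "x = y"
      using x y eq pl_inj[OF T] by simp
  qed
  show "(\<lambda>(T, e). pl T e) ` (T4 \<times> UNIV) = FL"
  proof (intro equalityI subsetI)
    fix f assume "f \<in> (\<lambda>(T, e). pl T e) ` (T4 \<times> UNIV)"
    then obtain a b c d e where T: "(a, b, c, d) \<in> T4" "f = pl (a, b, c, d) e" by auto
    then obtain p q r s where "f = (p, q, r)" "num p > num q" "tet p q r s"
      using pl_props[OF T(1)] by metis
    then show "f \<in> FL"
      using tet_tri[of p q r s] by (simp add: FL_def)
  next
    fix f assume "f \<in> FL"
    then obtain p q r where f: "f = (p, q, r)" "tri p q r" "num p > num q" by (auto simp: FL_def)
    obtain s where s: "tet p q r s" "\<not> pos p q r s" using ex_neg f by blast
    obtain a b c d where T: "(a, b, c, d) \<in> T4" and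
       cs: "(p, q, r, s) \<in> {(b, d, a, c), (c, d, a, b), (b, c, a, d), (a, c, b, d), (a, b, c, d), (a, d, b, c),
       (b, d, c, a), (c, d, b, a), (b, c, d, a), (a, c, d, b), (a, b, d, c), (a, d, c, b)}"
      using T4_cases[OF s(1) f(3)] by metis
    have t: "tet a b c d" using T by (simp add: T4_def)
    have "(p, q, r) \<in> {pl (a, b, c, d) ei, pl (a, b, c, d) ej, pl (a, b, c, d) ek, pl (a, b, c, d) el,
       pl (a, b, c, d) em, pl (a, b, c, d) en}"
      using cs s(2) pos_perm[OF t] pl_plus[OF t] pl_minus[OF t]
      by (cases "pos a b c d") (elim insertE emptyE; simp)+
    then obtain e where "(p, q, r) = pl (a, b, c, d) e" by blast
    then show "f \<in> (\<lambda>(T, e). pl T e) ` (T4 \<times> UNIV)"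
      using T f(1) by (intro image_eqI[where x = "((a, b, c, d), e)"]) auto
  qed
qed

text \<open>For p > q > r the slots are the edges pq, qr and pr. Along p, q, r, p the first two
  arrows agree with the direction of travel and the third opposes it, so slot 2 is the exceptional
  one throughout.\<close>

definition slot :: "'v \<times> 'v \<times> 'v \<Rightarrow> nat \<Rightarrow> 'v \<times> 'v \<times> 'v"
  where "slot = (\<lambda>(p, q, r) k. if k = 0 then (p, q, r) else if k = 1 then (q, r, p) else (p, r, q))"

lemma num_less_or: "tri p q r \<Longrightarrow> num p < num q \<or> num q < num p"
  using num_eq[of "{p, q, r}" "{p, q, r}" p q] by (cases "num p" "num q" rule: linorder_cases) (auto simp: tri_def)

lemma tri_perm: assumes "tri a b c" shows "tri b c a" "tri c a b" "tri a c b" "tri b a c" "tri c b a"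
  using assms by (auto simp: tri_def insert_commute)

lemma bij_slot: "bij_betw (\<lambda>(F, k). slot F k) (T3 \<times> {0, 1, 2}) FL"
proof (rule bij_betw_imageI)
  show "inj_on (\<lambda>(F, k). slot F k) (T3 \<times> {0, 1, 2})"
    by (auto simp: inj_on_def slot_def T3_def)
  show "(\<lambda>(F, k). slot F k) ` (T3 \<times> {0, 1, 2}) = FL"
  proof (intro equalityI subsetI)
    fix f assume "f \<in> (\<lambda>(F, k). slot F k) ` (T3 \<times> {0, 1, 2})"
    then show "f \<in> FL" by (auto simp: slot_def T3_def FL_def dest: tri_perm)
  next
    fix f assume "f \<in> FL"
    then obtain p q r where f: "f = (p, q, r)" "tri p q r" "num p > num q" by (auto simp: FL_def)
    have s: "tri q r p" "tri r p q" "tri p r q" using f(2) by (blast intro: tri_sym)+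
    consider "num q > num r" | "num r > num q" "num p > num r" | "num r > num p"
      using num_less_or[OF s(1)] num_less_or[OF s(2)] by linarith
    then show "f \<in> (\<lambda>(F, k). slot F k) ` (T3 \<times> {0, 1, 2})"
    proof cases
      case 1
      then have "((p, q, r), 0) \<in> T3 \<times> {0, 1, 2}" using f by (simp add: T3_def)
      then show ?thesis using f by (force simp: slot_def)
    next
      case 2
      then have "((p, r, q), 2) \<in> T3 \<times> {0, 1, 2}" using f s by (simp add: T3_def)
      then show ?thesis using f by (force simp: slot_def)
    next
      case 3
      then have "((r, p, q), 1) \<in> T3 \<times> {0, 1, 2}" using f s by (simp add: T3_def)
      then show ?thesis using f by (force simp: slot_def)
    qed
  qed
qed

lemma bij_link: "bij_betw (\<lambda>(E, r). (fst E, snd E, r)) (Sigma T2 (\<lambda>(p, q). set (lnk p q))) FL"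
proof (rule bij_betw_imageI)
  show "inj_on (\<lambda>(E, r). (fst E, snd E, r)) (Sigma T2 (\<lambda>(p, q). set (lnk p q)))"
    by (auto simp: inj_on_def)
  show "(\<lambda>(E, r). (fst E, snd E, r)) ` (Sigma T2 (\<lambda>(p, q). set (lnk p q))) = FL"
  proof (intro equalityI subsetI)
    fix f assume "f \<in> (\<lambda>(E, r). (fst E, snd E, r)) ` (Sigma T2 (\<lambda>(p, q). set (lnk p q)))"
    then show "f \<in> FL" by (auto simp: T2_def FL_def set_link)
  next
    fix f assume "f \<in> FL"
    then obtain p q r where f: "f = (p, q, r)" "tri p q r" "num p > num q" by (auto simp: FL_def)
    then have "((p, q), r) \<in> Sigma T2 (\<lambda>(p, q). set (lnk p q))"
      using tri_edg set_link by (auto simp: T2_def)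
    then show "f \<in> (\<lambda>(E, r). (fst E, snd E, r)) ` (Sigma T2 (\<lambda>(p, q). set (lnk p q)))"
      using f by force
  qed
qed

text \<open>
  The faces of a tetrahedron whose decreasing vertex order agrees, respectively disagrees, with the
  boundary orientation; every triangle is once of either kind.
\<close>

definition posface :: "'v \<times> 'v \<times> 'v \<times> 'v \<Rightarrow> bool \<Rightarrow> 'v \<times> 'v \<times> 'v"
  where "posface = (\<lambda>(a, b, c, d) k. if pos a b c d then (if k then (a, b, c) else (a, c, d))
    else (if k then (a, b, d) else (b, c, d)))"

definition negface :: "'v \<times> 'v \<times> 'v \<times> 'v \<Rightarrow> bool \<Rightarrow> 'v \<times> 'v \<times> 'v"
  where "negface = (\<lambda>(a, b, c, d) k. if pos a b c d then (if k then (a, b, d) else (b, c, d))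
    else (if k then (a, b, c) else (a, c, d)))"

lemma posface_props:
  assumes "(a, b, c, d) \<in> T4"
  shows "\<exists>p q r s. posface (a, b, c, d) k = (p, q, r) \<and> (p, q, r) \<in> T3 \<and> tet p q r s \<and> pos p q r s \<and>
     {p, q, r, s} = {a, b, c, d}"
proof -
  have t: "tet a b c d" and n: "num a > num b" "num b > num c" "num c > num d" using assms by (auto simp: T4_def)
  show ?thesis
    using t tet_perm[OF t] pos_perm[OF t] n tri_of_tet[OF t] unfolding posface_def T3_def by (auto simp: insert_commute)
qed

lemma negface_props:
  assumes "(a, b, c, d) \<in> T4"
  shows "\<exists>p q r s. negface (a, b, c, d) k = (p, q, r) \<and> (p, q, r) \<in> T3 \<and> tet p q r s \<and> \<not> pos p q r s \<and>
     {p, q, r, s} = {a, b, c, d}"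
proof -
  have t: "tet a b c d" and n: "num a > num b" "num b > num c" "num c > num d" using assms by (auto simp: T4_def)
  show ?thesis
    using t tet_perm[OF t] pos_perm[OF t] n tri_of_tet[OF t] unfolding negface_def T3_def by (auto simp: insert_commute)
qed

lemma face_cases:
  assumes "tet p q r s" "(p, q, r) \<in> T3"
  shows "\<exists>a b c d. (a, b, c, d) \<in> T4 \<and> (p, q, r, s) \<in> {(a, b, c, d), (a, b, d, c), (a, c, d, b), (b, c, d, a)}"
proof -
  have n: "num p > num q" "num q > num r" using assms(2) by (auto simp: T3_def)
  obtain a b c d where T: "(a, b, c, d) \<in> T4" and
       cs: "(p, q, r, s) \<in> {(b, d, a, c), (c, d, a, b), (b, c, a, d), (a, c, b, d), (a, b, c, d), (a, d, b, c),
       (b, d, c, a), (c, d, b, a), (b, c, d, a), (a, c, d, b), (a, b, d, c), (a, d, c, b)}"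
    using T4_cases[OF assms(1) n(1)] by metis
  have "(p, q, r, s) \<in> {(a, b, c, d), (a, b, d, c), (a, c, d, b), (b, c, d, a)}"
    using cs n T by (elim insertE emptyE) (auto simp: T4_def)
  then show ?thesis using T by metis
qed

lemma bij_posface: "bij_betw (\<lambda>(T, k). posface T k) (T4 \<times> UNIV) T3"
proof (rule bij_betw_imageI)
  show "inj_on (\<lambda>(T, k). posface T k) (T4 \<times> UNIV)"
  proof (rule inj_onI)
    fix x y assume "x \<in> T4 \<times> (UNIV :: bool set)" "y \<in> T4 \<times> (UNIV :: bool set)"
      and "(\<lambda>(T, k). posface T k) x = (\<lambda>(T, k). posface T k) y"
    moreover obtain a b c d k where x: "x = ((a, b, c, d), k)"
      by (cases x) auto
    moreover obtain a' b' c' d' k' where y: "y = ((a', b', c', d'), k')"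
      by (cases y) auto
    ultimately have T: "(a, b, c, d) \<in> T4" and T': "(a', b', c', d') \<in> T4" and eq: "posface (a, b, c, d) k = posface (a', b', c', d') k'"
      by simp_all
    obtain p q r s where 1: "posface (a, b, c, d) k = (p, q, r)" "tet p q r s" "pos p q r s" "{p, q, r, s} = {a, b, c, d}"
      using posface_props[OF T] by metis
    obtain s' where 2: "tet p q r s'" "pos p q r s'" "{p, q, r, s'} = {a', b', c', d'}"
      using posface_props[OF T', of k'] eq 1(1) by (metis prod.inject)
    have "s = s'" using pos_unique 1 2 by metis
    then have "a = a' \<and> b = b' \<and> c = c' \<and> d = d'" using sorted4_unique[OF T T'] 1 2 by metis
    then show "x = y"
      using x y eq T by (auto simp: posface_def T4_def split: if_splits)
  qed
  show "(\<lambda>(T, k). posface T k) ` (T4 \<times> UNIV) = T3"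
  proof (intro equalityI subsetI)
    fix f assume "f \<in> (\<lambda>(T, k). posface T k) ` (T4 \<times> UNIV)"
    then obtain a b c d k where "(a, b, c, d) \<in> T4" "f = posface (a, b, c, d) k" by auto
    then show "f \<in> T3"
      using posface_props[of a b c d k] by auto
  next
    fix f assume f: "f \<in> T3"
    then obtain p q r where f': "f = (p, q, r)" "tri p q r" by (auto simp: T3_def)
    obtain s where s: "tet p q r s" "pos p q r s" using ex_pos f' by blast
    obtain a b c d where T: "(a, b, c, d) \<in> T4" and
       cs: "(p, q, r, s) \<in> {(a, b, c, d), (a, b, d, c), (a, c, d, b), (b, c, d, a)}"
      using face_cases[OF s(1)] f f' by metis
    have t: "tet a b c d" using T by (simp add: T4_def)
    have "(p, q, r) \<in> {posface (a, b, c, d) True, posface (a, b, c, d) False}"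
      using cs s(2) pos_perm[OF t] unfolding posface_def by (elim insertE emptyE) auto
    then obtain k where "(p, q, r) = posface (a, b, c, d) k" by blast
    then show "f \<in> (\<lambda>(T, k). posface T k) ` (T4 \<times> UNIV)"
      using T f'(1) by (intro image_eqI[where x = "((a, b, c, d), k)"]) auto
  qed
qed

lemma bij_negface: "bij_betw (\<lambda>(T, k). negface T k) (T4 \<times> UNIV) T3"
proof (rule bij_betw_imageI)
  show "inj_on (\<lambda>(T, k). negface T k) (T4 \<times> UNIV)"
  proof (rule inj_onI)
    fix x y assume "x \<in> T4 \<times> (UNIV :: bool set)" "y \<in> T4 \<times> (UNIV :: bool set)"
      and "(\<lambda>(T, k). negface T k) x = (\<lambda>(T, k). negface T k) y"
    moreover obtain a b c d k where x: "x = ((a, b, c, d), k)"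
      by (cases x) auto
    moreover obtain a' b' c' d' k' where y: "y = ((a', b', c', d'), k')"
      by (cases y) auto
    ultimately have T: "(a, b, c, d) \<in> T4" and T': "(a', b', c', d') \<in> T4" and eq: "negface (a, b, c, d) k = negface (a', b', c', d') k'"
      by simp_all
    obtain p q r s where 1: "negface (a, b, c, d) k = (p, q, r)" "tet p q r s" "\<not> pos p q r s" "{p, q, r, s} = {a, b, c, d}"
      using negface_props[OF T] by metis
    obtain s' where 2: "tet p q r s'" "\<not> pos p q r s'" "{p, q, r, s'} = {a', b', c', d'}"
      using negface_props[OF T', of k'] eq 1(1) by (metis prod.inject)
    have "s = s'" using pos_unique 1 2 by metis
    then have "a = a' \<and> b = b' \<and> c = c' \<and> d = d'" using sorted4_unique[OF T T'] 1 2 by metis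
    then show "x = y"
      using x y eq T by (auto simp: negface_def T4_def split: if_splits)
  qed
  show "(\<lambda>(T, k). negface T k) ` (T4 \<times> UNIV) = T3"
  proof (intro equalityI subsetI)
    fix f assume "f \<in> (\<lambda>(T, k). negface T k) ` (T4 \<times> UNIV)"
    then obtain a b c d k where "(a, b, c, d) \<in> T4" "f = negface (a, b, c, d) k" by auto
    then show "f \<in> T3"
      using negface_props[of a b c d k] by auto
  next
    fix f assume f: "f \<in> T3"
    then obtain p q r where f': "f = (p, q, r)" "tri p q r" by (auto simp: T3_def)
    obtain s where s: "tet p q r s" "\<not> pos p q r s" using ex_neg f' by blast
    obtain a b c d where T: "(a, b, c, d) \<in> T4" and
       cs: "(p, q, r, s) \<in> {(a, b, c, d), (a, b, d, c), (a, c, d, b), (b, c, d, a)}"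
      using face_cases[OF s(1)] f f' by metis
    have t: "tet a b c d" using T by (simp add: T4_def)
    have "(p, q, r) \<in> {negface (a, b, c, d) True, negface (a, b, c, d) False}"
      using cs s(2) pos_perm[OF t] unfolding negface_def by (elim insertE emptyE) auto
    then obtain k where "(p, q, r) = negface (a, b, c, d) k" by blast
    then show "f \<in> (\<lambda>(T, k). negface T k) ` (T4 \<times> UNIV)"
      using T f'(1) by (intro image_eqI[where x = "((a, b, c, d), k)"]) auto
  qed
qed

end

section \<open>Regrouping the state sum by triangles and edges\<close>

lemma sum_PiE3:
  fixes g :: "'x::finite \<Rightarrow> 'x \<Rightarrow> 'x \<Rightarrow> 'c::comm_monoid_add"
  shows "(\<Sum>a\<in>{0, 1, 2::nat} \<rightarrow>\<^sub>E UNIV. g (a 0) (a 1) (a 2)) = (\<Sum>x\<in>UNIV. \<Sum>y\<in>UNIV. \<Sum>z\<in>UNIV. g x y z)"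
  unfolding sum.cartesian_product
proof (rule sum.reindex_bij_witness[of _ "\<lambda>(x, y, z). \<lambda>k\<in>{0, 1, 2}. if k = 0 then x else if k = 1 then y else z"
      "\<lambda>a. (a 0, a 1, a 2)"])
  fix a :: "nat \<Rightarrow> 'x" assume a: "a \<in> {0, 1, 2} \<rightarrow>\<^sub>E UNIV"
  show "(case (a 0, a 1, a 2) of (x, y, z) \<Rightarrow> \<lambda>k\<in>{0, 1, 2}. if k = 0 then x else if k = 1 then y else z) = a"
    by (rule PiE_ext[OF _ a]) auto
next
  fix t :: "'x \<times> 'x \<times> 'x"
  show "(case t of (x, y, z) \<Rightarrow> \<lambda>k\<in>{0, 1, 2}. if k = 0 then x else if k = 1 then y else z) \<in> {0, 1, 2} \<rightarrow>\<^sub>E UNIV"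
    by (cases t) (simp only: prod.case restrict_PiE_iff, simp)
qed auto

context hopf_tensors
begin

lemma tr3_pillow_sum:
  "(\<Sum>a0\<in>UNIV. \<Sum>a1\<in>UNIV. \<Sum>a2\<in>UNIV. \<Sum>b0\<in>UNIV. \<Sum>b1\<in>UNIV. \<Sum>b2\<in>UNIV. \<Sum>c0\<in>UNIV. \<Sum>c1\<in>UNIV. \<Sum>c2\<in>UNIV.
     tr3 b1 b0 a2 * tr3 a0 a1 b2 * (S b0 c0 * \<Delta> w0 a0 c0) * (S b1 c1 * \<Delta> w1 a1 c1) * (S b2 c2 * \<Delta> w2 a2 c2)) =
   of_nat CARD('x) * A w2 (\<lambda>y. tr3 w0 w1 y)"
  apply (rule trans[OF _ tr3_pillow])
  unfolding D_def A_def sum_distrib_left sum.cartesian_product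
  by (rule sum.reindex_bij_witness[of _ "\<lambda>(a0, c0, a1, c1, a2, c2, b0, b1, b2). (a0, a1, a2, b0, b1, b2, c0, c1, c2)"
      "\<lambda>(a0, a1, a2, b0, b1, b2, c0, c1, c2). (a0, c0, a1, c1, a2, c2, b0, b1, b2)"])
    (auto simp: mult_ac)

end

context oriented_complex
begin

lemma mi_pl_props:
  assumes "(a, b, c, d) \<in> T4"
  shows "\<forall>e. \<exists>p q r s. mi (a, b, c, d) e = (p, q, r) \<and> pl (a, b, c, d) e = (p, q, s) \<and> tet p q r s \<and> pos p q r s"
proof (cases "pos a b c d")
  case True
  have t: "tet a b c d" using assms by (auto simp: T4_def)
  show ?thesis
    unfolding all_tet_edge mi_plus[OF t True] pl_plus[OF t True]
    using t tet_perm[OF t] pos_perm[OF t] True by auto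
next
  case False
  have t: "tet a b c d" using assms by (auto simp: T4_def)
  show ?thesis
    unfolding all_tet_edge mi_minus[OF t False] pl_minus[OF t False]
    using t tet_perm[OF t] pos_perm[OF t] False by auto
qed

text \<open>
  Crossing a tetrahedron from \<open>e\<^sub>-\<close> to \<open>e\<^sub>+\<close> is a permutation of the colors, whose cycles are the
  clockwise edge stars.
\<close>

definition nx where "nx f = (case the_inv_into (T4 \<times> UNIV) (\<lambda>(T, e). mi T e) f of (T, e) \<Rightarrow> pl T e)"

lemma nx_mi: "T \<in> T4 \<Longrightarrow> nx (mi T e) = pl T e"
  using the_inv_into_f_f[OF bij_betw_imp_inj_on[OF bij_mi], of "(T, e)"] by (simp add: nx_def)

lemma bij_nx: "bij_betw nx FL FL"
proof -
  have "bij_betw ((\<lambda>(T, e). pl T e) \<circ> the_inv_into (T4 \<times> UNIV) (\<lambda>(T, e). mi T e)) FL FL"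
    by (rule bij_betw_trans[OF bij_betw_the_inv_into[OF bij_mi] bij_pl])
  then show ?thesis
    by (simp add: comp_def nx_def[abs_def])
qed

text \<open>Both \<open>pl\<close> and the next list entry complete the triangle to a positive
  tetrahedron, so \<open>pos_unique\<close> identifies them.\<close>

lemma nx_link:
  assumes "edg p q" "num p > num q" "i < length (lnk p q)"
  shows "nx (p, q, lnk p q ! i) = (p, q, lnk p q ! ((i + 1) mod length (lnk p q)))"
proof -
  let ?r = "lnk p q ! i" and ?s = "lnk p q ! ((i + 1) mod length (lnk p q))"
  have t: "tet p q ?r ?s" "pos p q ?r ?s" using link_tet[OF assms(1,3)] by auto
  then have "(p, q, ?r) \<in> FL" using tet_tri assms(2) by (simp add: FL_def)
  then have "(p, q, ?r) \<in> (\<lambda>(T, e). mi T e) ` (T4 \<times> UNIV)"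
    by (simp only: bij_betw_imp_surj_on[OF bij_mi])
  then obtain a b c d e where T: "(a, b, c, d) \<in> T4" "(p, q, ?r) = mi (a, b, c, d) e"
    by auto
  obtain s where s: "pl (a, b, c, d) e = (p, q, s)" "tet p q ?r s" "pos p q ?r s"
    using mi_pl_props[OF T(1)] T(2) by (metis prod.inject)
  have "s = ?s" using pos_unique[OF s(2) t(1)] s(3) t(2) by simp
  then show ?thesis using nx_mi[OF T(1), of e] T(2) s(1) by simp
qed

lemma finite_T: "finite T4" "finite T3" "finite T2" "finite FL"
proof -
  have V: "finite (\<Union>Sg)" using finite_complex finite_simplex by blast
  have "T4 \<subseteq> \<Union>Sg \<times> \<Union>Sg \<times> \<Union>Sg \<times> \<Union>Sg" "T3 \<subseteq> \<Union>Sg \<times> \<Union>Sg \<times> \<Union>Sg" "T2 \<subseteq> \<Union>Sg \<times> \<Union>Sg" "FL \<subseteq> \<Union>Sg \<times> \<Union>Sg \<times> \<Union>Sg"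
    by (auto simp: T4_def T3_def T2_def FL_def tet_def tri_def edg_def)
  then show "finite T4" "finite T3" "finite T2" "finite FL"
    by (meson V finite_SigmaI finite_subset)+
qed

end

locale state_sum = oriented_complex Sg num pos lnk + hopf_tensors C \<eta> \<Delta> \<epsilon> S
  for Sg :: "'v set set" and num pos lnk and C :: "'x::finite \<Rightarrow> 'x \<Rightarrow> 'x \<Rightarrow> complex" and \<eta> \<Delta> \<epsilon> S
begin

definition C4 :: "'v \<times> 'v \<times> 'v \<times> 'v \<Rightarrow> (tet_edge \<Rightarrow> 'x) \<Rightarrow> (tet_edge \<Rightarrow> 'x) \<Rightarrow> complex"
  where "C4 = (\<lambda>(a, b, c, d) E E'. if pos a b c d
    then cyclic_contraction C [E' ei, E ek, E ej] * cyclic_contraction C [E' ek, E' em, E el] *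
         cyclic_contraction C [E' ej, E' el, E en] * cyclic_contraction C [E ei, E' en, E em]
    else cyclic_contraction C [E ei, E' ek, E' ej] * cyclic_contraction C [E ek, E' em, E el] *
         cyclic_contraction C [E ej, E' el, E en] * cyclic_contraction C [E' ei, E' en, E em])"

definition W :: "('v \<times> 'v \<times> 'v \<Rightarrow> 'x) \<Rightarrow> 'v \<times> 'v \<times> 'v \<times> 'v \<Rightarrow> complex"
  where "W col T = (\<Sum>E\<in>UNIV. \<Sum>E'\<in>UNIV. \<Sum>E''\<in>UNIV.
     C4 T E E' * weight_D \<Delta> S (\<lambda>e. col (mi T e)) (\<lambda>e. col (pl T e)) E E' E'')"

text \<open>The \<open>C\<close>-factors that the two tetrahedra adjacent to a triangle contribute at it.\<close>

definition PF :: "('v \<times> 'v \<times> 'v \<Rightarrow> 'x) \<Rightarrow> ('v \<times> 'v \<times> 'v \<Rightarrow> 'x) \<Rightarrow> 'v \<times> 'v \<times> 'v \<Rightarrow> complex"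
  where "PF \<alpha> \<beta> F = tr3 (\<beta> (slot F 1)) (\<beta> (slot F 0)) (\<alpha> (slot F 2))"

definition NF :: "('v \<times> 'v \<times> 'v \<Rightarrow> 'x) \<Rightarrow> ('v \<times> 'v \<times> 'v \<Rightarrow> 'x) \<Rightarrow> 'v \<times> 'v \<times> 'v \<Rightarrow> complex"
  where "NF \<alpha> \<beta> F = tr3 (\<alpha> (slot F 0)) (\<alpha> (slot F 1)) (\<beta> (slot F 2))"

text \<open>What a collapsed pillow leaves behind, the trace of w0 w1 S(w2): the antipode sits on
  the one edge whose arrow opposes the cyclic order.\<close>

definition GF :: "('v \<times> 'v \<times> 'v \<Rightarrow> 'x) \<Rightarrow> 'v \<times> 'v \<times> 'v \<Rightarrow> complex"
  where "GF w F = A (w (slot F 2)) (\<lambda>y. tr3 (w (slot F 0)) (w (slot F 1)) y)"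

definition HF :: "('v \<times> 'v \<times> 'v \<Rightarrow> 'x) \<Rightarrow> 'v \<times> 'v \<Rightarrow> complex"
  where "HF w = (\<lambda>(p, q). cyclic_contraction \<Delta> (map (\<lambda>r. w (p, q, r)) (lnk p q)))"

text \<open>In a face, an edge contributes its primed index if the face is the \<open>e_-\<close>
  side of that edge and its unprimed index if it is the \<open>e_+\<close> side. So each of the four
  factors \<open>C\<close> belongs to one face, up to the cyclic rotations supplied to the
  simplifier.\<close>

lemma C4_faces:
  assumes "T \<in> T4"
  shows "C4 T (\<lambda>e. \<alpha> (pl T e)) (\<lambda>e. \<beta> (mi T e)) =
    (\<Prod>k\<in>UNIV. PF \<alpha> \<beta> (posface T k)) * (\<Prod>k\<in>UNIV. NF \<alpha> \<beta> (negface T k))"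
proof -
  obtain a b c d where T: "T = (a, b, c, d)" by (cases T) auto
  have t: "tet a b c d" using assms T by (simp add: T4_def)
  show ?thesis
  proof (cases "pos a b c d")
    case True
    show ?thesis
      unfolding T UNIV_bool C4_def PF_def NF_def slot_def cyclic_contraction_tr3
      using True by (simp add: mi_plus[OF t True] pl_plus[OF t True] posface_def negface_def
          tr3_cyclic[of "\<alpha> (b, d, a)"] tr3_cyclic[of "\<beta> (a, d, b)"] tr3_cyclic[of "\<beta> (b, d, c)"])
  next
    case False
    show ?thesis
      unfolding T UNIV_bool C4_def PF_def NF_def slot_def cyclic_contraction_tr3
      using False by (simp add: mi_minus[OF t False] pl_minus[OF t False] posface_def negface_def
          tr3_cyclic[of "\<alpha> (b, d, c)"] tr3_cyclic[of "\<alpha> (c, d, a)"] tr3_cyclic[of "\<beta> (a, d, c)"]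
          tr3_cyclic[of "\<alpha> (b, c, a)"] tr3_cyclic[of "\<beta> (a, c, b)"])
  qed
qed

lemma prod_C4:
  "(\<Prod>T\<in>T4. C4 T (\<lambda>e. \<alpha> (pl T e)) (\<lambda>e. \<beta> (mi T e))) = (\<Prod>F\<in>T3. PF \<alpha> \<beta> F * NF \<alpha> \<beta> F)"
proof -
  have "(\<Prod>T\<in>T4. \<Prod>k\<in>UNIV. PF \<alpha> \<beta> (posface T k)) = (\<Prod>F\<in>T3. PF \<alpha> \<beta> F)"
    by (rule prod_bij_sigma[OF bij_posface finite_T(1)]) simp
  moreover have "(\<Prod>T\<in>T4. \<Prod>k\<in>UNIV. NF \<alpha> \<beta> (negface T k)) = (\<Prod>F\<in>T3. NF \<alpha> \<beta> F)"
    by (rule prod_bij_sigma[OF bij_negface finite_T(1)]) simp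
  ultimately show ?thesis
    by (simp add: C4_faces prod.distrib cong: prod.cong)
qed

text \<open>\<open>E\<close> is transported along \<open>bij_pl\<close>, but \<open>E'\<close> and
  \<open>E''\<close> along \<open>bij_mi\<close>. With this choice the indices at a triangle all
  refer to its own flags, while the tensor of a tetrahedron couples a flag with its successor under
  \<open>nx\<close>.\<close>

lemma prod_W:
  "(\<Prod>T\<in>T4. W col T) = (\<Sum>\<alpha>\<in>FL \<rightarrow>\<^sub>E UNIV. \<Sum>\<beta>\<in>FL \<rightarrow>\<^sub>E UNIV. \<Sum>\<gamma>\<in>FL \<rightarrow>\<^sub>E UNIV.
     (\<Prod>F\<in>T3. PF \<alpha> \<beta> F * NF \<alpha> \<beta> F) * (\<Prod>f\<in>FL. S (\<beta> f) (\<gamma> f)) *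
     (\<Prod>f\<in>FL. comult_lowered \<Delta> (\<gamma> f) (\<alpha> (nx f)) (col (nx f)) (col f)))"
proof -
  have "(\<Prod>T\<in>T4. W col T) = (\<Sum>\<alpha>\<in>FL \<rightarrow>\<^sub>E UNIV. \<Sum>\<beta>\<in>FL \<rightarrow>\<^sub>E UNIV. \<Sum>\<gamma>\<in>FL \<rightarrow>\<^sub>E UNIV. \<Prod>T\<in>T4.
     C4 T (\<lambda>e. \<alpha> (pl T e)) (\<lambda>e. \<beta> (mi T e)) * weight_D \<Delta> S (\<lambda>e. col (mi T e)) (\<lambda>e. col (pl T e))
       (\<lambda>e. \<alpha> (pl T e)) (\<lambda>e. \<beta> (mi T e)) (\<lambda>e. \<gamma> (mi T e)))"
    unfolding W_def
    by (subst prod_sum_reindex[OF finite_T(1) bij_pl]) (simp only: prod_sum_reindex[OF finite_T(1) bij_mi])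
  also have "\<dots> = (\<Sum>\<alpha>\<in>FL \<rightarrow>\<^sub>E UNIV. \<Sum>\<beta>\<in>FL \<rightarrow>\<^sub>E UNIV. \<Sum>\<gamma>\<in>FL \<rightarrow>\<^sub>E UNIV.
     (\<Prod>F\<in>T3. PF \<alpha> \<beta> F * NF \<alpha> \<beta> F) * (\<Prod>f\<in>FL. S (\<beta> f) (\<gamma> f) *
     comult_lowered \<Delta> (\<gamma> f) (\<alpha> (nx f)) (col (nx f)) (col f)))"
  proof -
    have "(\<Prod>T\<in>T4. weight_D \<Delta> S (\<lambda>e. col (mi T e)) (\<lambda>e. col (pl T e))
       (\<lambda>e. \<alpha> (pl T e)) (\<lambda>e. \<beta> (mi T e)) (\<lambda>e. \<gamma> (mi T e))) =
      (\<Prod>f\<in>FL. S (\<beta> f) (\<gamma> f) * comult_lowered \<Delta> (\<gamma> f) (\<alpha> (nx f)) (col (nx f)) (col f))" for \<alpha> \<beta> \<gamma>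
      unfolding weight_D_def by (subst prod_bij_sigma[OF bij_mi finite_T(1), symmetric]) (simp_all add: nx_mi)
    then show ?thesis
      by (simp add: prod.distrib prod_C4)
  qed
  finally show ?thesis
    by (simp add: prod.distrib mult.assoc)
qed

lemma prod_sum_FL:
  "(\<Prod>f\<in>FL. \<Sum>u\<in>UNIV. h f u) = (\<Sum>u\<in>FL \<rightarrow>\<^sub>E UNIV. \<Prod>f\<in>FL. h f (u f) :: complex)" for h :: "_ \<Rightarrow> 'x \<Rightarrow> complex"
  using finite_T by (intro prod_sum_PiE) auto

text \<open>
  Summing over the colors fuses, around each edge, the two comultiplications facing each other
  across a triangle.
\<close>

lemma sum_col:
  "(\<Sum>col\<in>FL \<rightarrow>\<^sub>E UNIV. \<Prod>f\<in>FL. comult_lowered \<Delta> (\<gamma> f) (\<alpha> (nx f)) (col (nx f)) (col f)) =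
   (\<Sum>w\<in>FL \<rightarrow>\<^sub>E UNIV. (\<Prod>f\<in>FL. \<Delta> (w f) (\<alpha> f) (\<gamma> f)) * (\<Sum>u\<in>FL \<rightarrow>\<^sub>E UNIV. \<Prod>f\<in>FL. \<Delta> (u f) (w f) (u (nx f))))"
proof -
  have nxFL: "nx f \<in> FL" if "f \<in> FL" for f
    using bij_betw_apply[OF bij_nx that] .
  have "(\<Sum>col\<in>FL \<rightarrow>\<^sub>E UNIV. \<Prod>f\<in>FL. comult_lowered \<Delta> (\<gamma> f) (\<alpha> (nx f)) (col (nx f)) (col f)) =
     (\<Sum>col\<in>FL \<rightarrow>\<^sub>E UNIV. \<Sum>u\<in>FL \<rightarrow>\<^sub>E UNIV. \<Prod>f\<in>FL. \<Delta> (col f) (\<gamma> f) (u f) * \<Delta> (u f) (\<alpha> (nx f)) (col (nx f)))"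
    by (simp only: comult_lowered_eq prod_sum_FL)
  \<comment> \<open>The auxiliary index moves to the next flag, so that a later shift of one factor
    along \<open>nx\<close> brings the two coproducts containing \<open>col f\<close>
    together.\<close>
  also have "\<dots> = (\<Sum>col\<in>FL \<rightarrow>\<^sub>E UNIV. \<Sum>u\<in>FL \<rightarrow>\<^sub>E UNIV. \<Prod>f\<in>FL. \<Delta> (col f) (\<gamma> f) (u (nx f)) * \<Delta> (u (nx f)) (\<alpha> (nx f)) (col (nx f)))"
    by (subst sum_PiE_reindex[OF bij_nx]) (intro sum.cong prod.cong refl, simp)
  also have "\<dots> = (\<Sum>col\<in>FL \<rightarrow>\<^sub>E UNIV. \<Sum>u\<in>FL \<rightarrow>\<^sub>E UNIV. \<Prod>f\<in>FL. \<Delta> (u f) (\<alpha> f) (col f) * \<Delta> (col f) (\<gamma> f) (u (nx f)))"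
    by (simp only: prod.distrib prod.reindex_bij_betw[OF bij_nx, of "\<lambda>f. \<Delta> (_ f) (\<alpha> f) (_ f)"] mult.commute)
  also have "\<dots> = (\<Sum>u\<in>FL \<rightarrow>\<^sub>E UNIV. \<Prod>f\<in>FL. \<Sum>c\<in>UNIV. \<Delta> (u f) (\<alpha> f) c * \<Delta> c (\<gamma> f) (u (nx f)))"
    by (subst sum.swap) (simp only: prod_sum_FL)
  also have "\<dots> = (\<Sum>u\<in>FL \<rightarrow>\<^sub>E UNIV. \<Sum>w\<in>FL \<rightarrow>\<^sub>E UNIV. \<Prod>f\<in>FL. \<Delta> (u f) (w f) (u (nx f)) * \<Delta> (w f) (\<alpha> f) (\<gamma> f))"
    by (simp only: coassoc[symmetric] prod_sum_FL)
  also have "\<dots> = (\<Sum>w\<in>FL \<rightarrow>\<^sub>E UNIV. (\<Prod>f\<in>FL. \<Delta> (w f) (\<alpha> f) (\<gamma> f)) * (\<Sum>u\<in>FL \<rightarrow>\<^sub>E UNIV. \<Prod>f\<in>FL. \<Delta> (u f) (w f) (u (nx f))))"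
    by (subst sum.swap) (simp add: prod.distrib sum_distrib_left mult.commute)
  finally show ?thesis .
qed

lemma prod_HF: "(\<Sum>u\<in>FL \<rightarrow>\<^sub>E UNIV. \<Prod>f\<in>FL. \<Delta> (u f) (w f) (u (nx f))) = (\<Prod>E\<in>T2. HF w E)"
proof -
  let ?J = "\<lambda>(p, q). set (lnk p q)"
  have "HF w E = (\<Sum>u\<in>?J E \<rightarrow>\<^sub>E UNIV. \<Prod>r\<in>?J E. \<Delta> (u r) (w (fst E, snd E, r)) (u (snd (snd (nx (fst E, snd E, r))))))"
    if "E \<in> T2" for E
    using that unfolding HF_def
    by (auto simp: T2_def split_def intro!: cyclic_contraction_map simp: nx_link link_distinct edg_def)
  then have "(\<Prod>E\<in>T2. HF w E) = (\<Prod>E\<in>T2. \<Sum>u\<in>?J E \<rightarrow>\<^sub>E UNIV. \<Prod>r\<in>?J E.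
      \<Delta> (u r) (w (fst E, snd E, r)) (u (snd (snd (nx (fst E, snd E, r))))))"
    by (rule prod.cong[OF refl])
  also have "\<dots> = (\<Sum>u\<in>FL \<rightarrow>\<^sub>E UNIV. \<Prod>E\<in>T2. \<Prod>r\<in>?J E. \<Delta> ((\<lambda>r\<in>?J E. u (fst E, snd E, r)) r) (w (fst E, snd E, r))
      ((\<lambda>r\<in>?J E. u (fst E, snd E, r)) (snd (snd (nx (fst E, snd E, r))))))"
    by (rule prod_sum_PiE_reindex[OF finite_T(3) _ bij_link]) auto
  also have "\<dots> = (\<Sum>u\<in>FL \<rightarrow>\<^sub>E UNIV. \<Prod>E\<in>T2. \<Prod>r\<in>?J E. \<Delta> (u (fst E, snd E, r)) (w (fst E, snd E, r)) (u (nx (fst E, snd E, r))))"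
  proof (intro sum.cong prod.cong refl)
    fix u :: "_ \<Rightarrow> 'x" and E r assume E: "E \<in> T2" and r: "r \<in> ?J E"
    obtain p q where pq: "E = (p, q)" "edg p q" "num p > num q" using E by (auto simp: T2_def)
    obtain i where i: "i < length (lnk p q)" "r = lnk p q ! i" using r pq by (auto simp: in_set_conv_nth)
    have "(i + 1) mod length (lnk p q) < length (lnk p q)" using i by (intro mod_less_divisor) auto
    then show "\<Delta> ((\<lambda>r\<in>?J E. u (fst E, snd E, r)) r) (w (fst E, snd E, r))
      ((\<lambda>r\<in>?J E. u (fst E, snd E, r)) (snd (snd (nx (fst E, snd E, r))))) =
      \<Delta> (u (fst E, snd E, r)) (w (fst E, snd E, r)) (u (nx (fst E, snd E, r)))"
      using i pq by (simp add: nx_link del: mod_Suc)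
  qed
  also have "\<dots> = (\<Sum>u\<in>FL \<rightarrow>\<^sub>E UNIV. \<Prod>f\<in>FL. \<Delta> (u f) (w f) (u (nx f)))"
    using prod_bij_sigma[OF bij_link finite_T(3), of "\<lambda>f. \<Delta> (_ f) (w f) (_ (nx f))"] by auto
  finally show ?thesis ..
qed

lemma prod_FL_slots: "(\<Prod>f\<in>FL. g f) = (\<Prod>F\<in>T3. g (slot F 0) * g (slot F 1) * g (slot F 2))" for g :: "_ \<Rightarrow> complex"
  by (subst prod_bij_sigma[OF bij_slot finite_T(2), symmetric]) (simp_all add: mult.assoc)

lemma sum_slots1:
  "(\<Sum>\<alpha>\<in>FL \<rightarrow>\<^sub>E UNIV. \<Prod>F\<in>T3. g F (\<alpha> (slot F 0)) (\<alpha> (slot F 1)) (\<alpha> (slot F 2))) =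
   (\<Prod>F\<in>T3. \<Sum>x\<in>UNIV. \<Sum>y\<in>UNIV. \<Sum>z\<in>UNIV. g F x y z)" for g :: "_ \<Rightarrow> 'x \<Rightarrow> 'x \<Rightarrow> 'x \<Rightarrow> complex"
  unfolding sum_PiE3[symmetric] by (subst prod_sum_PiE_reindex[OF finite_T(2) _ bij_slot]) simp_all

text \<open>Once w is fixed, the three families interact only within a triangle. Sorting flags by
  slots makes the sum a product of independent ninefold sums, each of which is a pillow.\<close>

lemma pillows:
  "(\<Sum>\<alpha>\<in>FL \<rightarrow>\<^sub>E UNIV. \<Sum>\<beta>\<in>FL \<rightarrow>\<^sub>E UNIV. \<Sum>\<gamma>\<in>FL \<rightarrow>\<^sub>E UNIV.
     (\<Prod>F\<in>T3. PF \<alpha> \<beta> F * NF \<alpha> \<beta> F) * (\<Prod>f\<in>FL. S (\<beta> f) (\<gamma> f)) * (\<Prod>f\<in>FL. \<Delta> (w f) (\<alpha> f) (\<gamma> f))) =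
   of_nat CARD('x) ^ card T3 * (\<Prod>F\<in>T3. GF w F)"
proof -
  let ?P = "FL \<rightarrow>\<^sub>E (UNIV :: 'x set)"
  define Q where "Q F a0 a1 a2 b0 b1 b2 c0 c1 c2 = tr3 b1 b0 a2 * tr3 a0 a1 b2 * (S b0 c0 * \<Delta> (w (slot F 0)) a0 c0) *
     (S b1 c1 * \<Delta> (w (slot F 1)) a1 c1) * (S b2 c2 * \<Delta> (w (slot F 2)) a2 c2)" for F a0 a1 a2 b0 b1 b2 c0 c1 c2
  have "(\<Sum>\<alpha>\<in>FL \<rightarrow>\<^sub>E UNIV. \<Sum>\<beta>\<in>FL \<rightarrow>\<^sub>E UNIV. \<Sum>\<gamma>\<in>FL \<rightarrow>\<^sub>E UNIV.
     (\<Prod>F\<in>T3. PF \<alpha> \<beta> F * NF \<alpha> \<beta> F) * (\<Prod>f\<in>FL. S (\<beta> f) (\<gamma> f)) * (\<Prod>f\<in>FL. \<Delta> (w f) (\<alpha> f) (\<gamma> f))) =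
   (\<Sum>\<alpha>\<in>?P. \<Sum>\<beta>\<in>?P. \<Sum>\<gamma>\<in>?P. \<Prod>F\<in>T3.
     Q F (\<alpha> (slot F 0)) (\<alpha> (slot F 1)) (\<alpha> (slot F 2)) (\<beta> (slot F 0)) (\<beta> (slot F 1)) (\<beta> (slot F 2))
       (\<gamma> (slot F 0)) (\<gamma> (slot F 1)) (\<gamma> (slot F 2)))"
    by (simp add: prod_FL_slots PF_def NF_def Q_def mult_ac flip: prod.distrib)
  also have "\<dots> = (\<Sum>\<alpha>\<in>?P. \<Sum>\<beta>\<in>?P. \<Prod>F\<in>T3. \<Sum>c0\<in>UNIV. \<Sum>c1\<in>UNIV. \<Sum>c2\<in>UNIV.
     Q F (\<alpha> (slot F 0)) (\<alpha> (slot F 1)) (\<alpha> (slot F 2)) (\<beta> (slot F 0)) (\<beta> (slot F 1)) (\<beta> (slot F 2)) c0 c1 c2)"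
    by (intro sum.cong refl sum_slots1[where g = "\<lambda>F. Q F (_ (slot F 0)) (_ (slot F 1)) (_ (slot F 2)) (_ (slot F 0)) (_ (slot F 1)) (_ (slot F 2))"])
  also have "\<dots> = (\<Sum>\<alpha>\<in>?P. \<Prod>F\<in>T3. \<Sum>b0\<in>UNIV. \<Sum>b1\<in>UNIV. \<Sum>b2\<in>UNIV. \<Sum>c0\<in>UNIV. \<Sum>c1\<in>UNIV. \<Sum>c2\<in>UNIV.
     Q F (\<alpha> (slot F 0)) (\<alpha> (slot F 1)) (\<alpha> (slot F 2)) b0 b1 b2 c0 c1 c2)"
    by (intro sum.cong refl sum_slots1[where g = "\<lambda>F b0 b1 b2. \<Sum>c0\<in>UNIV. \<Sum>c1\<in>UNIV. \<Sum>c2\<in>UNIV.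
      Q F (_ (slot F 0)) (_ (slot F 1)) (_ (slot F 2)) b0 b1 b2 c0 c1 c2"])
  also have "\<dots> = (\<Prod>F\<in>T3. \<Sum>a0\<in>UNIV. \<Sum>a1\<in>UNIV. \<Sum>a2\<in>UNIV. \<Sum>b0\<in>UNIV. \<Sum>b1\<in>UNIV. \<Sum>b2\<in>UNIV. \<Sum>c0\<in>UNIV. \<Sum>c1\<in>UNIV. \<Sum>c2\<in>UNIV.
     Q F a0 a1 a2 b0 b1 b2 c0 c1 c2)"
    by (rule sum_slots1[where g = "\<lambda>F a0 a1 a2. \<Sum>b0\<in>UNIV. \<Sum>b1\<in>UNIV. \<Sum>b2\<in>UNIV. \<Sum>c0\<in>UNIV. \<Sum>c1\<in>UNIV. \<Sum>c2\<in>UNIV.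
      Q F a0 a1 a2 b0 b1 b2 c0 c1 c2"])
  also have "\<dots> = (\<Prod>F\<in>T3. of_nat CARD('x) * GF w F)"
    by (simp only: Q_def tr3_pillow_sum GF_def)
  finally show ?thesis
    by (simp add: prod.distrib)
qed

lemma sum_W:
  "(\<Sum>col\<in>FL \<rightarrow>\<^sub>E UNIV. \<Prod>T\<in>T4. W col T) =
   of_nat CARD('x) ^ card T3 * (\<Sum>w\<in>FL \<rightarrow>\<^sub>E UNIV. (\<Prod>F\<in>T3. GF w F) * (\<Prod>E\<in>T2. HF w E))"
proof -
  let ?P = "FL \<rightarrow>\<^sub>E (UNIV :: 'x set)"
  have "(\<Sum>col\<in>?P. \<Prod>T\<in>T4. W col T) = (\<Sum>\<alpha>\<in>?P. \<Sum>\<beta>\<in>?P. \<Sum>\<gamma>\<in>?P.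
     (\<Prod>F\<in>T3. PF \<alpha> \<beta> F * NF \<alpha> \<beta> F) * (\<Prod>f\<in>FL. S (\<beta> f) (\<gamma> f)) *
     (\<Sum>col\<in>?P. \<Prod>f\<in>FL. comult_lowered \<Delta> (\<gamma> f) (\<alpha> (nx f)) (col (nx f)) (col f)))"
    unfolding prod_W sum_distrib_left
    by (subst sum.swap, rule sum.cong[OF refl], subst sum.swap, rule sum.cong[OF refl], rule sum.swap)
  also have "\<dots> = (\<Sum>\<alpha>\<in>?P. \<Sum>\<beta>\<in>?P. \<Sum>\<gamma>\<in>?P. \<Sum>w\<in>?P.
     (\<Prod>F\<in>T3. PF \<alpha> \<beta> F * NF \<alpha> \<beta> F) * (\<Prod>f\<in>FL. S (\<beta> f) (\<gamma> f)) * (\<Prod>f\<in>FL. \<Delta> (w f) (\<alpha> f) (\<gamma> f)) * (\<Prod>E\<in>T2. HF w E))"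
    unfolding sum_col prod_HF sum_distrib_left by (simp only: mult.assoc)
  also have "\<dots> = (\<Sum>w\<in>?P. \<Sum>\<alpha>\<in>?P. \<Sum>\<beta>\<in>?P. \<Sum>\<gamma>\<in>?P.
     (\<Prod>F\<in>T3. PF \<alpha> \<beta> F * NF \<alpha> \<beta> F) * (\<Prod>f\<in>FL. S (\<beta> f) (\<gamma> f)) * (\<Prod>f\<in>FL. \<Delta> (w f) (\<alpha> f) (\<gamma> f)) * (\<Prod>E\<in>T2. HF w E))"
    by (rule sym, subst sum.swap, rule sum.cong[OF refl], subst sum.swap,
        rule sum.cong[OF refl], rule sum.swap)
  also have "\<dots> = (\<Sum>w\<in>?P. of_nat CARD('x) ^ card T3 * (\<Prod>F\<in>T3. GF w F) * (\<Prod>E\<in>T2. HF w E))"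
    by (simp only: sum_distrib_right[symmetric] pillows)
  finally show ?thesis
    by (simp only: sum_distrib_left mult.assoc)
qed

text \<open>If the orientation of the triangle follows the decreasing order (\<open>ev\<close>),
  only slot 2 carries an antipode; otherwise slots 0 and 1 do and the trace is reversed. By
  \<open>tr3_flip\<close> summing out \<zeta> gives the same \<open>GF\<close> in both
  cases.\<close>

lemma sum_hinges:
  assumes sg: "\<And>F k. F \<in> T3 \<Longrightarrow> k \<in> {0, 1, 2} \<Longrightarrow> sg (slot F k) \<longleftrightarrow> (ev F \<longleftrightarrow> k \<noteq> 2)"
    and cF: "\<And>F \<zeta>. F \<in> T3 \<Longrightarrow> cF \<zeta> F = (if ev F then tr3 (\<zeta> (slot F 0)) (\<zeta> (slot F 1)) (\<zeta> (slot F 2))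
       else tr3 (\<zeta> (slot F 2)) (\<zeta> (slot F 1)) (\<zeta> (slot F 0)))"
  shows "(\<Sum>\<zeta>\<in>FL \<rightarrow>\<^sub>E UNIV. (\<Prod>F\<in>T3. cF \<zeta> F) * (\<Prod>(p, q)\<in>T2.
      hinge_factor \<Delta> S (map (\<lambda>r. (\<zeta> (p, q, r), sg (p, q, r))) (lnk p q)))) =
    (\<Sum>w\<in>FL \<rightarrow>\<^sub>E UNIV. (\<Prod>F\<in>T3. GF w F) * (\<Prod>E\<in>T2. HF w E))"
proof -
  let ?P = "FL \<rightarrow>\<^sub>E (UNIV :: 'x set)"
  let ?J = "\<lambda>(p, q). set (lnk p q)"
  define m where "m f z y = (if sg f then of_bool (y = z) else S z y)" for f z y
  have hinges: "(\<Prod>(p, q)\<in>T2. hinge_factor \<Delta> S (map (\<lambda>r. (\<zeta> (p, q, r), sg (p, q, r))) (lnk p q))) =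
    (\<Sum>w\<in>?P. (\<Prod>f\<in>FL. m f (\<zeta> f) (w f)) * (\<Prod>E\<in>T2. HF w E))" for \<zeta>
  proof -
    have "(\<Prod>(p, q)\<in>T2. hinge_factor \<Delta> S (map (\<lambda>r. (\<zeta> (p, q, r), sg (p, q, r))) (lnk p q))) =
      (\<Prod>E\<in>T2. \<Sum>y\<in>?J E \<rightarrow>\<^sub>E UNIV. (\<Prod>r\<in>?J E. m (fst E, snd E, r) (\<zeta> (fst E, snd E, r)) (y r)) *
        cyclic_contraction \<Delta> (map y (lnk (fst E) (snd E))))"
    proof (rule prod.cong[OF refl])
      fix E assume "E \<in> T2"
      then obtain p q where "E = (p, q)" "edg p q" by (auto simp: T2_def)
      then show "(case E of (p, q) \<Rightarrow> hinge_factor \<Delta> S (map (\<lambda>r. (\<zeta> (p, q, r), sg (p, q, r))) (lnk p q))) =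
        (\<Sum>y\<in>?J E \<rightarrow>\<^sub>E UNIV. (\<Prod>r\<in>?J E. m (fst E, snd E, r) (\<zeta> (fst E, snd E, r)) (y r)) *
          cyclic_contraction \<Delta> (map y (lnk (fst E) (snd E))))"
        using hinge_factor_map[of "lnk p q"] link_distinct[of p q] by (simp add: m_def edg_def)
    qed
    also have "\<dots> = (\<Sum>w\<in>?P. \<Prod>E\<in>T2. (\<Prod>r\<in>?J E. m (fst E, snd E, r) (\<zeta> (fst E, snd E, r)) ((\<lambda>r\<in>?J E. w (fst E, snd E, r)) r)) *
        cyclic_contraction \<Delta> (map (\<lambda>r\<in>?J E. w (fst E, snd E, r)) (lnk (fst E) (snd E))))"
      by (rule prod_sum_PiE_reindex[OF finite_T(3) _ bij_link]) auto
    also have "\<dots> = (\<Sum>w\<in>?P. \<Prod>E\<in>T2. (\<Prod>r\<in>?J E. m (fst E, snd E, r) (\<zeta> (fst E, snd E, r)) (w (fst E, snd E, r))) * HF w E)"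
      by (intro sum.cong prod.cong arg_cong2[where f = "(*)"] refl)
        (auto simp: HF_def intro!: arg_cong[where f = "cyclic_contraction \<Delta>"])
    also have "\<dots> = (\<Sum>w\<in>?P. (\<Prod>f\<in>FL. m f (\<zeta> f) (w f)) * (\<Prod>E\<in>T2. HF w E))"
      using prod_bij_sigma[OF bij_link finite_T(3), of "\<lambda>f. m f (\<zeta> f) (_ f)"] by (simp add: prod.distrib split_def)
    finally show ?thesis .
  qed
  have "(\<Sum>\<zeta>\<in>?P. (\<Prod>F\<in>T3. cF \<zeta> F) * (\<Prod>f\<in>FL. m f (\<zeta> f) (w f))) = (\<Prod>F\<in>T3. GF w F)" for w
  proof -
    have "(\<Sum>\<zeta>\<in>?P. (\<Prod>F\<in>T3. cF \<zeta> F) * (\<Prod>f\<in>FL. m f (\<zeta> f) (w f))) =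
      (\<Sum>\<zeta>\<in>?P. \<Prod>F\<in>T3. (if ev F then tr3 (\<zeta> (slot F 0)) (\<zeta> (slot F 1)) (\<zeta> (slot F 2))
         else tr3 (\<zeta> (slot F 2)) (\<zeta> (slot F 1)) (\<zeta> (slot F 0))) * (m (slot F 0) (\<zeta> (slot F 0)) (w (slot F 0)) *
         m (slot F 1) (\<zeta> (slot F 1)) (w (slot F 1)) * m (slot F 2) (\<zeta> (slot F 2)) (w (slot F 2))))"
      by (simp add: prod_FL_slots cF cong: prod.cong flip: prod.distrib)
    also have "\<dots> = (\<Prod>F\<in>T3. \<Sum>x\<in>UNIV. \<Sum>y\<in>UNIV. \<Sum>z\<in>UNIV. (if ev F then tr3 x y z else tr3 z y x) *
        (m (slot F 0) x (w (slot F 0)) * m (slot F 1) y (w (slot F 1)) * m (slot F 2) z (w (slot F 2))))"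
      by (rule sum_slots1)
    also have "\<dots> = (\<Prod>F\<in>T3. GF w F)"
    proof (rule prod.cong[OF refl])
      fix F assume F: "F \<in> T3"
      show "(\<Sum>x\<in>UNIV. \<Sum>y\<in>UNIV. \<Sum>z\<in>UNIV. (if ev F then tr3 x y z else tr3 z y x) *
        (m (slot F 0) x (w (slot F 0)) * m (slot F 1) y (w (slot F 1)) * m (slot F 2) z (w (slot F 2)))) = GF w F"
      proof (cases "ev F")
        case True
        then have "(\<Sum>x\<in>UNIV. \<Sum>y\<in>UNIV. \<Sum>z\<in>UNIV. (if ev F then tr3 x y z else tr3 z y x) *
          (m (slot F 0) x (w (slot F 0)) * m (slot F 1) y (w (slot F 1)) * m (slot F 2) z (w (slot F 2)))) =
          (\<Sum>x\<in>UNIV. of_bool (w (slot F 0) = x) * (\<Sum>y\<in>UNIV. of_bool (w (slot F 1) = y) * (\<Sum>z\<in>UNIV. S z (w (slot F 2)) * tr3 x y z)))"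
          using sg[OF F] by (simp add: m_def sum_distrib_left mult_ac)
        then show ?thesis
          by (simp add: sum_of_bool GF_def A_def)
      next
        case False
        then have "(\<Sum>x\<in>UNIV. \<Sum>y\<in>UNIV. \<Sum>z\<in>UNIV. (if ev F then tr3 x y z else tr3 z y x) *
          (m (slot F 0) x (w (slot F 0)) * m (slot F 1) y (w (slot F 1)) * m (slot F 2) z (w (slot F 2)))) =
          (\<Sum>x\<in>UNIV. S x (w (slot F 0)) * (\<Sum>y\<in>UNIV. S y (w (slot F 1)) * (\<Sum>z\<in>UNIV. of_bool (w (slot F 2) = z) * tr3 z y x)))"
          using sg[OF F] unfolding sum_distrib_left by (intro sum.cong refl) (simp add: m_def mult_ac)
        then show ?thesis
          unfolding GF_def tr3_flip by (simp add: sum_of_bool A_def tr3_cyclic[of "w (slot F 2)"])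
      qed
    qed
    finally show ?thesis .
  qed
  then have "(\<Sum>w\<in>?P. \<Sum>\<zeta>\<in>?P. (\<Prod>F\<in>T3. cF \<zeta> F) * ((\<Prod>f\<in>FL. m f (\<zeta> f) (w f)) * (\<Prod>E\<in>T2. HF w E))) =
      (\<Sum>w\<in>?P. (\<Prod>F\<in>T3. GF w F) * (\<Prod>E\<in>T2. HF w E))"
    by (simp only: mult.assoc[symmetric] sum_distrib_right[symmetric])
  then show ?thesis
    unfolding hinges sum_distrib_left by (subst sum.swap)
qed

end

section \<open>The Euler characteristic of a closed 3-manifold\<close>

text \<open>Gaussian elimination by cross-multiplication instead of division: the solution stays
  integral, as the hypothesis \<open>exact\<close> on integer cochains demands.\<close>

lemma homogeneous_system_int:
  fixes M :: "'a \<Rightarrow> 'b \<Rightarrow> int"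
  assumes "finite B" "finite A" "card B < card A"
  shows "\<exists>y. (\<exists>a\<in>A. y a \<noteq> 0) \<and> (\<forall>b\<in>B. (\<Sum>a\<in>A. y a * M a b) = 0)"
  using assms
proof (induction B arbitrary: A M rule: finite_induct)
  case empty
  then have "A \<noteq> {}" by auto
  then show ?case by (intro exI[of _ "\<lambda>_. 1"]) auto
next
  case (insert b B)
  show ?case
  proof (cases "\<forall>a\<in>A. M a b = 0")
    case True
    then show ?thesis
      using insert.IH[of A M] insert.prems insert.hyps by auto
  next
    case False
    then obtain a1 where a1: "a1 \<in> A" "M a1 b \<noteq> 0" by auto
    define A' where "A' = A - {a1}"
    have A': "finite A'" "card B < card A'" "a1 \<notin> A'" "A = insert a1 A'"
      using insert.prems insert.hyps a1 by (auto simp: A'_def)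
    obtain y' where y': "\<exists>a\<in>A'. y' a \<noteq> 0" "\<forall>e\<in>B. (\<Sum>a\<in>A'. y' a * (M a1 b * M a e - M a b * M a1 e)) = 0"
      using insert.IH[OF A'(1,2), of "\<lambda>a e. M a1 b * M a e - M a b * M a1 e"] by blast
    define y where "y a = (if a = a1 then - (\<Sum>a\<in>A'. y' a * M a b) else M a1 b * y' a)" for a
    have y: "(\<Sum>a\<in>A. y a * M a e) = (\<Sum>a\<in>A'. y' a * (M a1 b * M a e - M a b * M a1 e))" for e
    proof -
      have "(\<Sum>a\<in>A'. y a * M a e) = (\<Sum>a\<in>A'. M a1 b * y' a * M a e)"
        using A'(3) by (intro sum.cong) (auto simp: y_def)
      then have "(\<Sum>a\<in>A. y a * M a e) = - (\<Sum>a\<in>A'. y' a * M a b) * M a1 e + (\<Sum>a\<in>A'. M a1 b * y' a * M a e)"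
        using A' by (simp add: y_def)
      then show ?thesis
        by (simp add: algebra_simps sum_subtractf sum_distrib_left)
    qed
    have "(\<Sum>a\<in>A. y a * M a e) = 0" if "e \<in> insert b B" for e
      using that y' unfolding y by (auto simp: mult.commute)
    moreover have "\<exists>a\<in>A. y a \<noteq> 0"
      using y'(1) a1 A' by (auto simp: y_def)
    ultimately show ?thesis by blast
  qed
qed

text \<open>Assumptions \<open>conn\<close> and \<open>exact\<close> say that \<open>H\<^sup>0 = \<int>\<close> and \<open>H\<^sup>1 = 0\<close> for the link of \<open>v\<close>.\<close>

locale vertex_link = oriented_complex +
  fixes v :: 'a
  assumes vertex: "{v} \<in> Sg"
    and conn: "\<And>P u w. (\<And>u w. tri v u w \<Longrightarrow> P u \<longleftrightarrow> P w) \<Longrightarrow> edg v u \<Longrightarrow> edg v w \<Longrightarrow> P u \<longleftrightarrow> P w"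
    and exact: "\<And>c :: 'a \<Rightarrow> 'a \<Rightarrow> int. (\<And>u w. tri v u w \<Longrightarrow> c w u = - c u w) \<Longrightarrow>
       (\<And>x y z. tet v x y z \<Longrightarrow> c x y + c y z + c z x = 0) \<Longrightarrow>
       \<exists>b. \<forall>u w. tri v u w \<longrightarrow> c u w = b w - b u"
begin

section \<open>Integer cochains on a vertex link\<close>

definition LV where "LV = {u. edg v u}"
definition LE where "LE = {(u, w). tri v u w \<and> num u > num w}"
definition LF where "LF = {(x, y, z). tet v x y z \<and> num x > num y \<and> num y > num z}"

lemma finite_link: "finite LV" "finite LE" "finite LF"
proof -
  have V: "finite (\<Union>Sg)" using finite_complex finite_simplex by blast
  have "LV \<subseteq> \<Union>Sg" "LE \<subseteq> \<Union>Sg \<times> \<Union>Sg" "LF \<subseteq> \<Union>Sg \<times> \<Union>Sg \<times> \<Union>Sg"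
    by (auto simp: LV_def LE_def LF_def tet_def tri_def edg_def)
  then show "finite LV" "finite LE" "finite LF"
    by (meson V finite_SigmaI finite_subset)+
qed

lemma tri_LE: "tri v u w \<Longrightarrow> (u, w) \<in> LE \<or> (w, u) \<in> LE"
  using num_less_or[OF tri_perm(1)] tri_perm(3) by (auto simp: LE_def)

lemma tri_LV: "tri v u w \<Longrightarrow> u \<in> LV \<and> w \<in> LV"
  using tri_edg[of v u w] tri_edg[OF tri_perm(3), of v u w] by (simp add: LV_def)

lemma LE_LV: "(u, w) \<in> LE \<Longrightarrow> u \<in> LV \<and> w \<in> LV"
  using tri_LV by (auto simp: LE_def)

lemma tet_sorted:
  assumes "tet v x y z"
  shows "\<exists>x' y' z'. (x', y', z') \<in> LF \<and> {x', y', z'} = {x, y, z}"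
proof -
  have "card {x, y, z} = 3" "{v, x, y, z} \<in> Sg" "v \<notin> {x, y, z}"
    using assms card3[of x y z] by (auto simp: tet_def)
  then obtain x' y' z' where s: "{x, y, z} = {x', y', z'}" "num x' > num y'" "num y' > num z'"
    using sorted3[of "{v, x, y, z}" "{x, y, z}"] by auto
  have "distinct [x', y', z']" using s card3 \<open>card {x, y, z} = 3\<close> by metis
  moreover have "v \<notin> {x', y', z'}" using s \<open>v \<notin> {x, y, z}\<close> by simp
  moreover have "{v, x', y', z'} \<in> Sg" using s \<open>{v, x, y, z} \<in> Sg\<close> by (metis (no_types))
  ultimately have "(x', y', z') \<in> LF" using s(2,3) by (simp add: LF_def tet_def)
  then show ?thesis using s(1) by metis
qed

lemma ex_tet: "\<exists>x y z. tet v x y z"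
proof -
  obtain B where B: "B \<in> Sg" "v \<in> B" "card B = 4" using pure[OF vertex] by auto
  have "finite B" using finite_simplex B by blast
  then have "card (B - {v}) = 3" using B by simp
  then obtain x y z where xyz: "B - {v} = {x, y, z}" "x \<noteq> y \<and> y \<noteq> z \<and> x \<noteq> z"
    unfolding card_3_iff by blast
  moreover have "insert v (B - {v}) = B" using B(2) by blast
  ultimately have "{v, x, y, z} = B" "v \<notin> {x, y, z}" by auto
  then have "tet v x y z" using B(1) xyz(2) by (simp add: tet_def)
  then show ?thesis by blast
qed

text \<open>A telescoping sum along an edge path from \<open>u0\<close> to u. No path is built:
  \<open>conn\<close> is applied to the property of being reachable in this sense.\<close>

lemma path_functional:
  assumes "u0 \<in> LV" "u \<in> LV"
  shows "\<exists>k. \<forall>b. (\<Sum>e\<in>LE. k e * (b (snd e) - b (fst e))) = b u - (b u0 :: int)"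
proof -
  define P where "P u \<longleftrightarrow> (\<exists>k. \<forall>b. (\<Sum>e\<in>LE. k e * (b (snd e) - b (fst e))) = b u - (b u0 :: int))" for u
  have step: "P w" if Pu: "P u" and uw: "tri v u w" for u w
  proof -
    obtain k where k: "\<And>b. (\<Sum>e\<in>LE. k e * (b (snd e) - b (fst e))) = b u - (b u0 :: int)"
      using Pu unfolding P_def by blast
    have delta: "(\<Sum>e\<in>LE. of_bool (e = e0) * (b (snd e) - b (fst e))) = b (snd e0) - (b (fst e0) :: int)"
      if "e0 \<in> LE" for e0 b
      using that finite_link by (subst sum.remove[of _ e0]) auto
    consider "(u, w) \<in> LE" | "(w, u) \<in> LE" using tri_LE uw by blast
    then show ?thesis
    proof cases
      case 1
      then have "(\<Sum>e\<in>LE. (k e + of_bool (e = (u, w))) * (b (snd e) - b (fst e))) = b w - (b u0 :: int)" for b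
        using k[of b] delta[OF 1, of b] by (simp only: distrib_right sum.distrib) simp
      then show ?thesis unfolding P_def by (intro exI[of _ "\<lambda>e. k e + of_bool (e = (u, w))"]) blast
    next
      case 2
      then have "(\<Sum>e\<in>LE. (k e - of_bool (e = (w, u))) * (b (snd e) - b (fst e))) = b w - (b u0 :: int)" for b
        using k[of b] delta[OF 2, of b] by (simp only: left_diff_distrib sum_subtractf) simp
      then show ?thesis unfolding P_def by (intro exI[of _ "\<lambda>e. k e - of_bool (e = (w, u))"]) blast
    qed
  qed
  have "P u0" unfolding P_def by (rule exI[of _ "\<lambda>_. 0"]) simp
  moreover have "P u0 \<longleftrightarrow> P u"
  proof (rule conn[of P])
    show "P u \<longleftrightarrow> P w" if "tri v u w" for u w
      using step[OF _ that] step[OF _ tri_perm(3)[OF that]] by blast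
  qed (use assms in \<open>simp_all add: LV_def\<close>)
  ultimately show ?thesis by (simp add: P_def)
qed

lemma tet_link_perm: "tet v x y z \<Longrightarrow> tet v y z x" "tet v x y z \<Longrightarrow> tet v z x y" "tet v x y z \<Longrightarrow> tet v y x z"
  using tet_perm by blast+

text \<open>Every directed link edge starts exactly one positively oriented triangle, so the
  boundary terms run over all directed edges, where antisymmetry cancels them in pairs.\<close>

lemma sum_boundary:
  fixes c :: "'a \<Rightarrow> 'a \<Rightarrow> int"
  assumes "\<And>u w. tri v u w \<Longrightarrow> c w u = - c u w"
  shows "(\<Sum>(x, y, z)\<in>{(x, y, z). tet v x y z \<and> pos v x y z}. c x y + c y z + c z x) = 0"
proof -
  define O' where "O' = {(x, y, z). tet v x y z \<and> pos v x y z}"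
  define E' where "E' = {(x, y). tri v x y}"
  have rot: "(\<Sum>(x, y, z)\<in>O'. c y z) = (\<Sum>(x, y, z)\<in>O'. c x y)"
    by (rule sum.reindex_bij_witness[of _ "\<lambda>(x, y, z). (z, x, y)" "\<lambda>(x, y, z). (y, z, x)"])
      (auto simp: O'_def pos_perm dest: tet_link_perm)
  have rot': "(\<Sum>(x, y, z)\<in>O'. c z x) = (\<Sum>(x, y, z)\<in>O'. c x y)"
    by (rule sum.reindex_bij_witness[of _ "\<lambda>(x, y, z). (y, z, x)" "\<lambda>(x, y, z). (z, x, y)"])
      (auto simp: O'_def pos_perm dest: tet_link_perm)
  have "bij_betw (\<lambda>(x, y, z). (x, y)) O' E'"
  proof (rule bij_betw_imageI)
    show "inj_on (\<lambda>(x, y, z). (x, y)) O'"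
      using pos_unique by (auto simp: inj_on_def O'_def)
    show "(\<lambda>(x, y, z). (x, y)) ` O' = E'"
      using ex_pos tet_tri by (force simp: O'_def E'_def)
  qed
  then have "(\<Sum>(x, y, z)\<in>O'. c x y) = (\<Sum>(x, y)\<in>E'. c x y)"
    using sum.reindex_bij_betw[of "\<lambda>(x, y, z). (x, y)" O' E' "\<lambda>(x, y). c x y"] by (simp add: split_def)
  moreover have "(\<Sum>(x, y)\<in>E'. c x y) = (\<Sum>(x, y)\<in>E'. c y x)"
    by (rule sum.reindex_bij_witness[of _ "\<lambda>(x, y). (y, x)" "\<lambda>(x, y). (y, x)"]) (auto simp: E'_def dest: tri_perm)
  moreover have "(\<Sum>(x, y)\<in>E'. c y x) = (\<Sum>(x, y)\<in>E'. - c x y)"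
    using assms by (intro sum.cong) (auto simp: E'_def)
  ultimately have "(\<Sum>(x, y, z)\<in>O'. c x y) = 0"
    by (simp add: split_def sum_negf)
  then show ?thesis
    unfolding O'_def[symmetric] using rot rot' by (simp add: split_def sum.distrib)
qed

text \<open>The coboundary of a 1-cochain, evaluated on an ordered triangle.\<close>

definition bd :: "('a \<Rightarrow> 'a \<Rightarrow> int) \<Rightarrow> 'a \<times> 'a \<times> 'a \<Rightarrow> int"
  where "bd c = (\<lambda>(x, y, z). c x y + c y z + c z x)"

lemma bd_perm:
  assumes anti: "\<And>u w. tri v u w \<Longrightarrow> c w u = - c u w" and t: "tet v x y z"
  shows "bd c (x, z, y) = - bd c (x, y, z)" "bd c (y, x, z) = - bd c (x, y, z)" "bd c (y, z, x) = bd c (x, y, z)"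
    "bd c (z, x, y) = bd c (x, y, z)" "bd c (z, y, x) = - bd c (x, y, z)"
proof -
  have "c y x = - c x y" "c z y = - c y z" "c x z = - c z x"
    using tri_of_tet[OF t] by (auto intro!: anti dest: tri_perm)
  then show "bd c (x, z, y) = - bd c (x, y, z)" "bd c (y, x, z) = - bd c (x, y, z)" "bd c (y, z, x) = bd c (x, y, z)"
    "bd c (z, x, y) = bd c (x, y, z)" "bd c (z, y, x) = - bd c (x, y, z)"
    by (simp_all add: bd_def)
qed

lemma perm3: "{x, y, z} = {x', y', z'} \<Longrightarrow> distinct [x, y, z] \<Longrightarrow>
    (x, y, z) \<in> {(x', y', z'), (x', z', y'), (y', x', z'), (y', z', x'), (z', x', y'), (z', y', x')}"
proof -
  assume s: "{x, y, z} = {x', y', z'}" and d: "distinct [x, y, z]"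
  have "x = x' \<or> x = y' \<or> x = z'" "y = x' \<or> y = y' \<or> y = z'" "z = x' \<or> z = y' \<or> z = z'"
    using s by blast+
  then show ?thesis using d by auto
qed

text \<open>On a closed oriented surface a coboundary has total zero. If it vanishes on all
  triangles except \<open>t0\<close>, it must vanish there too.\<close>

lemma bd_eq_zero:
  assumes anti: "\<And>u w. tri v u w \<Longrightarrow> c w u = - c u w"
    and t0: "t0 \<in> LF" and zero: "\<And>t. t \<in> LF - {t0} \<Longrightarrow> bd c t = 0" and t: "tet v x y z"
  shows "bd c (x, y, z) = 0"
proof -
  obtain x0 y0 z0 where xyz0: "t0 = (x0, y0, z0)" by (cases t0)
  have tt0: "tet v x0 y0 z0" using t0 xyz0 by (simp add: LF_def)
  have same: "bd c (x, y, z) = (if pos v x y z = pos v x' y' z' then bd c (x', y', z') else - bd c (x', y', z'))"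
    if "tet v x y z" "tet v x' y' z'" "{x, y, z} = {x', y', z'}" for x y z x' y' z'
  proof -
    have "(x, y, z) \<in> {(x', y', z'), (x', z', y'), (y', x', z'), (y', z', x'), (z', x', y'), (z', y', x')}"
      using perm3[OF that(3)] that(1) by (simp add: tet_def)
    then show ?thesis
      using bd_perm[OF anti that(2)] pos_perm[OF that(2)] by (elim insertE emptyE) simp_all
  qed
  define O' where "O' = {(x, y, z). tet v x y z \<and> pos v x y z}"
  define d0 where "d0 = (if pos v x0 y0 z0 then bd c (x0, y0, z0) else - bd c (x0, y0, z0))"
  \<comment> \<open>The positively oriented orderings of the triangle \<open>t0\<close>; on all of
    them the coboundary has the same value \<open>d0\<close>.\<close>
  define Z where "Z = {(x, y, z)\<in>O'. {x, y, z} = {x0, y0, z0}}"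
  have finO: "finite O'"
  proof -
    have "finite (\<Union>Sg)" using finite_complex finite_simplex by blast
    moreover have "O' \<subseteq> \<Union>Sg \<times> \<Union>Sg \<times> \<Union>Sg" by (auto simp: O'_def tet_def)
    ultimately show ?thesis by (meson finite_SigmaI finite_subset)
  qed
  have other: "bd c (x, y, z) = 0" if tt: "tet v x y z" and ne: "{x, y, z} \<noteq> {x0, y0, z0}" for x y z
  proof -
    obtain x' y' z' where s: "(x', y', z') \<in> LF" "{x', y', z'} = {x, y, z}" using tet_sorted[OF tt] by blast
    then have "bd c (x', y', z') = 0" using zero ne xyz0 by (metis Diff_iff Pair_inject singletonD)
    then show ?thesis using same[OF tt, of x' y' z'] s by (simp add: LF_def)
  qed
  have "0 = (\<Sum>t\<in>O'. bd c t)"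
    using sum_boundary[OF anti] by (simp add: O'_def bd_def)
  also have "\<dots> = (\<Sum>t\<in>Z. bd c t)"
    using finO other by (intro sum.mono_neutral_right) (auto simp: Z_def O'_def)
  also have "\<dots> = (\<Sum>t\<in>Z. d0)"
  proof (rule sum.cong[OF refl])
    fix t assume "t \<in> Z"
    then obtain x y z where "t = (x, y, z)" "tet v x y z" "pos v x y z" "{x, y, z} = {x0, y0, z0}"
      by (auto simp: Z_def O'_def)
    then show "bd c t = d0" using same[OF _ tt0, of x y z] by (simp add: d0_def)
  qed
  finally have "int (card Z) * d0 = 0" by simp
  moreover have "Z \<noteq> {}"
  proof (cases "pos v x0 y0 z0")
    case True
    then have "(x0, y0, z0) \<in> Z" using tt0 by (simp add: Z_def O'_def)
    then show ?thesis by blast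
  next
    case False
    then have "(y0, x0, z0) \<in> Z" using tt0 tet_perm[OF tt0] pos_perm[OF tt0] by (auto simp: Z_def O'_def)
    then show ?thesis by blast
  qed
  moreover have "finite Z" using finO by (rule finite_subset[rotated]) (auto simp: Z_def)
  ultimately have "d0 = 0" by simp
  then have "bd c (x0, y0, z0) = 0" by (simp add: d0_def split: if_splits)
  then show ?thesis
    using other[OF t] same[OF t tt0] by (cases "{x, y, z} = {x0, y0, z0}") (auto split: if_splits)
qed

text \<open>An edge cochain is subjected to one coboundary condition for each triangle but
  \<open>t0\<close> and to one path functional for each vertex but \<open>u0\<close>. The former
  make it exact, the latter make its potential constant, so it is zero. Hence there are no more
  edges than conditions.\<close>

lemma link_euler_ge: "card LE + 2 \<le> card LV + card LF"
proof (rule ccontr)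
  assume less: "\<not> card LE + 2 \<le> card LV + card LF"
  obtain x y z where t: "tet v x y z" using ex_tet by blast
  then obtain t0 where t0: "t0 \<in> LF" using tet_sorted by blast
  obtain u0 where u0: "u0 \<in> LV" using tri_LV[OF tet_tri[OF t]] by blast
  have "\<forall>u\<in>LV. \<exists>k. \<forall>b. (\<Sum>e\<in>LE. k e * (b (snd e) - b (fst e))) = b u - (b u0 :: int)"
    using path_functional[OF u0] by blast
  then obtain k where k: "\<And>u b. u \<in> LV \<Longrightarrow> (\<Sum>e\<in>LE. k u e * (b (snd e) - b (fst e))) = b u - (b u0 :: int)"
    by metis
  define B where "B = (LV - {u0}) <+> (LF - {t0})"
  define M where "M e s = (case s of Inl u \<Rightarrow> k u e
    | Inr (x, y, z) \<Rightarrow> of_bool (e = (x, y)) + of_bool (e = (y, z)) - of_bool (e = (x, z)))" for e s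
  have "card B = (card LV - 1) + (card LF - 1)"
    using finite_link u0 t0 by (simp add: B_def card_Plus)
  moreover have "card LV > 0" "card LF > 0" using finite_link u0 t0 by (auto simp: card_gt_0_iff)
  ultimately have "card B < card LE" using less by linarith
  then obtain y where y: "\<exists>e\<in>LE. y e \<noteq> 0" "\<forall>s\<in>B. (\<Sum>e\<in>LE. y e * M e s) = 0"
    using homogeneous_system_int[of B LE M] finite_link by (auto simp: B_def)
  define c where "c u w = (if num u > num w then y (u, w) else - y (w, u))" for u w
  have anti: "c w u = - c u w" if "tri v u w" for u w
    using num_less_or[OF tri_perm(1)[OF that]] by (auto simp: c_def)
  have zero: "bd c t = 0" if t: "t \<in> LF - {t0}" for t
  proof -
    obtain p q r where pqr: "t = (p, q, r)" by (cases t)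
    have n: "tet v p q r" "num p > num q" "num q > num r" using t pqr by (auto simp: LF_def)
    have mem: "(p, q) \<in> LE" "(q, r) \<in> LE" "(p, r) \<in> LE"
      using n tri_of_tet[OF n(1)] by (auto simp: LE_def)
    have delta: "(\<Sum>e\<in>LE. y e * of_bool (e = e0)) = y e0" if "e0 \<in> LE" for e0
      using that finite_link by (subst sum.remove[of _ e0]) auto
    have "(\<Sum>e\<in>LE. y e * M e (Inr t)) = y (p, q) + y (q, r) - y (p, r)"
      using delta[OF mem(1)] delta[OF mem(2)] delta[OF mem(3)]
      by (simp add: M_def pqr distrib_left right_diff_distrib sum.distrib sum_subtractf)
    then have "y (p, q) + y (q, r) - y (p, r) = 0"
      using bspec[OF y(2), of "Inr t"] t InrI[of t "LF - {t0}" "LV - {u0}"] unfolding B_def by simp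
    then show ?thesis using n by (simp add: pqr bd_def c_def)
  qed
  obtain b where b: "\<And>u w. tri v u w \<Longrightarrow> c u w = b w - b u"
    using exact[of c] anti bd_eq_zero[OF anti t0 zero] by (auto simp: bd_def)
  have yb: "y e = b (snd e) - b (fst e)" if "e \<in> LE" for e
    using that b[of "fst e" "snd e"] by (auto simp: LE_def c_def)
  have "b u = b u0" if "u \<in> LV" for u
  proof (cases "u = u0")
    case False
    then have "Inl u \<in> B" using that unfolding B_def by (intro InlI) simp
    then have "(\<Sum>e\<in>LE. y e * k u e) = 0" using y(2) by (fastforce simp: M_def)
    then have "(\<Sum>e\<in>LE. k u e * (b (snd e) - b (fst e))) = 0" using yb by (simp add: mult.commute)
    then show ?thesis using k[OF that, of b] by simp
  qed simp
  then have "y e = 0" if "e \<in> LE" for e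
    using yb[OF that] LE_LV[of "fst e" "snd e"] that by simp
  then show False using y(1) by blast
qed

definition single :: "'a \<Rightarrow> 'a \<Rightarrow> 'a \<Rightarrow> 'a \<Rightarrow> int"
  where "single u w x y = of_bool (x = u \<and> y = w) - of_bool (x = w \<and> y = u)"

lemma bd_single:
  assumes "tet v u w z" "tet v x y r"
  shows "bd (single u w) (x, y, r) = 0 \<longleftrightarrow> \<not> {u, w} \<subseteq> {x, y, r}"
    "bd (single u w) (x, y, r) \<in> {-1, 0, 1}"
  using assms by (auto simp: bd_def single_def tet_def)

lemma two_tets:
  assumes t1: "tet v u w x" and t2: "tet v u w y" and ne: "x \<noteq> y" and t: "tet v u w z"
  shows "z = x \<or> z = y"
  using pos_unique[OF t t1] pos_unique[OF t t2] pos_unique[OF t1 t2] ne by blast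

text \<open>
  On the oriented link surface all triangles are cohomologous up to sign; hence modulo coboundaries
  every 2-cochain is concentrated on the single triangle \<open>t0\<close>.
\<close>

definition bounds :: "'a \<times> 'a \<times> 'a \<Rightarrow> 'a set \<Rightarrow> bool"
  where "bounds t0 X \<longleftrightarrow> (\<exists>c. (\<forall>u w. c w u = - c u w) \<and>
    (\<forall>x y z. (x, y, z) \<in> LF - {t0} \<longrightarrow> bd c (x, y, z) = of_bool ({x, y, z} = X)))"

lemma LF_unique:
  assumes "(x, y, z) \<in> LF" "(x', y', z') \<in> LF" "{x, y, z} = {x', y', z'}"
  shows "(x, y, z) = (x', y', z')"
proof -
  have "(x, y, z) \<in> {(x', y', z'), (x', z', y'), (y', x', z'), (y', z', x'), (z', x', y'), (z', y', x')}"
    using perm3[OF assms(3)] assms(1) by (simp add: LF_def tet_def)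
  then show ?thesis using assms(1,2) by (auto simp: LF_def)
qed

text \<open>The cochain dual to the edge uw has its coboundary on the two triangles at that edge
  only, with values of absolute value 1, so it exchanges their indicators modulo
  coboundaries.\<close>

lemma bounds_adjacent:
  assumes t1: "tet v u w x" and t2: "tet v u w y" and ne: "x \<noteq> y" and b: "bounds t0 {u, w, x}"
  shows "bounds t0 {u, w, y}"
proof -
  obtain c where anti: "\<And>u w. c w u = - c u w"
    and c: "\<And>p q r. (p, q, r) \<in> LF - {t0} \<Longrightarrow> bd c (p, q, r) = of_bool ({p, q, r} = {u, w, x})"
    using b unfolding bounds_def by blast
  have uw: "u \<noteq> w" "w \<noteq> x" "u \<noteq> x" "w \<noteq> y" "u \<noteq> y" using t1 t2 by (auto simp: tet_def)
  obtain x1 x2 x3 where X: "(x1, x2, x3) \<in> LF" "{x1, x2, x3} = {u, w, x}" using tet_sorted[OF t1] by blast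
  obtain y1 y2 y3 where Y: "(y1, y2, y3) \<in> LF" "{y1, y2, y3} = {u, w, y}" using tet_sorted[OF t2] by blast
  define s1 where "s1 = bd (single u w) (x1, x2, x3)"
  define s2 where "s2 = bd (single u w) (y1, y2, y3)"
  have ty: "tet v y1 y2 y3" using Y(1) by (simp add: LF_def)
  have "{u, w} \<subseteq> {y1, y2, y3}" unfolding Y(2) by blast
  then have "s2 \<in> {-1, 1}" using bd_single[OF t2 ty] by (auto simp: s2_def)
  then have s2: "s2 * s2 = 1" by auto
  \<comment> \<open>At {u, w, x} the coboundary is s2 (s1 - s1) = 0, at {u, w, y} it is s2 s2 = 1.
    The sign \<open>s2\<close> serves as its own inverse.\<close>
  define c' where "c' p q = s2 * (single u w p q - s1 * c p q)" for p q
  have single_anti: "single u w q p = - single u w p q" for p q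
    unfolding single_def minus_diff_eq by (subst (1 2) conj_commute) (rule refl)
  have c'_anti: "c' q p = - c' p q" for p q
  proof -
    have "c' q p = s2 * (- single u w p q - s1 * - c p q)"
      unfolding c'_def by (subst single_anti, subst anti) (rule refl)
    then show ?thesis
      unfolding c'_def by (simp only: right_diff_distrib mult_minus_right)
  qed
  have c'_bd: "bd c' (p, q, r) = of_bool ({p, q, r} = {u, w, y})" if pqr: "(p, q, r) \<in> LF - {t0}" for p q r
  proof -
    have bd: "bd c' (p, q, r) = s2 * (bd (single u w) (p, q, r) - s1 * bd c (p, q, r))"
      by (simp add: bd_def c'_def algebra_simps)
    have tp: "tet v p q r" using pqr by (simp add: LF_def)
    have ne': "{u, w, x} \<noteq> {u, w, y}"
    proof
      assume "{u, w, x} = {u, w, y}"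
      then have "x \<in> {u, w, y}" by blast
      then show False using ne uw by simp
    qed
    show ?thesis
    proof (cases "{u, w} \<subseteq> {p, q, r}")
      case False
      then have "bd (single u w) (p, q, r) = 0" using bd_single(1)[OF t1 tp] by simp
      moreover have "{p, q, r} \<noteq> {u, w, x}" "{p, q, r} \<noteq> {u, w, y}" using False by blast+
      ultimately show ?thesis using c[OF pqr] bd by simp
    next
      case True
      obtain z where z: "{p, q, r} = {u, w, z}" "z \<noteq> u" "z \<noteq> w"
      proof -
        have "distinct [p, q, r]" using tp by (simp add: tet_def)
        then have "card ({p, q, r} - {u, w}) = 1" using True uw card3[of p q r] by (subst card_Diff_subset) auto
        then obtain z where "{p, q, r} - {u, w} = {z}" by (rule card_1_singletonE)
        then show ?thesis using True that[of z] by blast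
      qed
      have "tet v u w z" using tp z uw by (simp add: tet_def)
      then consider "z = x" | "z = y" using two_tets[OF t1 t2 ne] by blast
      then show ?thesis
      proof cases
        case 1
        then have "(p, q, r) = (x1, x2, x3)" using LF_unique[of p q r x1 x2 x3] pqr X z by simp
        then show ?thesis using c[OF pqr] z 1 ne' bd by (simp add: s1_def)
      next
        case 2
        then have "(p, q, r) = (y1, y2, y3)" using LF_unique[of p q r y1 y2 y3] pqr Y z by simp
        then show ?thesis using c[OF pqr] z 2 ne' bd s2 by (simp add: s2_def)
      qed
    qed
  qed
  show ?thesis unfolding bounds_def using c'_anti c'_bd by (intro exI[of _ c']) blast
qed

lemma bounds_iff_adjacent:
  assumes "tet v u w x" "tet v u w y"
  shows "bounds t0 {u, w, x} \<longleftrightarrow> bounds t0 {u, w, y}"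
  using bounds_adjacent[OF assms, of t0] bounds_adjacent[OF assms(2,1), of t0] by blast

text \<open>The consecutive entries of \<open>lnk v u\<close> enumerate the link triangles around u,
  each sharing an edge with the next.\<close>

lemma bounds_around:
  assumes t: "tet v u x y" and t': "tet v u x' y'"
  shows "bounds t0 {u, x, y} \<longleftrightarrow> bounds t0 {u, x', y'}"
proof -
  let ?l = "lnk v u"
  let ?n = "length ?l"
  have e: "edg v u" using tri_edg[OF tet_tri[OF t]] .
  define T where "T i = {u, ?l ! i, ?l ! ((i + 1) mod ?n)}" for i
  have step: "bounds t0 (T i) \<longleftrightarrow> bounds t0 (T (i + 1))" if "i + 1 < ?n" for i
  proof -
    have 1: "tet v u (?l ! i) (?l ! (i + 1))" using link_tet[OF e, of i] that by simp
    have 2: "tet v u (?l ! (i + 1)) (?l ! ((i + 2) mod ?n))" using link_tet[OF e, of "i + 1"] that by simp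
    show ?thesis
      using bounds_iff_adjacent[OF tet_sym(3)[OF 1] 2] that by (simp add: T_def insert_commute)
  qed
  have T0: "bounds t0 (T i) \<longleftrightarrow> bounds t0 (T 0)" if "i < ?n" for i
    using that by (induction i) (use step in auto)
  have *: "bounds t0 {u, x, y} \<longleftrightarrow> bounds t0 (T 0)" if t: "tet v u x y" "pos v u x y" for x y
  proof -
    have "x \<in> set ?l" using set_link[OF e] tet_tri[OF t(1)] by simp
    then obtain i where i: "i < ?n" "x = ?l ! i" by (auto simp: in_set_conv_nth)
    have "y = ?l ! ((i + 1) mod ?n)"
      using link_tet[OF e i(1)] pos_unique[OF t(1)] t(2) i(2) by blast
    then show ?thesis using T0[OF i(1)] i(2) by (simp add: T_def)
  qed
  have **: "bounds t0 {u, x, y} \<longleftrightarrow> bounds t0 (T 0)" if t: "tet v u x y" for x y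
    using *[OF t] *[OF tet_sym(3)[OF t]] pos_swap3[OF t] by (cases "pos v u x y") (auto simp: insert_commute)
  show ?thesis using **[OF t] **[OF t'] by simp
qed

text \<open>Connectedness is available for vertices only, so the property is spread over stars: it
  holds for one triangle at u iff for all of them, and adjacent vertices have a common
  triangle.\<close>

lemma bounds_all:
  assumes t0: "(x0, y0, z0) \<in> LF" and t: "tet v x y z"
  shows "bounds (x0, y0, z0) {x, y, z}"
proof -
  define P where "P u \<longleftrightarrow> (\<exists>x y. tet v u x y \<and> bounds (x0, y0, z0) {u, x, y})" for u
  have tt0: "tet v x0 y0 z0" using t0 by (simp add: LF_def)
  have "P u \<longleftrightarrow> P w" if uw: "tri v u w" for u w
  proof -
    obtain s where s: "tet v u w s" using ex_pos[OF uw] by blast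
    have s': "tet v w u s" using s by (rule tet_link_perm)
    have "P u \<longleftrightarrow> bounds (x0, y0, z0) {u, w, s}" unfolding P_def using s bounds_around[OF s] by blast
    moreover have "P w \<longleftrightarrow> bounds (x0, y0, z0) {w, u, s}" unfolding P_def using s' bounds_around[OF s'] by blast
    ultimately show ?thesis by (simp add: insert_commute)
  qed
  moreover have "bounds (x0, y0, z0) {x0, y0, z0}"
    unfolding bounds_def
  proof (intro exI[of _ "\<lambda>_ _. 0"] conjI allI impI)
    fix p q r assume pqr: "(p, q, r) \<in> LF - {(x0, y0, z0)}"
    then have "{p, q, r} \<noteq> {x0, y0, z0}" using LF_unique[OF _ t0] by blast
    then show "bd (\<lambda>_ _. 0) (p, q, r) = of_bool ({p, q, r} = {x0, y0, z0})" by (simp add: bd_def)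
  qed simp
  then have "P x0" using tt0 unfolding P_def by blast
  ultimately have "P x"
    using conn[of P x0 x] tri_edg[OF tet_tri[OF tt0]] tri_edg[OF tet_tri[OF t]] by blast
  then obtain x' y' where "tet v x x' y'" "bounds (x0, y0, z0) {x, x', y'}" unfolding P_def by blast
  then show ?thesis using bounds_around[OF t] by blast
qed

text \<open>The cochains \<open>c t\<close> for t other than \<open>t0\<close> and the coboundaries
  of the vertices other than \<open>u0\<close> are linearly independent in the edge cochains, so
  there are at most as many of them as edges.\<close>

lemma link_euler_le: "card LV + card LF \<le> card LE + 2"
proof (rule ccontr)
  assume less: "\<not> card LV + card LF \<le> card LE + 2"
  obtain x y z where t: "tet v x y z" using ex_tet by blast
  then obtain x0 y0 z0 where t0: "(x0, y0, z0) \<in> LF" using tet_sorted by blast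
  obtain u0 where u0: "u0 \<in> LV" using tri_LV[OF tet_tri[OF t]] by blast
  have "\<forall>t\<in>LF. \<exists>c. (\<forall>u w. c w u = - c u w) \<and>
    (\<forall>x y z. (x, y, z) \<in> LF - {(x0, y0, z0)} \<longrightarrow> bd c (x, y, z) = of_bool ((x, y, z) = t))"
  proof
    fix t assume t: "t \<in> LF"
    obtain p q r where pqr: "t = (p, q, r)" by (cases t)
    have tt: "tet v p q r" using t pqr by (simp add: LF_def)
    have eq: "{x, y, z} = {p, q, r} \<longleftrightarrow> (x, y, z) = t" if "(x, y, z) \<in> LF" for x y z
      using LF_unique[OF that, of p q r] t pqr by auto
    show "\<exists>c. (\<forall>u w. c w u = - c u w) \<and>
        (\<forall>x y z. (x, y, z) \<in> LF - {(x0, y0, z0)} \<longrightarrow> bd c (x, y, z) = of_bool ((x, y, z) = t))"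
      using bounds_all[OF t0 tt] eq unfolding bounds_def by (simp cong: conj_cong)
  qed
  then obtain c where anti: "\<And>t u w. t \<in> LF \<Longrightarrow> c t w u = - c t u w"
    and c: "\<And>t t'. t \<in> LF \<Longrightarrow> t' \<in> LF - {(x0, y0, z0)} \<Longrightarrow> bd (c t) t' = of_bool (t' = t)"
    by (metis (no_types, lifting) prod_cases3)
  define F where "F = LF - {(x0, y0, z0)}"
  define B where "B = (LV - {u0}) <+> F"
  define M where "M s e = (case s of Inl z \<Rightarrow> of_bool (z = snd e) - of_bool (z = fst e)
    | Inr t \<Rightarrow> c t (fst e) (snd e))" for s e
  have "card B = (card LV - 1) + (card LF - 1)"
    using finite_link u0 t0 by (simp add: B_def F_def card_Plus)
  moreover have "card LV > 0" "card LF > 0" using finite_link u0 t0 by (auto simp: card_gt_0_iff)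
  ultimately have "card LE < card B" using less by linarith
  then obtain y where y: "\<exists>s\<in>B. y s \<noteq> 0" "\<forall>e\<in>LE. (\<Sum>s\<in>B. y s * M s e) = 0"
    using homogeneous_system_int[of LE B M] finite_link by (auto simp: B_def F_def)
  define b where "b u = (if u \<in> LV - {u0} then y (Inl u) else 0)" for u
  have eqn: "b w - b u + (\<Sum>t\<in>F. y (Inr t) * c t u w) = 0" if uw: "tri v u w" for u w
  proof -
    have LE: "b w - b u + (\<Sum>t\<in>F. y (Inr t) * c t u w) = 0" if uw: "(u, w) \<in> LE" for u w
    proof -
      have "(\<Sum>s\<in>B. y s * M s (u, w)) = (\<Sum>z\<in>LV - {u0}. y (Inl z) * (of_bool (z = w) - of_bool (z = u))) +
          (\<Sum>t\<in>F. y (Inr t) * c t u w)"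
        unfolding B_def using finite_link by (subst sum.Plus) (simp_all add: M_def F_def)
      moreover have "(\<Sum>z\<in>LV - {u0}. y (Inl z) * of_bool (z = w)) = b w" for w
        using finite_link by (simp add: b_def sum.delta of_bool_def if_distrib cong: if_cong)
      ultimately show ?thesis using bspec[OF y(2) uw] by (simp add: right_diff_distrib sum_subtractf)
    qed
    consider "(u, w) \<in> LE" | "(w, u) \<in> LE" using tri_LE[OF uw] by blast
    then show ?thesis
    proof cases
      case 2
      have "(\<Sum>t\<in>F. y (Inr t) * c t w u) = - (\<Sum>t\<in>F. y (Inr t) * c t u w)"
        unfolding sum_negf[symmetric] by (intro sum.cong refl) (simp add: anti[of _ u w] F_def)
      then show ?thesis using LE[OF 2] by simp
    qed (rule LE)
  qed
  \<comment> \<open>Taking the coboundary of the relation annihilates its vertex part and isolates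
    the coefficient of the triangle t'.\<close>
  have yF: "y (Inr t') = 0" if t': "t' \<in> F" for t'
  proof -
    obtain p q r where pqr: "t' = (p, q, r)" by (cases t')
    have tt: "tet v p q r" using t' pqr by (simp add: F_def LF_def)
    have "(\<Sum>t\<in>F. y (Inr t) * bd (c t) t') = (\<Sum>t\<in>F. y (Inr t) * c t p q) + (\<Sum>t\<in>F. y (Inr t) * c t q r) +
        (\<Sum>t\<in>F. y (Inr t) * c t r p)"
      by (simp add: bd_def pqr distrib_left sum.distrib)
    also have "\<dots> = 0"
      using eqn[of p q] eqn[of q r] eqn[of r p] tri_of_tet[OF tt] tri_perm by (smt (verit))
    finally have "(\<Sum>t\<in>F. y (Inr t) * bd (c t) t') = 0" .
    moreover have "(\<Sum>t\<in>F. y (Inr t) * bd (c t) t') = (\<Sum>t\<in>F. y (Inr t) * of_bool (t' = t))"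
      using t' by (intro sum.cong refl) (simp add: c F_def)
    ultimately have "(\<Sum>t\<in>F. y (Inr t) * of_bool (t' = t)) = 0" by simp
    then show ?thesis
      using finite_link t' by (simp add: F_def of_bool_def if_distrib cong: if_cong)
  qed
  have edge: "b u = b w" if "tri v u w" for u w
    using eqn[OF that] yF by simp
  have "b u = 0" if "u \<in> LV" for u
  proof -
    have "b u = 0 \<longleftrightarrow> b u0 = 0"
    proof (rule conn[of "\<lambda>u. b u = 0"])
      show "b u = 0 \<longleftrightarrow> b w = 0" if "tri v u w" for u w
        unfolding edge[OF that] ..
    qed (use that u0 in \<open>simp_all add: LV_def\<close>)
    then show ?thesis by (simp add: b_def)
  qed
  then have "y (Inl u) = 0" if "u \<in> LV - {u0}" for u
    using that unfolding b_def by (metis DiffD1)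
  then have "y s = 0" if "s \<in> B" for s
    using that yF unfolding B_def by (elim PlusE) simp_all
  then show False using y(1) by blast
qed

lemma link_euler: "card LV + card LF = card LE + 2"
  using link_euler_ge link_euler_le by simp

end

section \<open>The Euler relation from the links of all vertices\<close>

context oriented_complex
begin

text \<open>Summed over all vertices, \<open>link_euler\<close> reads 2 N1 + 2 N2 = 3 N2 + 2 N0, and
  each tetrahedron has four faces shared by two, so N2 = 2 N3.\<close>

lemma euler_characteristic:
  assumes "\<And>v. {v} \<in> Sg \<Longrightarrow> vertex_link Sg num pos lnk v"
  shows "card {v. {v} \<in> Sg} + card T3 = card T2 + card T4"
proof -
  define V0 where "V0 = {v. {v} \<in> Sg}"
  define lv where "lv v = {u. edg v u}" for v
  define le where "le v = {(u, w). tri v u w \<and> num u > num w}" for v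
  define lf where "lf v = {(x, y, z). tet v x y z \<and> num x > num y \<and> num y > num z}" for v
  have finU: "finite (\<Union>Sg)" using finite_complex finite_simplex by blast
  have "V0 \<subseteq> \<Union>Sg" by (auto simp: V0_def)
  then have fin0: "finite V0" using finU finite_subset by blast
  have loc: "card (lv v) + card (lf v) = card (le v) + 2" "finite (lv v)" "finite (le v)" "finite (lf v)" if "v \<in> V0" for v
  proof -
    interpret vertex_link Sg num pos lnk v using assms that by (simp add: V0_def)
    show "card (lv v) + card (lf v) = card (le v) + 2" "finite (lv v)" "finite (le v)" "finite (lf v)"
      using link_euler finite_link by (simp_all add: LV_def LF_def LE_def lv_def le_def lf_def)
  qed
  have V: "v \<in> V0" if "edg v u" for v u
    using that face_closed[of "{v, u}" "{v}"] by (simp add: V0_def edg_def)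
  have V3: "v \<in> V0" if "tri v u w" for v u w
    using that tri_edg V by blast
  have V4: "v \<in> V0" if "tet v x y z" for v x y z
    using that tet_tri V3 by blast
  have "(\<Sum>v\<in>V0. card (lv v) + card (lf v)) = (\<Sum>v\<in>V0. card (le v) + 2)"
    by (rule sum.cong[OF refl]) (rule loc)
  then have sums: "card (Sigma V0 lv) + card (Sigma V0 lf) = card (Sigma V0 le) + 2 * card V0"
  proof -
    have "card (Sigma V0 lv) = (\<Sum>v\<in>V0. card (lv v))" "card (Sigma V0 lf) = (\<Sum>v\<in>V0. card (lf v))"
      "card (Sigma V0 le) = (\<Sum>v\<in>V0. card (le v))"
      using loc(2-4) fin0 by (simp_all add: card_SigmaI)
    then show ?thesis
      using \<open>(\<Sum>v\<in>V0. card (lv v) + card (lf v)) = (\<Sum>v\<in>V0. card (le v) + 2)\<close>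
      by (simp only: sum.distrib) simp
  qed
  have "card (Sigma V0 lv) = 2 * card T2"
  proof -
    have "num u < num v \<or> num v < num u" if "edg v u" for u v
      using that num_eq[of "{v, u}" "{v, u}" v u] by (cases "num u" "num v" rule: linorder_cases) (auto simp: edg_def)
    then have "Sigma V0 lv = T2 \<union> prod.swap ` T2"
      using V edg_sym by (fastforce simp: lv_def T2_def image_iff)
    moreover have "T2 \<inter> prod.swap ` T2 = {}" by (auto simp: T2_def)
    moreover have "card (prod.swap ` T2) = card T2" by (rule card_image) simp
    ultimately show ?thesis using finite_T by (simp add: card_Un_disjoint)
  qed
  moreover have "card (Sigma V0 le) = 3 * card T3"
  proof -
    have "bij_betw (\<lambda>(v, u, w). (u, w, v)) (Sigma V0 le) FL"
      by (rule bij_betw_byWitness[where f' = "\<lambda>(u, w, v). (v, u, w)"])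
        (auto simp: le_def FL_def intro: V3 dest: tri_perm)
    then have "card (Sigma V0 le) = card FL" by (rule bij_betw_same_card)
    also have "\<dots> = card (T3 \<times> {0, 1, 2 :: nat})" using bij_betw_same_card[OF bij_slot] by simp
    finally show ?thesis by (simp add: card_cartesian_product)
  qed
  \<comment> \<open>A tetrahedron with a distinguished vertex v is encoded by the triangle opposite
    to v and the side of it on which v lies.\<close>
  moreover have "card (Sigma V0 lf) = 2 * card T3"
  proof -
    have "bij_betw (\<lambda>(v, x, y, z). ((x, y, z), pos x y z v)) (Sigma V0 lf) (T3 \<times> UNIV)"
    proof (rule bij_betw_imageI)
      show "inj_on (\<lambda>(v, x, y, z). ((x, y, z), pos x y z v)) (Sigma V0 lf)"
      proof (rule inj_onI)
        fix s t assume st: "s \<in> Sigma V0 lf" "t \<in> Sigma V0 lf"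
          and eq: "(\<lambda>(v, x, y, z). ((x, y, z), pos x y z v)) s = (\<lambda>(v, x, y, z). ((x, y, z), pos x y z v)) t"
        obtain v x y z where s: "s = (v, x, y, z)" by (cases s)
        obtain v' where t: "t = (v', x, y, z)" "pos x y z v = pos x y z v'" using eq s by (cases t) auto
        have "tet x y z v" "tet x y z v'" using st s t by (auto simp: lf_def tet_def insert_commute)
        then show "s = t" using pos_unique t s by blast
      qed
      show "(\<lambda>(v, x, y, z). ((x, y, z), pos x y z v)) ` Sigma V0 lf = T3 \<times> UNIV"
      proof (intro equalityI subsetI)
        fix t assume "t \<in> (\<lambda>(v, x, y, z). ((x, y, z), pos x y z v)) ` Sigma V0 lf"
        then show "t \<in> T3 \<times> UNIV" by (auto simp: lf_def T3_def dest: tri_of_tet(8))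
      next
        fix t assume "t \<in> T3 \<times> (UNIV :: bool set)"
        then obtain x y z k where t: "t = ((x, y, z), k)" "tri x y z" "num x > num y" "num y > num z"
          by (auto simp: T3_def)
        obtain v where v: "tet x y z v" "pos x y z v = k"
          using ex_pos[OF t(2)] ex_neg[OF t(2)] by (cases k) auto
        have "tet v x y z" using v(1) tet_sym by blast
        then have "(v, x, y, z) \<in> Sigma V0 lf" using t V4 by (simp add: lf_def)
        then show "t \<in> (\<lambda>(v, x, y, z). ((x, y, z), pos x y z v)) ` Sigma V0 lf"
          using t(1) v(2) by (intro image_eqI[of _ _ "(v, x, y, z)"]) auto
      qed
    qed
    then have "card (Sigma V0 lf) = card (T3 \<times> (UNIV :: bool set))" by (rule bij_betw_same_card)
    then show ?thesis by (simp add: card_cartesian_product)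
  qed
  moreover have "card T3 = 2 * card T4"
    using bij_betw_same_card[OF bij_posface] by (simp add: card_cartesian_product)
  ultimately show ?thesis using sums by (simp add: V0_def)
qed

end

section \<open>Triangulated 3-manifolds\<close>

text \<open>The abstract complex of K. Affine independence makes the vertex set of a simplex unique,
  and the empty face is left out.\<close>

definition vertex_sets :: "'v::euclidean_space set set \<Rightarrow> 'v set set"
  where "vertex_sets K = {A. A \<noteq> {} \<and> \<not> affine_dependent A \<and> convex hull A \<in> K}"

lemma convex_hull_eq_independent:
  fixes A B :: "'v::euclidean_space set"
  assumes "\<not> affine_dependent A" "\<not> affine_dependent B" "convex hull A = convex hull B"
  shows "A = B"
proof (rule set_eqI)
  show "x \<in> A \<longleftrightarrow> x \<in> B" for x
    using extreme_point_of_convex_hull_affine_independent[OF assms(1), of x]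
      extreme_point_of_convex_hull_affine_independent[OF assms(2), of x] assms(3) by simp
qed

lemma inj_on_hull: "inj_on ((hull) convex) (vertex_sets K)"
  by (rule inj_onI) (simp add: vertex_sets_def convex_hull_eq_independent)

locale complex_K =
  fixes K :: "'v::euclidean_space set set"
  assumes complex: "simplicial_complex K"
begin

lemma finite_K: "finite K"
  using complex by (simp add: simplicial_complex_def)

lemma face_K: "S \<in> K \<Longrightarrow> F face_of S \<Longrightarrow> F \<in> K"
  using complex by (auto simp: simplicial_complex_def)

lemma simplex_K: assumes "S \<in> K" "S \<noteq> {}" shows "\<exists>A\<in>vertex_sets K. S = convex hull A"
proof -
  obtain n where "n simplex S" using complex assms unfolding simplicial_complex_def by blast
  then obtain A where "\<not> affine_dependent A" "S = convex hull A" by (auto simp: simplex_def)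
  then show ?thesis using assms by (auto simp: vertex_sets_def)
qed

lemma vs_finite: "A \<in> vertex_sets K \<Longrightarrow> finite A"
  by (auto simp: vertex_sets_def aff_independent_finite)

lemma vs_closed:
  assumes "A \<in> vertex_sets K" "B \<subseteq> A" "B \<noteq> {}"
  shows "B \<in> vertex_sets K"
proof -
  have "convex hull B face_of convex hull A"
    using assms face_of_convex_hull_affine_independent[of A] by (auto simp: vertex_sets_def)
  then show ?thesis
    using assms face_K[of "convex hull A"] affine_independent_subset[of A B] by (simp add: vertex_sets_def)
qed

text \<open>The intersection is a face of both simplices, hence spanned by a subset of either vertex
  set, and an affinely independent spanning set is determined by its hull.\<close>

lemma vs_inter:
  assumes A: "A \<in> vertex_sets K" and B: "B \<in> vertex_sets K"
  shows "convex hull A \<inter> convex hull B = convex hull (A \<inter> B)"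
proof -
  have f: "(convex hull A \<inter> convex hull B) face_of convex hull A" "(convex hull A \<inter> convex hull B) face_of convex hull B"
    using complex A B unfolding simplicial_complex_def vertex_sets_def by (blast, metis (no_types, lifting) Int_commute mem_Collect_eq)
  obtain C where C: "C \<subseteq> A" "convex hull A \<inter> convex hull B = convex hull C"
    using f(1) A face_of_convex_hull_affine_independent[of A] by (auto simp: vertex_sets_def)
  obtain C' where C': "C' \<subseteq> B" "convex hull A \<inter> convex hull B = convex hull C'"
    using f(2) B face_of_convex_hull_affine_independent[of B] by (auto simp: vertex_sets_def)
  have "\<not> affine_dependent C" "\<not> affine_dependent C'"
    using A B C(1) C'(1) affine_independent_subset[of A C] affine_independent_subset[of B C'] by (simp_all add: vertex_sets_def)
  then have "C = C'" using C C' convex_hull_eq_independent by metis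
  then have "convex hull C \<subseteq> convex hull (A \<inter> B)" using C C' by (intro hull_mono) auto
  moreover have "convex hull (A \<inter> B) \<subseteq> convex hull A \<inter> convex hull B"
    by (simp add: hull_mono)
  ultimately show ?thesis using C by auto
qed

lemma finite_vs: "finite (vertex_sets K)"
proof (rule finite_imageD)
  show "finite ((hull) convex ` vertex_sets K)"
    by (rule finite_subset[OF _ finite_K]) (auto simp: vertex_sets_def)
  show "inj_on ((hull) convex) (vertex_sets K)"
    by (rule inj_on_hull)
qed

lemma simplices_eq: "simplices n K = (hull) convex ` {A \<in> vertex_sets K. card A = Suc n}"
proof (intro equalityI subsetI)
  fix S assume "S \<in> simplices n K"
  then obtain A where A: "S \<in> K" "\<not> affine_dependent A" "int (card A) = int n + 1" "S = convex hull A"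
    by (auto simp: simplices_def simplex_def)
  then have "A \<noteq> {}" by auto
  then show "S \<in> (hull) convex ` {A \<in> vertex_sets K. card A = Suc n}"
    using A by (auto simp: vertex_sets_def)
next
  fix S assume "S \<in> (hull) convex ` {A \<in> vertex_sets K. card A = Suc n}"
  then show "S \<in> simplices n K"
    by (force simp: simplices_def simplex_def vertex_sets_def)
qed

lemma card_simplices: "card (simplices n K) = card {A \<in> vertex_sets K. card A = Suc n}"
  unfolding simplices_eq
  by (rule card_image) (rule inj_on_subset[OF inj_on_hull], blast)

text \<open>An n-simplex has n + 1 extreme points, all of which must occur in X. So the listed
  points are neither repeated nor redundant.\<close>

lemma hull_in_simplices:
  assumes "finite X" "card X \<le> Suc n"
  shows "convex hull X \<in> simplices n K \<longleftrightarrow> X \<in> vertex_sets K \<and> card X = Suc n"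
proof
  assume "convex hull X \<in> simplices n K"
  then obtain A where A: "A \<in> vertex_sets K" "card A = Suc n" "convex hull X = convex hull A"
    by (auto simp: simplices_eq)
  have "A \<subseteq> X"
  proof
    fix x assume "x \<in> A"
    then have "x extreme_point_of (convex hull X)"
      using A extreme_point_of_convex_hull_affine_independent by (auto simp: vertex_sets_def)
    then show "x \<in> X" using extreme_point_of_convex_hull by blast
  qed
  then have "A = X" using assms A by (intro card_seteq) simp_all
  then show "X \<in> vertex_sets K \<and> card X = Suc n" using A by simp
qed (auto simp: simplices_eq)

lemma vertex_iff: "{v} \<in> vertex_sets K \<longleftrightarrow> {v} \<in> K"
  by (auto simp: vertex_sets_def)

lemma vertex_mem: "A \<in> vertex_sets K \<Longrightarrow> v \<in> A \<Longrightarrow> {v} \<in> vertex_sets K"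
  by (rule vs_closed) auto

lemma vertex_in_hull: "A \<in> vertex_sets K \<Longrightarrow> {v} \<in> vertex_sets K \<Longrightarrow> v \<in> convex hull A \<Longrightarrow> v \<in> A"
  using vs_inter[of A "{v}"] by (cases "v \<in> A") auto

text \<open>The relative interior of a maximal simplex is the complement of the union of all other
  simplices, and that is a finite union of closed sets.\<close>

lemma maximal_open:
  assumes B: "B \<in> vertex_sets K" and max: "\<And>C. C \<in> vertex_sets K \<Longrightarrow> B \<subseteq> C \<Longrightarrow> C = B"
  shows "openin (top_of_set (\<Union>K)) (rel_interior (convex hull B))"
proof -
  let ?\<sigma> = "convex hull B"
  have ind: "\<not> affine_dependent B" and K: "?\<sigma> \<in> K" using B by (auto simp: vertex_sets_def)
  have closed: "closed (\<Union>(K - {?\<sigma>}))"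
  proof (rule closed_Union)
    show "\<forall>T\<in>K - {?\<sigma>}. closed T"
      using complex closed_simplex unfolding simplicial_complex_def by blast
  qed (use finite_K in auto)
  have "rel_interior ?\<sigma> = \<Union>K - \<Union>(K - {?\<sigma>})"
  proof (intro equalityI subsetI DiffI)
    fix x assume x: "x \<in> rel_interior ?\<sigma>"
    show "x \<in> \<Union>K" using x K rel_interior_subset by blast
    show "x \<notin> \<Union>(K - {?\<sigma>})"
    proof
      assume "x \<in> \<Union>(K - {?\<sigma>})"
      then obtain T where T: "T \<in> K" "T \<noteq> ?\<sigma>" "x \<in> T" by auto
      then obtain C where C: "C \<in> vertex_sets K" "T = convex hull C" using simplex_K by blast
      have int: "?\<sigma> \<inter> T = convex hull (B \<inter> C)" using vs_inter[OF B C(1)] C(2) by simp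
      have "(?\<sigma> \<inter> T) face_of ?\<sigma>"
        unfolding int using ind face_of_convex_hull_affine_independent[of B] by blast
      moreover have "x \<in> ?\<sigma> \<inter> T" using x T rel_interior_subset by blast
      ultimately have "?\<sigma> \<inter> T = ?\<sigma>" using face_of_disjoint_rel_interior x by blast
      then have "convex hull (B \<inter> C) = ?\<sigma>" using int by simp
      then have "B \<inter> C = B"
        using convex_hull_eq_independent[of "B \<inter> C" B] ind affine_independent_subset[of B "B \<inter> C"] by auto
      then have "C = B" using max[OF C(1)] by blast
      then show False using T C by simp
    qed
  next
    fix x assume x: "x \<in> \<Union>K - \<Union>(K - {?\<sigma>})"
    then have x\<sigma>: "x \<in> ?\<sigma>" by blast
    show "x \<in> rel_interior ?\<sigma>"
    proof (rule ccontr)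
      assume "x \<notin> rel_interior ?\<sigma>"
      then have "x \<in> rel_frontier ?\<sigma>"
        using x\<sigma> closure_subset by (auto simp: rel_frontier_def)
      then obtain b where b: "b \<in> B" "x \<in> convex hull (B - {b})"
        using rel_frontier_convex_hull_cases[OF ind] by auto
      have "convex hull (B - {b}) \<in> K"
        using face_K[OF K] ind face_of_convex_hull_affine_independent[of B] by blast
      moreover have "convex hull (B - {b}) \<noteq> ?\<sigma>"
        using convex_hull_eq_independent[of "B - {b}" B] ind affine_independent_subset[of B "B - {b}"] b by auto
      ultimately show False using x b by blast
    qed
  qed
  moreover have "closedin (top_of_set (\<Union>K)) (\<Union>(K - {?\<sigma>}))"
    using closed by (intro closed_subset) auto
  ultimately show ?thesis
    by (metis openin_diff openin_subtopology_self)
qed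

text \<open>A piece of the interior of a maximal simplex is open in its affine hull and homeomorphic
  to an open set of three-space; invariance of dimension is applied in both directions.\<close>

lemma pure3:
  assumes chart: "\<And>x. x \<in> \<Union>K \<Longrightarrow> \<exists>U W :: (real ^ 3) set.
       openin (top_of_set (\<Union>K)) U \<and> x \<in> U \<and> open W \<and> U homeomorphic W"
    and A: "A \<in> vertex_sets K"
  shows "\<exists>B\<in>vertex_sets K. A \<subseteq> B \<and> card B = 4"
proof -
  obtain B where B: "B \<in> vertex_sets K" "A \<subseteq> B" and max: "\<And>C. C \<in> vertex_sets K \<Longrightarrow> B \<subseteq> C \<Longrightarrow> C = B"
    using finite_has_maximal2[OF finite_vs A] by metis
  let ?\<sigma> = "convex hull B" and ?R = "rel_interior (convex hull B)"
  have ind: "\<not> affine_dependent B" "B \<noteq> {}" and K: "?\<sigma> \<in> K" using B by (auto simp: vertex_sets_def)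
  have R: "openin (top_of_set (\<Union>K)) ?R" by (rule maximal_open[OF B(1) max])
  have "?R \<noteq> {}" using ind by (simp add: rel_interior_eq_empty)
  then obtain x where x: "x \<in> ?R" by blast
  then obtain U and W :: "(real ^ 3) set" where U: "openin (top_of_set (\<Union>K)) U" "x \<in> U" "open W" "U homeomorphic W"
    using chart[of x] openin_imp_subset[OF R] by blast
  obtain f g where fg: "homeomorphism U W f g" using U(4) by (auto simp: homeomorphic_def)
  define N where "N = U \<inter> ?R"
  have N: "openin (top_of_set U) N" "openin (top_of_set ?R) N" "x \<in> N"
  proof -
    have "openin (top_of_set (\<Union>K)) N" unfolding N_def using U R by blast
    then show "openin (top_of_set U) N" "openin (top_of_set ?R) N"
      using openin_subset_trans[of "\<Union>K" N] openin_imp_subset[OF U(1)] openin_imp_subset[OF R]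
      by (auto simp: N_def)
    show "x \<in> N" using U x by (simp add: N_def)
  qed
  have aff: "openin (top_of_set (affine hull B)) ?R"
    using openin_rel_interior[of ?\<sigma>] by (simp add: affine_hull_convex_hull)
  then have N_aff: "openin (top_of_set (affine hull B)) N" using N(2) openin_trans by blast
  have fN: "openin (top_of_set W) (f ` N)"
    using homeomorphism_imp_open_map[OF fg N(1)] .
  then have open_fN: "open (f ` N)" using U(3) openin_open_eq by blast
  have homN: "homeomorphism N (f ` N) f g"
    by (rule homeomorphism_of_subsets[OF fg]) (auto simp: N_def)
  have d1: "aff_dim (affine hull B) \<le> aff_dim (UNIV :: (real ^ 3) set)"
    by (rule invariance_of_dimension_affine_sets[OF N_aff, of _ f])
      (use homN N(3) in \<open>auto simp: homeomorphism_def intro: inj_on_inverseI\<close>)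
  have d2: "aff_dim (UNIV :: (real ^ 3) set) \<le> aff_dim (affine hull B)"
  proof (rule invariance_of_dimension_affine_sets[of _ "f ` N" _ g])
    show "openin (top_of_set UNIV) (f ` N)" using open_fN by simp
    show "continuous_on (f ` N) g" using homN by (simp add: homeomorphism_def)
    show "g \<in> f ` N \<rightarrow> affine hull B"
      using homN openin_imp_subset[OF N_aff] by (auto simp: homeomorphism_def)
    show "inj_on g (f ` N)" using homN by (auto simp: homeomorphism_def intro: inj_on_inverseI)
  qed (use N(3) in auto)
  have "aff_dim B = 3" using d1 d2 by (simp add: aff_dim_affine_hull)
  then have "card B = 4" using aff_dim_unique[of B] aff_dim_affine_independent[OF ind(1)] by linarith
  then show ?thesis using B by blast
qed

section \<open>Topology near a vertex\<close>

text \<open>N is the image of a punctured chart ball, so its shape inside K is unknown; \<delta>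
  only guarantees that points of K close to v belong to it.\<close>

lemma punctured_neighbourhood:
  assumes chart: "\<And>x. x \<in> \<Union>K \<Longrightarrow> \<exists>U W :: (real ^ 3) set.
       openin (top_of_set (\<Union>K)) U \<and> x \<in> U \<and> open W \<and> U homeomorphic W"
    and v: "{v} \<in> vertex_sets K"
  shows "\<exists>N \<delta>. \<delta> > 0 \<and> ball v \<delta> \<inter> \<Union>K - {v} \<subseteq> N \<and> v \<notin> N \<and> connected N \<and> Borsukian N \<and>
    N \<subseteq> \<Union>((hull) convex ` {A \<in> vertex_sets K. v \<in> A \<and> card A = 4})"
proof -
  have vK: "v \<in> \<Union>K" using v by (auto simp: vertex_sets_def)
  obtain U and W :: "(real ^ 3) set" where U: "openin (top_of_set (\<Union>K)) U" "v \<in> U" "open W" "U homeomorphic W"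
    using chart[OF vK] by blast
  obtain f g where fg: "homeomorphism U W f g" using U(4) by (auto simp: homeomorphic_def)
  \<comment> \<open>Avoiding the simplices away from v forces N into the simplices at v, which
    \<open>pure3\<close> enlarges to tetrahedra at v.\<close>
  define Z where "Z = \<Union>{T \<in> K. v \<notin> T}"
  have "closed Z" unfolding Z_def
  proof (rule closed_Union)
    show "\<forall>T\<in>{T \<in> K. v \<notin> T}. closed T"
      using complex closed_simplex unfolding simplicial_complex_def by blast
  qed (use finite_K in auto)
  then have U': "openin (top_of_set U) (U - Z)"
    by (metis closedin_closed_Int Diff_Int_distrib openin_diff openin_subtopology_self Diff_Int inf.idem Diff_eq Int_Diff Int_absorb)
  have vU': "v \<in> U - Z" using U(2) by (auto simp: Z_def)
  have "openin (top_of_set W) (f ` (U - Z))" using homeomorphism_imp_open_map[OF fg U'] .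
  then have "open (f ` (U - Z))" using U(3) openin_open_eq by blast
  then obtain r where r: "r > 0" "ball (f v) r \<subseteq> f ` (U - Z)"
    using vU' open_contains_ball by blast
  define B where "B = ball (f v) r"
  define N0 where "N0 = g ` B"
  have BW: "B \<subseteq> W" using r fg unfolding B_def homeomorphism_def by blast
  have N0U: "N0 \<subseteq> U - Z"
    using r(2) fg unfolding N0_def B_def homeomorphism_def by (auto dest!: subsetD)
  have gf: "g (f v) = v" using fg U(2) by (simp add: homeomorphism_def)
  have "openin (top_of_set W) B" using BW by (simp add: B_def open_openin_trans openin_open_eq U(3))
  then have "openin (top_of_set U) N0"
    unfolding N0_def using homeomorphism_imp_open_map[OF homeomorphism_symD[OF fg]] by blast
  then have N0: "openin (top_of_set (\<Union>K)) N0" using U(1) openin_trans by blast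
  have vN0: "v \<in> N0" using gf r(1) unfolding N0_def B_def by (metis centre_in_ball imageI)
  obtain \<delta> where \<delta>: "\<delta> > 0" "ball v \<delta> \<inter> \<Union>K \<subseteq> N0"
    using N0 vN0 unfolding openin_contains_ball by blast
  define N where "N = N0 - {v}"
  have inj: "inj_on g B" using fg BW unfolding homeomorphism_def by (metis inj_on_inverseI subsetD)
  have "homeomorphism B N0 g f"
    unfolding N0_def by (rule homeomorphism_of_subsets[OF homeomorphism_symD[OF fg]]) (use BW in auto)
  moreover have "g ` (B - {f v}) = N"
    unfolding N_def N0_def using inj gf r(1) by (subst inj_on_image_set_diff[of g B]) (auto simp: B_def)
  ultimately have "homeomorphism (B - {f v}) N g f"
    by (metis Diff_subset N_def homeomorphism_of_subsets)
  then have hom: "(B - {f v}) homeomorphic N" by (auto simp: homeomorphic_def)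
  have dimB: "aff_dim B = 3" using r(1) by (simp add: B_def aff_dim_open)
  \<comment> \<open>Dimension 3 is essential: a punctured disc is not simply connected.\<close>
  have sc: "simply_connected (B - {f v})"
    using dimB by (intro simply_connected_punctured_convex) (auto simp: B_def)
  have "locally path_connected (B - {f v})"
    by (rule open_imp_locally_path_connected) (auto simp: B_def)
  then have "Borsukian (B - {f v})" using sc simply_connected_imp_Borsukian by blast
  then have "Borsukian N" using hom homeomorphic_Borsukian by blast
  moreover have "connected N"
    using hom simply_connected_imp_connected[OF sc] homeomorphic_connectedness by blast
  moreover have "N \<subseteq> \<Union>((hull) convex ` {A \<in> vertex_sets K. v \<in> A \<and> card A = 4})"
  proof
    fix x assume "x \<in> N"
    then have x: "x \<in> U" "x \<notin> Z" using N0U by (auto simp: N_def)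
    then obtain T where T: "T \<in> K" "x \<in> T" using openin_imp_subset[OF U(1)] by blast
    then have "v \<in> T" using x by (auto simp: Z_def)
    obtain A where A: "A \<in> vertex_sets K" "T = convex hull A" using simplex_K T by blast
    then have vA: "v \<in> A" using vertex_in_hull v \<open>v \<in> T\<close> by blast
    obtain B' where B': "B' \<in> vertex_sets K" "A \<subseteq> B'" "card B' = 4" using pure3[OF chart A(1)] by blast
    then have "x \<in> convex hull B'" using T A hull_mono[of A B'] by blast
    then show "x \<in> \<Union>((hull) convex ` {A \<in> vertex_sets K. v \<in> A \<and> card A = 4})" using B' vA by blast
  qed
  ultimately show ?thesis
    using \<delta> by (intro exI[of _ N] exI[of _ \<delta>]) (auto simp: N_def)
qed

lemma paste:
  fixes f :: "'v set \<Rightarrow> 'v \<Rightarrow> 'b::topological_space"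
  assumes I: "finite I" "I \<subseteq> vertex_sets K" and cover: "N \<subseteq> \<Union>((hull) convex ` I)"
    and cont: "\<And>A. A \<in> I \<Longrightarrow> continuous_on (convex hull A \<inter> N) (f A)"
    and agree: "\<And>A B x. A \<in> I \<Longrightarrow> B \<in> I \<Longrightarrow> x \<in> convex hull (A \<inter> B) \<Longrightarrow> x \<in> N \<Longrightarrow> f A x = f B x"
  obtains g where "continuous_on N g" "\<And>A x. A \<in> I \<Longrightarrow> x \<in> convex hull A \<Longrightarrow> x \<in> N \<Longrightarrow> g x = f A x"
proof -
  obtain g where g: "continuous_map (top_of_set N) euclidean g"
    "\<And>x A. A \<in> I \<Longrightarrow> x \<in> topspace (top_of_set N) \<inter> (convex hull A \<inter> N) \<Longrightarrow> g x = f A x"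
  proof (rule pasting_lemma_exists_closed[of I "top_of_set N" "\<lambda>A. convex hull A \<inter> N" euclidean f])
    show "topspace (top_of_set N) \<subseteq> (\<Union>A\<in>I. convex hull A \<inter> N)" using cover by auto
    fix A assume A: "A \<in> I"
    then have "closed (convex hull A)"
      using I(2) vs_finite by (meson compact_imp_closed finite_imp_compact_convex_hull subsetD)
    then show "closedin (top_of_set N) (convex hull A \<inter> N)"
      by (metis closedin_closed_Int Int_commute)
    show "continuous_map (subtopology (top_of_set N) (convex hull A \<inter> N)) euclidean (f A)"
      using cont[OF A] by (simp add: subtopology_subtopology inf.absorb2)
  next
    fix A B x assume AB: "A \<in> I" "B \<in> I" and x: "x \<in> topspace (top_of_set N) \<inter> (convex hull A \<inter> N) \<inter> (convex hull B \<inter> N)"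
    then have "x \<in> convex hull (A \<inter> B)" using vs_inter[of A B] I(2) by auto
    then show "f A x = f B x" using agree[OF AB, of x] x by blast
  qed (use I in auto)
  then show ?thesis by (intro that[of g]) auto
qed

lemma small_scale:
  fixes v :: 'v
  assumes "\<delta> > 0" "finite X"
  obtains t where "0 < t" "t < 1" "\<And>u. u \<in> X \<Longrightarrow> v + t *\<^sub>R (u - v) \<in> ball v \<delta>"
proof -
  define m where "m = Max (insert 1 ((\<lambda>u. norm (u - v)) ` X))"
  have m: "1 \<le> m" "\<And>u. u \<in> X \<Longrightarrow> norm (u - v) \<le> m"
    using assms(2) by (auto simp: m_def)
  define t where "t = min (1/2) (\<delta> / (2 * m))"
  have t: "0 < t" "t < 1" using m assms(1) by (auto simp: t_def)
  have "v + t *\<^sub>R (u - v) \<in> ball v \<delta>" if "u \<in> X" for u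
  proof -
    have "t * norm (u - v) \<le> (\<delta> / (2 * m)) * m"
      using m(2)[OF that] assms(1) m(1) by (intro mult_mono) (auto simp: t_def)
    also have "\<dots> < \<delta>" using m(1) assms(1) by simp
    finally show ?thesis using t by (simp add: dist_norm)
  qed
  then show ?thesis using t that by blast
qed

lemma hull_inter_vertex:
  assumes "x \<in> convex hull (A \<inter> B)" "x \<noteq> v"
  shows "\<exists>w\<in>A \<inter> B. w \<noteq> v"
proof (rule ccontr)
  assume "\<not> (\<exists>w\<in>A \<inter> B. w \<noteq> v)"
  then have "A \<inter> B \<subseteq> {v}" by blast
  then have "convex hull (A \<inter> B) \<subseteq> {v}" using hull_mono[of "A \<inter> B" "{v}" convex] by simp
  then show False using assms by blast
qed

end

locale closed_K = complex_K K for K :: "'a::euclidean_space set set" +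
  assumes chart: "\<And>x. x \<in> \<Union>K \<Longrightarrow> \<exists>U W :: (real ^ 3) set.
       openin (top_of_set (\<Union>K)) U \<and> x \<in> U \<and> open W \<and> U homeomorphic W"
begin

text \<open>P induces a function on N with values 0 and 1 that is constant on each tetrahedron. It
  is consistent because tetrahedra that meet outside v share a vertex other than v. Connectedness of
  N makes it constant, and points of the edges va and vb near v read off P at a and b.\<close>

lemma link_connected:
  assumes v: "{v} \<in> vertex_sets K"
    and P: "\<And>u w. {v, u, w} \<in> vertex_sets K \<Longrightarrow> distinct [v, u, w] \<Longrightarrow> P u \<longleftrightarrow> P w"
    and a: "{v, a} \<in> vertex_sets K" "v \<noteq> a" and b: "{v, b} \<in> vertex_sets K" "v \<noteq> b"
  shows "P a \<longleftrightarrow> P b"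
proof -
  obtain N \<delta> where N: "\<delta> > 0" "ball v \<delta> \<inter> \<Union>K - {v} \<subseteq> N" "v \<notin> N" "connected N"
    "N \<subseteq> \<Union>((hull) convex ` {A \<in> vertex_sets K. v \<in> A \<and> card A = 4})"
    using punctured_neighbourhood[OF chart v] by blast
  define I where "I = {A \<in> vertex_sets K. v \<in> A \<and> card A = 4}"
  have I: "finite I" "I \<subseteq> vertex_sets K" using finite_vs by (auto simp: I_def)
  have PA: "P u \<longleftrightarrow> P w" if "A \<in> I" "u \<in> A" "w \<in> A" "u \<noteq> v" "w \<noteq> v" for A u w
  proof (cases "u = w")
    case False
    have "{v, u, w} \<in> vertex_sets K" by (rule vs_closed[of A]) (use that in \<open>auto simp: I_def\<close>)
    then show ?thesis using P[of u w] that(4,5) False by auto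
  qed simp
  define q :: "'a set \<Rightarrow> real" where "q A = of_bool (\<exists>u\<in>A. u \<noteq> v \<and> P u)" for A
  have qA: "q A = of_bool (P u)" if "A \<in> I" "u \<in> A" "u \<noteq> v" for A u
    using PA[OF that(1)] that(2,3) unfolding q_def by (intro arg_cong[where f = of_bool]) blast
  obtain g :: "'a \<Rightarrow> real" where g: "continuous_on N g" "\<And>A x. A \<in> I \<Longrightarrow> x \<in> convex hull A \<Longrightarrow> x \<in> N \<Longrightarrow> g x = q A"
  proof (rule paste[OF I, of N "\<lambda>A _. q A"])
    show "N \<subseteq> \<Union>((hull) convex ` I)" using N(5) by (simp add: I_def)
    fix A B x assume AB: "A \<in> I" "B \<in> I" and x: "x \<in> convex hull (A \<inter> B)" "x \<in> N"
    have "x \<noteq> v" using x(2) N(3) by blast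
    then obtain w where "w \<in> A \<inter> B" "w \<noteq> v" using hull_inter_vertex[OF x(1)] by blast
    then show "q A = q B" using qA[OF AB(1), of w] qA[OF AB(2), of w] by simp
  qed auto
  have val: "\<exists>x\<in>N. g x = of_bool (P u)" if u: "{v, u} \<in> vertex_sets K" "v \<noteq> u" for u
  proof -
    obtain t where t: "0 < t" "t < 1" "v + t *\<^sub>R (u - v) \<in> ball v \<delta>"
      using small_scale[OF N(1), of "{u}" v] by blast
    obtain A where A: "A \<in> vertex_sets K" "{v, u} \<subseteq> A" "card A = 4" using pure3[OF chart u(1)] by blast
    define x where "x = v + t *\<^sub>R (u - v)"
    have "x = (1 - t) *\<^sub>R v + t *\<^sub>R u" by (simp add: x_def algebra_simps)
    moreover have "v \<in> convex hull A" "u \<in> convex hull A" using A by (auto intro: hull_inc)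
    ultimately have x: "x \<in> convex hull A"
      using t convexD[OF convex_convex_hull, of v A u "1 - t" t] by simp
    then have "x \<in> \<Union>K" using A by (auto simp: vertex_sets_def)
    moreover have "x \<noteq> v" using t u by (simp add: x_def)
    ultimately have "x \<in> N" using N(2) t(3) by (auto simp: x_def)
    then show ?thesis using g(2)[of A x] x A qA[of A u] u by (intro bexI[of _ x]) (auto simp: I_def)
  qed
  have "\<exists>y. \<forall>x\<in>N. g x = y"
  proof -
    have "g constant_on N"
    proof (rule continuous_discrete_range_constant[OF N(4) g(1)])
      fix x assume x: "x \<in> N"
      have *: "g y \<in> {0, 1}" if y: "y \<in> N" for y
      proof -
        obtain A where "A \<in> I" "y \<in> convex hull A" using N(5) y by (auto simp: I_def)
        then show ?thesis using g(2) y by (auto simp: q_def)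
      qed
      have "g y \<noteq> g x \<longrightarrow> 1 \<le> norm (g y - g x)" if y: "y \<in> N" for y
        using *[OF y] *[OF x] by auto
      then show "\<exists>e>0. \<forall>y. y \<in> N \<and> g y \<noteq> g x \<longrightarrow> e \<le> norm (g y - g x)" by (intro exI[of _ 1]) auto
    qed
    then show ?thesis by (auto simp: constant_on_def)
  qed
  then obtain y where y: "\<And>x. x \<in> N \<Longrightarrow> g x = y" by blast
  have "of_bool (P a) = y" "of_bool (P b) = y"
    using val[OF a] val[OF b] y by auto
  then have "of_bool (P a) = (of_bool (P b) :: real)" by simp
  then show ?thesis by (simp only: of_bool_eq_iff)
qed

text \<open>The interpolant is affine on the whole space, so that continuity and comparison on
  common faces need no barycentric coordinates.\<close>

lemma affine_interpolation:
  fixes A :: "'a set" and r :: "'a \<Rightarrow> real"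
  assumes "\<not> affine_dependent A"
  obtains h where "continuous_on UNIV h" "\<And>u. u \<in> A \<Longrightarrow> h u = r u"
    "\<And>x y s. h ((1 - s) *\<^sub>R x + s *\<^sub>R y) = (1 - s) * h x + s * h y"
proof (cases "A = {}")
  case True
  then show ?thesis by (intro that[of "\<lambda>_. 0"]) auto
next
  case False
  then obtain a where a: "a \<in> A" by blast
  define B where "B = (\<lambda>x. x - a) ` (A - {a})"
  have "independent B"
    using assms a affine_dependent_iff_dependent2[of a A] by (simp add: B_def)
  then obtain l where l: "linear l" "\<And>x. x \<in> B \<Longrightarrow> l x = r (x + a) - r a"
    using linear_independent_extend[of B "\<lambda>x. r (x + a) - r a"] by blast
  show ?thesis
  proof (rule that[of "\<lambda>x. l (x - a) + r a"])
    show "continuous_on UNIV (\<lambda>x. l (x - a) + r a)"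
      by (intro continuous_intros linear_continuous_on_compose[OF _ l(1)])
    show "l (u - a) + r a = r u" if "u \<in> A" for u
      using that l linear_0[OF l(1)] by (cases "u = a") (auto simp: B_def)
    fix x y s
    have "(1 - s) *\<^sub>R x + s *\<^sub>R y - a = (1 - s) *\<^sub>R (x - a) + s *\<^sub>R (y - a)" by (simp add: algebra_simps)
    then have "l ((1 - s) *\<^sub>R x + s *\<^sub>R y - a) = (1 - s) * l (x - a) + s * l (y - a)"
      by (simp only: linear_add[OF l(1)] linear_scale[OF l(1)] real_scaleR_def)
    then show "l ((1 - s) *\<^sub>R x + s *\<^sub>R y - a) + r a = (1 - s) * (l (x - a) + r a) + s * (l (y - a) + r a)"
      by (simp only:) (simp add: algebra_simps)
  qed
qed

lemma affine_eq_on_hull: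
  fixes h h' :: "'a \<Rightarrow> real"
  assumes "\<And>x y s. h ((1 - s) *\<^sub>R x + s *\<^sub>R y) = (1 - s) * h x + s * h y"
    and "\<And>x y s. h' ((1 - s) *\<^sub>R x + s *\<^sub>R y) = (1 - s) * h' x + s * h' y"
    and "\<And>u. u \<in> C \<Longrightarrow> h u = h' u" and "x \<in> convex hull C"
  shows "h x = h' x"
proof -
  have "convex {x. h x = h' x}" unfolding convex_alt using assms(1,2) by auto
  then have "convex hull C \<subseteq> {x. h x = h' x}" using assms(3) by (intro hull_minimal) auto
  then show ?thesis using assms(4) by blast
qed

text \<open>
  A 1-cocycle \<open>c\<close> on the link of \<open>v\<close> is the winding of a map from a punctured neighbourhood of
  \<open>v\<close> to the unit circle; as that neighbourhood is a punctured 3-ball, the map has a logarithm,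
  whose values at points near \<open>v\<close> are a potential of \<open>c\<close>.
\<close>

lemma link_exact:
  fixes c :: "'a \<Rightarrow> 'a \<Rightarrow> int"
  assumes v: "{v} \<in> vertex_sets K"
    and anti: "\<And>u w. {v, u, w} \<in> vertex_sets K \<Longrightarrow> distinct [v, u, w] \<Longrightarrow> c w u = - c u w"
    and cocycle: "\<And>x y z. {v, x, y, z} \<in> vertex_sets K \<Longrightarrow> distinct [v, x, y, z] \<Longrightarrow> c x y + c y z + c z x = 0"
  shows "\<exists>b :: 'a \<Rightarrow> int. \<forall>u w. {v, u, w} \<in> vertex_sets K \<and> distinct [v, u, w] \<longrightarrow> c u w = b w - b u"
proof -
  obtain N \<delta> where N: "\<delta> > 0" "ball v \<delta> \<inter> \<Union>K - {v} \<subseteq> N" "v \<notin> N" "Borsukian N"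
    "N \<subseteq> \<Union>((hull) convex ` {A \<in> vertex_sets K. v \<in> A \<and> card A = 4})"
    using punctured_neighbourhood[OF chart v] by blast
  define I where "I = {A \<in> vertex_sets K. v \<in> A \<and> card A = 4}"
  have I: "finite I" "I \<subseteq> vertex_sets K" using finite_vs by (auto simp: I_def)
  have vI: "v \<in> A" "\<not> affine_dependent A" if "A \<in> I" for A using that by (auto simp: I_def vertex_sets_def)
  \<comment> \<open>Zero on the diagonal, so that additivity also holds when some of the three
    vertices coincide.\<close>
  define c0 where "c0 u w = (if u = w then 0 else c u w)" for u w
  have anti0: "c0 w u = - c0 u w" if "A \<in> I" "u \<in> A - {v}" "w \<in> A - {v}" for A u w
  proof (cases "u = w")
    case False
    have "{v, u, w} \<in> vertex_sets K" by (rule vs_closed[of A]) (use that in \<open>auto simp: I_def\<close>)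
    then show ?thesis using anti[of u w] that(2,3) False by (auto simp: c0_def)
  qed (simp add: c0_def)
  have c0_add: "c0 a u = c0 a w + c0 w u" if A: "A \<in> I" "a \<in> A - {v}" "u \<in> A - {v}" "w \<in> A - {v}" for A a u w
  proof (cases "a = w \<or> w = u \<or> a = u")
    case True
    then show ?thesis using anti0[OF A(1,2,4)] by (auto simp: c0_def)
  next
    case False
    have "{v, a, w, u} \<in> vertex_sets K" by (rule vs_closed[of A]) (use A in \<open>auto simp: I_def\<close>)
    then have "c a w + c w u + c u a = 0" using cocycle[of a w u] A(2-4) False by auto
    moreover have "c0 u a = - c0 a u" by (rule anti0[OF A(1-3)])
    moreover have "u \<noteq> a" "a \<noteq> u" "a \<noteq> w" "w \<noteq> u" using False by auto
    ultimately show ?thesis by (simp add: c0_def)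
  qed
  define base where "base A = (SOME a. a \<in> A - {v})" for A
  have base: "base A \<in> A - {v}" if "A \<in> I" for A
  proof -
    have "A - {v} \<noteq> {}"
    proof
      assume "A - {v} = {}"
      then have "card A \<le> card {v}" by (intro card_mono) auto
      then show False using that by (simp add: I_def)
    qed
    then show ?thesis unfolding base_def by (rule some_in_eq[THEN iffD2])
  qed
  \<comment> \<open>\<open>\<mu> A\<close> is 1 minus the barycentric coordinate of v. Dividing by
    it makes functions constant along the rays from v and thereby extends functions on the link
    radially.\<close>
  have "\<forall>A\<in>I. \<exists>h. continuous_on UNIV h \<and> (\<forall>u\<in>A. h u = of_bool (u \<noteq> v)) \<and>
      (\<forall>x y s. h ((1 - s) *\<^sub>R x + s *\<^sub>R y) = (1 - s) * h x + s * (h y :: real))" (is "\<forall>A\<in>I. ?h A")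
  proof
    fix A assume "A \<in> I"
    then obtain h where "continuous_on UNIV h" "\<And>u. u \<in> A \<Longrightarrow> h u = (of_bool (u \<noteq> v) :: real)"
      "\<And>x y s. h ((1 - s) *\<^sub>R x + s *\<^sub>R y) = (1 - s) * h x + s * h y"
      using affine_interpolation[OF vI(2), of A "\<lambda>u. of_bool (u \<noteq> v)"] by blast
    then show "?h A" by (intro exI[of _ h] conjI ballI allI)
  qed
  then obtain \<mu> where "\<forall>A\<in>I. continuous_on UNIV (\<mu> A) \<and> (\<forall>u\<in>A. \<mu> A u = of_bool (u \<noteq> v)) \<and>
      (\<forall>x y s. \<mu> A ((1 - s) *\<^sub>R x + s *\<^sub>R y) = (1 - s) * \<mu> A x + s * (\<mu> A y :: real))"
    by (rule bchoice[THEN exE])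
  then have \<mu>: "continuous_on UNIV (\<mu> A)" "\<And>u. u \<in> A \<Longrightarrow> \<mu> A u = of_bool (u \<noteq> v)"
     "\<And>x y s. \<mu> A ((1 - s) *\<^sub>R x + s *\<^sub>R y) = (1 - s) * \<mu> A x + s * \<mu> A y" if "A \<in> I" for A
    using that by auto
  \<comment> \<open>\<open>\<nu> A\<close> interpolates the potential of c inside A that is
    normalized at a chosen base vertex.\<close>
  have "\<forall>A\<in>I. \<exists>h. continuous_on UNIV h \<and> (\<forall>u\<in>A. h u = (if u = v then 0 else of_int (c0 (base A) u))) \<and>
      (\<forall>x y s. h ((1 - s) *\<^sub>R x + s *\<^sub>R y) = (1 - s) * h x + s * (h y :: real))" (is "\<forall>A\<in>I. ?h A")
  proof
    fix A assume "A \<in> I"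
    then obtain h where "continuous_on UNIV h" "\<And>u. u \<in> A \<Longrightarrow> h u = (if u = v then 0 else of_int (c0 (base A) u) :: real)"
      "\<And>x y s. h ((1 - s) *\<^sub>R x + s *\<^sub>R y) = (1 - s) * h x + s * h y"
      using affine_interpolation[OF vI(2), of A "\<lambda>u. if u = v then 0 else of_int (c0 (base A) u)"] by blast
    then show "?h A" by (intro exI[of _ h] conjI ballI allI)
  qed
  then obtain \<nu> where "\<forall>A\<in>I. continuous_on UNIV (\<nu> A) \<and> (\<forall>u\<in>A. \<nu> A u = (if u = v then 0 else of_int (c0 (base A) u))) \<and>
      (\<forall>x y s. \<nu> A ((1 - s) *\<^sub>R x + s *\<^sub>R y) = (1 - s) * \<nu> A x + s * (\<nu> A y :: real))"
    by (rule bchoice[THEN exE])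
  then have \<nu>: "continuous_on UNIV (\<nu> A)" "\<And>u. u \<in> A \<Longrightarrow> \<nu> A u = (if u = v then 0 else of_int (c0 (base A) u))"
     "\<And>x y s. \<nu> A ((1 - s) *\<^sub>R x + s *\<^sub>R y) = (1 - s) * \<nu> A x + s * \<nu> A y" if "A \<in> I" for A
    using that by auto
  have \<mu>_nonzero: "\<mu> A x \<noteq> 0" if A: "A \<in> I" and x: "x \<in> convex hull A" "x \<noteq> v" for A x
  proof -
    have ne: "A - {v} \<noteq> {}" using base[OF A] by blast
    have "x \<in> convex hull (insert v (A - {v}))" using x(1) vI(1)[OF A] by (simp add: insert_absorb)
    then obtain p s y where y: "p + s = 1" "y \<in> convex hull (A - {v})" "x = p *\<^sub>R v + s *\<^sub>R y"
      unfolding convex_hull_insert[OF ne] by blast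
    have p: "p = 1 - s" using y(1) by simp
    have "\<mu> A y = 1"
      by (rule affine_eq_on_hull[OF \<mu>(3)[OF A] _ _ y(2), of "\<lambda>_. 1"]) (auto simp: \<mu>(2)[OF A])
    then have "\<mu> A x = s" using \<mu>(3)[OF A, of s v y] \<mu>(2)[OF A vI(1)[OF A]] y(3) p by simp
    moreover have "s \<noteq> 0" using y(3) p x(2) by auto
    ultimately show ?thesis by simp
  qed
  obtain g where g: "continuous_on N g" "\<And>A x. A \<in> I \<Longrightarrow> x \<in> convex hull A \<Longrightarrow> x \<in> N \<Longrightarrow> g x = cis (2 * pi * (\<nu> A x / \<mu> A x))"
  proof (rule paste[OF I, of N "\<lambda>A x. cis (2 * pi * (\<nu> A x / \<mu> A x))"])
    show "N \<subseteq> \<Union>((hull) convex ` I)" using N(5) by (simp add: I_def)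
  next
    fix A assume A: "A \<in> I"
    have nz: "\<forall>x\<in>convex hull A \<inter> N. \<mu> A x \<noteq> 0" using \<mu>_nonzero[OF A] N(3) by blast
    have "continuous_on (convex hull A \<inter> N) (\<mu> A)" "continuous_on (convex hull A \<inter> N) (\<nu> A)"
      using \<mu>(1)[OF A] \<nu>(1)[OF A] continuous_on_subset by blast+
    then show "continuous_on (convex hull A \<inter> N) (\<lambda>x. cis (2 * pi * (\<nu> A x / \<mu> A x)))"
      using nz by (intro continuous_intros) auto
  next
    fix A B x assume A: "A \<in> I" and B: "B \<in> I" and x: "x \<in> convex hull (A \<inter> B)" "x \<in> N"
    have xv: "x \<noteq> v" using x(2) N(3) by blast
    then obtain w where w: "w \<in> A" "w \<in> B" "w \<noteq> v" using hull_inter_vertex[OF x(1)] by blast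
    \<comment> \<open>On a common face the two potentials differ by an integer constant, since they
      have different base vertices; the map to the circle does not see it.\<close>
    define m where "m = c0 (base A) w - c0 (base B) w"
    have "x \<in> convex hull A" using x(1) hull_mono[of "A \<inter> B" A] by blast
    then have nz: "\<mu> A x \<noteq> 0" using \<mu>_nonzero[OF A _ xv] by blast
    have 1: "\<mu> A x = \<mu> B x"
      by (rule affine_eq_on_hull[OF \<mu>(3)[OF A] \<mu>(3)[OF B] _ x(1)]) (simp add: \<mu>(2)[OF A] \<mu>(2)[OF B])
    have 2: "\<nu> A x = \<nu> B x + of_int m * \<mu> A x"
    proof (rule affine_eq_on_hull[OF \<nu>(3)[OF A] _ _ x(1), of "\<lambda>x. \<nu> B x + of_int m * \<mu> A x"])
      show "\<nu> B ((1 - s) *\<^sub>R x + s *\<^sub>R y) + of_int m * \<mu> A ((1 - s) *\<^sub>R x + s *\<^sub>R y) =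
          (1 - s) * (\<nu> B x + of_int m * \<mu> A x) + s * (\<nu> B y + of_int m * \<mu> A y)" for x y s
        unfolding \<mu>(3)[OF A] \<nu>(3)[OF B] by (simp add: algebra_simps)
      fix u assume u: "u \<in> A \<inter> B"
      show "\<nu> A u = \<nu> B u + of_int m * \<mu> A u"
      proof (cases "u = v")
        case False
        have "c0 (base A) u = c0 (base A) w + c0 w u" "c0 (base B) u = c0 (base B) w + c0 w u"
          using c0_add[OF A base[OF A], of u w] c0_add[OF B base[OF B], of u w] u w False by auto
        then have "c0 (base A) u = c0 (base B) u + m" by (simp add: m_def)
        then show ?thesis using u False \<mu>(2)[OF A, of u] \<nu>(2)[OF A, of u] \<nu>(2)[OF B, of u] by simp
      qed (use u \<mu>(2)[OF A, of u] \<nu>(2)[OF A, of u] \<nu>(2)[OF B, of u] in simp)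
    qed
    have "2 * pi * (\<nu> A x / \<mu> A x) = 2 * pi * (\<nu> B x / \<mu> B x) + 2 * pi * of_int m"
      using 1 2 nz by (simp add: field_simps)
    then have "cis (2 * pi * (\<nu> A x / \<mu> A x)) = cis (2 * pi * (\<nu> B x / \<mu> B x)) * cis (2 * pi * of_int m)"
      by (simp only: cis_mult)
    then show "cis (2 * pi * (\<nu> A x / \<mu> A x)) = cis (2 * pi * (\<nu> B x / \<mu> B x))"
      using cis_multiple_2pi[of "of_int m"] by simp
  next
    fix g assume "continuous_on N g" "\<And>A x. A \<in> I \<Longrightarrow> x \<in> convex hull A \<Longrightarrow> x \<in> N \<Longrightarrow> g x = cis (2 * pi * (\<nu> A x / \<mu> A x))"
    then show thesis by (rule that)
  qed
  have "g x \<noteq> 0" if x: "x \<in> N" for x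
  proof -
    obtain A where "A \<in> I" "x \<in> convex hull A" using N(5) x by (auto simp: I_def)
    then show ?thesis using g(2) x by simp
  qed
  then have "g \<in> N \<rightarrow> - {0}" by auto
  then obtain G where G: "continuous_on N G" "\<And>x. x \<in> N \<Longrightarrow> g x = exp (G x)"
    using N(4) g(1) unfolding Borsukian_continuous_logarithm by blast
  have "finite (\<Union>(vertex_sets K))" using finite_vs vs_finite by blast
  \<comment> \<open>The same t for all vertices, so that \<open>\<mu> A\<close> is constant along
    the segment joining \<open>y u\<close> to \<open>y w\<close>.\<close>
  then obtain t where t: "0 < t" "t < 1" "\<And>u. u \<in> \<Union>(vertex_sets K) \<Longrightarrow> v + t *\<^sub>R (u - v) \<in> ball v \<delta>"
    using small_scale[OF N(1), of "\<Union>(vertex_sets K)" v] by blast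
  define y where "y u = v + t *\<^sub>R (u - v)" for u
  have y_eq: "y u = (1 - t) *\<^sub>R v + t *\<^sub>R u" for u by (simp add: y_def algebra_simps)
  \<comment> \<open>At \<open>y u\<close> the quotient of \<nu> by \<mu> is an integer, so the
    logarithm there is an integral multiple of the period: this gives an integral potential.\<close>
  define \<beta> where "\<beta> u = Im (G (y u)) / (2 * pi)" for u
  have edge: "\<beta> u \<in> \<int> \<and> \<beta> w - \<beta> u = of_int (c u w)" if uw: "{v, u, w} \<in> vertex_sets K" "distinct [v, u, w]" for u w
  proof -
    obtain A where A': "A \<in> vertex_sets K" "{v, u, w} \<subseteq> A" "card A = 4" using pure3[OF chart uw(1)] by blast
    then have A: "A \<in> I" by (simp add: I_def)
    define a where "a = base A"
    have a: "a \<in> A - {v}" using base[OF A] by (simp add: a_def)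
    define z where "z s = (1 - s) *\<^sub>R y u + s *\<^sub>R y w" for s
    have hull: "v \<in> convex hull A" "u \<in> convex hull A" "w \<in> convex hull A" using A' by (auto intro: hull_inc)
    have yh: "y u \<in> convex hull A" "y w \<in> convex hull A"
      unfolding y_eq using hull t convexD[OF convex_convex_hull, of v A _ "1 - t" t] by auto
    have yb: "y u \<in> ball v \<delta>" "y w \<in> ball v \<delta>" unfolding y_def using t(3) uw(1) by blast+
    have \<mu>y: "\<mu> A (y u) = t" "\<mu> A (y w) = t"
      unfolding y_eq \<mu>(3)[OF A] using \<mu>(2)[OF A] A' uw(2) by auto
    have \<nu>y: "\<nu> A (y u) = t * of_int (c0 a u)" "\<nu> A (y w) = t * of_int (c0 a w)"
      unfolding y_eq \<nu>(3)[OF A] using \<nu>(2)[OF A] A' uw(2) by (auto simp: a_def)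
    have c0: "c0 a w = c0 a u + c u w"
      using c0_add[OF A a, of w u] A' uw(2) by (auto simp: c0_def)
    have \<mu>z: "\<mu> A (z s) = t" for s unfolding z_def \<mu>(3)[OF A] \<mu>y by (simp add: algebra_simps)
    have \<nu>z: "\<nu> A (z s) = t * (of_int (c0 a u) + s * of_int (c u w))" for s
      unfolding z_def \<nu>(3)[OF A] \<nu>y c0 by (simp add: algebra_simps)
    have zh: "z s \<in> convex hull A" "z s \<in> N" if s: "s \<in> {0..1}" for s
    proof -
      show h: "z s \<in> convex hull A"
        unfolding z_def using yh s convexD[OF convex_convex_hull, of "y u" A "y w" "1 - s" s] by auto
      have "z s \<in> ball v \<delta>"
        unfolding z_def using yb s convexD[OF convex_ball, of "y u" v \<delta> "y w" "1 - s" s] by auto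
      moreover have "z s \<in> \<Union>K" using h A' by (auto simp: vertex_sets_def)
      moreover have "z s \<noteq> v" using \<mu>z[of s] \<mu>(2)[OF A vI(1)[OF A]] t(1) by auto
      ultimately show "z s \<in> N" using N(2) by blast
    qed
    \<comment> \<open>The quotient of \<nu> by \<mu> grows along the segment with slope c u w.
      Subtracting this growth from the logarithm leaves a continuous function with integer values,
      which is constant.\<close>
    define \<psi> where "\<psi> s = Im (G (z s)) / (2 * pi) - s * of_int (c u w)" for s
    have int: "\<psi> s \<in> \<int>" if s: "s \<in> {0..1}" for s
    proof -
      have "exp (G (z s)) = cis (2 * pi * (of_int (c0 a u) + s * of_int (c u w)))"
        using G(2)[OF zh(2)[OF s]] g(2)[OF A zh(1)[OF s] zh(2)[OF s]] \<mu>z[of s] \<nu>z[of s] t(1) by simp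
      then have "exp (G (z s)) = exp (\<i> * of_real (2 * pi * (of_int (c0 a u) + s * of_int (c u w))))"
        by (simp only: cis_conv_exp)
      then obtain n :: int where n: "G (z s) = \<i> * of_real (2 * pi * (of_int (c0 a u) + s * of_int (c u w))) + (of_int (2 * n) * pi) * \<i>"
        unfolding exp_eq by blast
      have "Im (G (z s)) = 2 * pi * (of_int (c0 a u) + s * of_int (c u w)) + of_int (2 * n) * pi"
        unfolding n by simp
      then have "\<psi> s = of_int (c0 a u + n)" by (simp add: \<psi>_def field_simps)
      then show ?thesis by simp
    qed
    have "continuous_on {0..1} z" unfolding z_def by (intro continuous_intros)
    then have "continuous_on {0..1} (\<lambda>s. G (z s))"
      by (rule continuous_on_compose2[OF G(1)]) (use zh in auto)
    then have cont: "continuous_on {0..1} \<psi>" unfolding \<psi>_def by (intro continuous_intros) auto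
    have "\<psi> constant_on {0..1}"
    proof (rule continuous_discrete_range_constant[OF _ cont])
      show "connected {0..1::real}" by simp
      fix x :: real assume x: "x \<in> {0..1}"
      have "1 \<le> norm (\<psi> y - \<psi> x)" if y: "y \<in> {0..1}" "\<psi> y \<noteq> \<psi> x" for y
      proof -
        obtain i j where "\<psi> y = of_int i" "\<psi> x = of_int j" using int[OF y(1)] int[OF x] by (auto elim!: Ints_cases)
        then show ?thesis using y(2) by simp
      qed
      then show "\<exists>e>0. \<forall>y. y \<in> {0..1} \<and> \<psi> y \<noteq> \<psi> x \<longrightarrow> e \<le> norm (\<psi> y - \<psi> x)"
        by (intro exI[of _ 1]) auto
    qed
    then have "\<psi> 0 = \<psi> 1" unfolding constant_on_def by (metis atLeastAtMost_iff order_refl zero_le_one)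
    moreover have "\<psi> 0 = \<beta> u" "\<psi> 1 = \<beta> w - of_int (c u w)" by (simp_all add: \<psi>_def \<beta>_def z_def)
    ultimately show ?thesis using int[of 0] by simp
  qed
  show ?thesis
  proof (intro exI[of _ "\<lambda>u. \<lfloor>\<beta> u\<rfloor>"] allI impI)
    fix u w assume "{v, u, w} \<in> vertex_sets K \<and> distinct [v, u, w]"
    then have "\<beta> u \<in> \<int>" "\<beta> w = \<beta> u + of_int (c u w)" using edge[of u w] by auto
    then show "c u w = \<lfloor>\<beta> w\<rfloor> - \<lfloor>\<beta> u\<rfloor>" by simp
  qed
qed

end

section \<open>Comparison of the two state sums\<close>

lemma rev_cyclic_step:
  assumes "i < length l"
  shows "\<exists>j<length l. rev l ! ((i + 1) mod length l) = l ! j \<and> rev l ! i = l ! ((j + 1) mod length l)"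
proof -
  let ?n = "length l"
  have n: "(i + 1) mod ?n < ?n" using assms by (intro mod_less_divisor) auto
  define j where "j = ?n - Suc ((i + 1) mod ?n)"
  have "j < ?n" using assms by (auto simp: j_def)
  moreover have "rev l ! ((i + 1) mod ?n) = l ! j" using n by (simp add: rev_nth j_def)
  moreover have "(j + 1) mod ?n = ?n - Suc i"
  proof (cases "i + 1 = ?n")
    case True
    then have "j + 1 = ?n" using assms by (simp add: j_def)
    then show ?thesis using True by simp
  qed (use assms in \<open>simp add: j_def\<close>)
  then have "rev l ! i = l ! ((j + 1) mod ?n)" using assms by (simp add: rev_nth)
  ultimately show ?thesis by blast
qed

section \<open>A triangulated manifold as an oriented complex\<close>

locale triangulated_manifold = closed_K K for K :: "'v::euclidean_space set set" +
  fixes pos :: "'v \<Rightarrow> 'v \<Rightarrow> 'v \<Rightarrow> 'v \<Rightarrow> bool" and num :: "'v \<Rightarrow> nat"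
    and ori :: "'v set \<Rightarrow> 'v \<times> 'v \<times> 'v" and dir :: "'v set \<Rightarrow> 'v \<times> 'v" and link :: "'v set \<Rightarrow> 'v list"
  assumes orient: "orientation K pos"
    and num_vertices: "inj_on num (vertices K)"
    and choices: "lattice_choices K pos ori dir link"
begin

text \<open>The given list is clockwise only for the direction chosen by \<open>dir\<close>; seen
  along the opposite direction it runs backwards.\<close>

definition lnk :: "'v \<Rightarrow> 'v \<Rightarrow> 'v list"
  where "lnk p q = (if dir (convex hull {p, q}) = (p, q) then link (convex hull {p, q})
    else rev (link (convex hull {p, q})))"

lemma hull_inj: "A \<in> vertex_sets K \<Longrightarrow> B \<in> vertex_sets K \<Longrightarrow> convex hull A = convex hull B \<Longrightarrow> A = B"
  by (auto simp: vertex_sets_def convex_hull_eq_independent)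

lemma hull2: "convex hull {p, q} \<in> simplices 1 K \<longleftrightarrow> {p, q} \<in> vertex_sets K \<and> p \<noteq> q"
  using hull_in_simplices[of "{p, q}" 1] by (cases "p = q") auto

lemma hull3: "convex hull {p, q, r} \<in> simplices 2 K \<longleftrightarrow> {p, q, r} \<in> vertex_sets K \<and> card {p, q, r} = 3"
  using hull_in_simplices[of "{p, q, r}" 2] card_insert_le_m1[of 3 "{q, r}" p] card_insert_le_m1[of 2 "{r}" q]
  by simp

lemma hull4: "convex hull {p, q, r, s} \<in> simplices 3 K \<longleftrightarrow> {p, q, r, s} \<in> vertex_sets K \<and> card {p, q, r, s} = 4"
  using hull_in_simplices[of "{p, q, r, s}" 3] card_insert_le_m1[of 4 "{q, r, s}" p]
    card_insert_le_m1[of 3 "{r, s}" q] card_insert_le_m1[of 2 "{s}" r]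
  by simp

lemma dir_cases:
  assumes "{p, q} \<in> vertex_sets K" "p \<noteq> q"
  shows "dir (convex hull {p, q}) = (p, q) \<or> dir (convex hull {p, q}) = (q, p)"
proof -
  obtain x y where xy: "dir (convex hull {p, q}) = (x, y)" by (cases "dir (convex hull {p, q})")
  have E: "convex hull {p, q} \<in> simplices 1 K" using hull2 assms by blast
  then have h: "convex hull {p, q} = convex hull {x, y}"
    using choices xy unfolding lattice_choices_def by fastforce
  then have "{x, y} \<in> vertex_sets K" using E hull2[of x y] by simp
  then have "{p, q} = {x, y}" using hull_inj assms h by blast
  then show ?thesis using xy by (auto simp: doubleton_eq_iff)
qed

lemma link_of_dir:
  assumes "{p, q} \<in> vertex_sets K" "p \<noteq> q" "dir (convex hull {p, q}) = (x, y)"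
  shows "distinct (link (convex hull {p, q}))"
    "set (link (convex hull {p, q})) = {r. {x, y, r} \<in> vertex_sets K \<and> card {x, y, r} = 3}"
    "\<And>i. i < length (link (convex hull {p, q})) \<Longrightarrow>
       {x, y, link (convex hull {p, q}) ! i, link (convex hull {p, q}) ! ((i + 1) mod length (link (convex hull {p, q})))} \<in> vertex_sets K \<and>
       card {x, y, link (convex hull {p, q}) ! i, link (convex hull {p, q}) ! ((i + 1) mod length (link (convex hull {p, q})))} = 4 \<and>
       pos x y (link (convex hull {p, q}) ! i) (link (convex hull {p, q}) ! ((i + 1) mod length (link (convex hull {p, q}))))"
proof -
  have E: "convex hull {p, q} \<in> simplices 1 K" using hull2 assms by blast
  have *: "case dir (convex hull {p, q}) of (x, y) \<Rightarrow> convex hull {p, q} = convex hull {x, y} \<and>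
       distinct (link (convex hull {p, q})) \<and>
       set (link (convex hull {p, q})) = {r. convex hull {x, y, r} \<in> simplices 2 K} \<and>
       (\<forall>i<length (link (convex hull {p, q})).
          let r = link (convex hull {p, q}) ! i; s = link (convex hull {p, q}) ! ((i + 1) mod length (link (convex hull {p, q})))
          in convex hull {x, y, r, s} \<in> simplices 3 K \<and> pos x y r s)"
    by (rule bspec[OF choices[unfolded lattice_choices_def, THEN conjunct2] E])
  show "distinct (link (convex hull {p, q}))"
    "set (link (convex hull {p, q})) = {r. {x, y, r} \<in> vertex_sets K \<and> card {x, y, r} = 3}"
    using * assms(3) hull3 by auto
  show "{x, y, link (convex hull {p, q}) ! i, link (convex hull {p, q}) ! ((i + 1) mod length (link (convex hull {p, q})))} \<in> vertex_sets K \<and>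
       card {x, y, link (convex hull {p, q}) ! i, link (convex hull {p, q}) ! ((i + 1) mod length (link (convex hull {p, q})))} = 4 \<and>
       pos x y (link (convex hull {p, q}) ! i) (link (convex hull {p, q}) ! ((i + 1) mod length (link (convex hull {p, q}))))"
    if "i < length (link (convex hull {p, q}))" for i
    using *[unfolded assms(3) prod.case Let_def hull4, THEN conjunct2, THEN conjunct2, THEN conjunct2] that by blast
qed

lemma pos_swaps:
  assumes "{a, b, c, d} \<in> vertex_sets K" "card {a, b, c, d} = 4"
  shows "pos b a c d \<longleftrightarrow> \<not> pos a b c d" "pos a c b d \<longleftrightarrow> \<not> pos a b c d" "pos a b d c \<longleftrightarrow> \<not> pos a b c d"
proof -
  have "convex hull {a, b, c, d} \<in> simplices 3 K" using hull4 assms by blast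
  then show "pos b a c d \<longleftrightarrow> \<not> pos a b c d" "pos a c b d \<longleftrightarrow> \<not> pos a b c d" "pos a b d c \<longleftrightarrow> \<not> pos a b c d"
    using orient unfolding orientation_def by blast+
qed

sublocale oriented_complex "vertex_sets K" num pos lnk
proof
  show "finite (vertex_sets K)" by (rule finite_vs)
  show "finite A" if "A \<in> vertex_sets K" for A using that by (rule vs_finite)
  show "B \<in> vertex_sets K" if "A \<in> vertex_sets K" "B \<subseteq> A" "B \<noteq> {}" for A B using that by (rule vs_closed)
  show "inj_on num (\<Union>(vertex_sets K))"
    by (rule inj_on_subset[OF num_vertices]) (use vertex_mem vertex_iff in \<open>auto simp: vertices_def\<close>)
  show "\<exists>B\<in>vertex_sets K. A \<subseteq> B \<and> card B = 4" if "A \<in> vertex_sets K" for A using pure3[OF chart that] .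
  fix a b c d assume t: "{a, b, c, d} \<in> vertex_sets K" "card {a, b, c, d} = 4"
  show "(pos b a c d \<longleftrightarrow> \<not> pos a b c d) \<and> (pos a c b d \<longleftrightarrow> \<not> pos a b c d) \<and> (pos a b d c \<longleftrightarrow> \<not> pos a b c d)"
    using pos_swaps[OF t] by blast
  show "pos a b c e \<longleftrightarrow> \<not> pos a b c d" if "{a, b, c, e} \<in> vertex_sets K" "card {a, b, c, e} = 4" "d \<noteq> e" for e
  proof -
    have "convex hull {a, b, c, d} \<in> simplices 3 K" "convex hull {a, b, c, e} \<in> simplices 3 K"
      using hull4 t that by blast+
    then show ?thesis using orient that(3) unfolding orientation_def by blast
  qed
next
  fix p q assume pq: "{p, q} \<in> vertex_sets K" "p \<noteq> q"
  let ?l = "link (convex hull {p, q})"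
  show "distinct (lnk p q)"
    using link_of_dir(1)[OF pq] dir_cases[OF pq] by (auto simp: lnk_def)
  show "set (lnk p q) = {r. {p, q, r} \<in> vertex_sets K \<and> card {p, q, r} = 3}"
  proof -
    have "{r. {q, p, r} \<in> vertex_sets K \<and> card {q, p, r} = 3} = {r. {p, q, r} \<in> vertex_sets K \<and> card {p, q, r} = 3}"
      by (simp add: insert_commute)
    then show ?thesis using link_of_dir(2)[OF pq] dir_cases[OF pq] by (auto simp: lnk_def)
  qed
  fix i assume i: "i < length (lnk p q)"
  consider "dir (convex hull {p, q}) = (p, q)" | "dir (convex hull {p, q}) = (q, p)" using dir_cases[OF pq] by blast
  then show "{p, q, lnk p q ! i, lnk p q ! ((i + 1) mod length (lnk p q))} \<in> vertex_sets K \<and>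
       card {p, q, lnk p q ! i, lnk p q ! ((i + 1) mod length (lnk p q))} = 4 \<and>
       pos p q (lnk p q ! i) (lnk p q ! ((i + 1) mod length (lnk p q)))"
  proof cases
    case 1
    then have "lnk p q = ?l" by (simp add: lnk_def)
    then show ?thesis using link_of_dir(3)[OF pq 1] i by (simp only:)
  next
    case 2
    then have l: "lnk p q = rev ?l" using pq(2) by (simp add: lnk_def)
    then have "i < length ?l" using i by simp
    then obtain j where j: "j < length ?l" "rev ?l ! ((i + 1) mod length ?l) = ?l ! j" "rev ?l ! i = ?l ! ((j + 1) mod length ?l)"
      using rev_cyclic_step by blast
    define r where "r = ?l ! ((j + 1) mod length ?l)"
    define s where "s = ?l ! j"
    have t: "{q, p, s, r} \<in> vertex_sets K" "card {q, p, s, r} = 4" "pos q p s r"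
      using link_of_dir(3)[OF pq 2 j(1)] unfolding r_def s_def by blast+
    have eq: "{p, q, r, s} = {q, p, s, r}" by blast
    then have t': "{p, q, r, s} \<in> vertex_sets K" "card {p, q, r, s} = 4" using t by simp_all
    have eq2: "{p, q, s, r} = {q, p, s, r}" by blast
    have "pos p q r s" using pos_swaps(1)[OF t(1,2)] pos_swaps(3)[OF t'] t(3) by blast
    then show ?thesis using t' j l by (simp only: length_rev r_def s_def)
  qed
qed

lemma vertex_links: "{v} \<in> vertex_sets K \<Longrightarrow> vertex_link (vertex_sets K) num pos lnk v"
proof
  assume v: "{v} \<in> vertex_sets K"
  show "{v} \<in> vertex_sets K" by (rule v)
  show "P u \<longleftrightarrow> P w" if "\<And>u w. tri v u w \<Longrightarrow> P u \<longleftrightarrow> P w" "edg v u" "edg v w" for P u w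
    by (rule link_connected[OF v, of P]) (use that in \<open>simp_all add: tri_def edg_def\<close>)
  show "\<exists>b. \<forall>u w. tri v u w \<longrightarrow> c u w = b w - b u"
    if "\<And>u w. tri v u w \<Longrightarrow> c w u = - c u w" "\<And>x y z. tet v x y z \<Longrightarrow> c x y + c y z + c z x = 0"
    for c :: "'v \<Rightarrow> 'v \<Rightarrow> int"
    using link_exact[OF v, of c] that unfolding tri_def tet_def by blast
qed

section \<open>Simplices and flags in decreasing vertex order\<close>

lemma bij_simplices1: "bij_betw (\<lambda>(p, q). convex hull {p, q}) T2 (simplices 1 K)"
proof (rule bij_betw_imageI)
  show "inj_on (\<lambda>(p, q). convex hull {p, q}) T2"
  proof (rule inj_onI)
    fix x y assume xy: "x \<in> T2" "y \<in> T2" "(\<lambda>(p, q). convex hull {p, q}) x = (\<lambda>(p, q). convex hull {p, q}) y"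
    obtain p q where x: "x = (p, q)" by (cases x)
    obtain p' q' where y: "y = (p', q')" by (cases y)
    have e: "edg p q" "num p > num q" "edg p' q'" "num p' > num q'" using xy x y by (auto simp: T2_def)
    have "convex hull {p, q} = convex hull {p', q'}" using xy(3) x y by simp
    then have "{p, q} = {p', q'}" using hull_inj[of "{p, q}" "{p', q'}"] e by (simp add: edg_def)
    then show "x = y" using x y e by (auto simp: doubleton_eq_iff)
  qed
  show "(\<lambda>(p, q). convex hull {p, q}) ` T2 = simplices 1 K"
  proof (intro equalityI subsetI)
    fix E assume "E \<in> simplices 1 K"
    then obtain A where A: "A \<in> vertex_sets K" "card A = 2" "E = convex hull A" by (auto simp: simplices_eq)
    then obtain a b where "A = {a, b}" "num a > num b" using sorted2[OF A(1) subset_refl] by blast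
    then show "E \<in> (\<lambda>(p, q). convex hull {p, q}) ` T2" using A
      by (intro image_eqI[of _ _ "(a, b)"]) (auto simp: T2_def edg_def)
  next
    fix E assume "E \<in> (\<lambda>(p, q). convex hull {p, q}) ` T2"
    then show "E \<in> simplices 1 K" using hull2 by (force simp: T2_def edg_def)
  qed
qed

lemma bij_simplices2: "bij_betw (\<lambda>(p, q, r). convex hull {p, q, r}) T3 (simplices 2 K)"
proof (rule bij_betw_imageI)
  show "inj_on (\<lambda>(p, q, r). convex hull {p, q, r}) T3"
  proof (rule inj_onI)
    fix x y assume xy: "x \<in> T3" "y \<in> T3" "(\<lambda>(p, q, r). convex hull {p, q, r}) x = (\<lambda>(p, q, r). convex hull {p, q, r}) y"
    obtain p q r where x: "x = (p, q, r)" by (cases x)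
    obtain p' q' r' where y: "y = (p', q', r')" by (cases y)
    have e: "tri p q r" "num p > num q" "num q > num r" "tri p' q' r'" "num p' > num q'" "num q' > num r'"
      using xy x y by (auto simp: T3_def)
    have "convex hull {p, q, r} = convex hull {p', q', r'}" using xy(3) x y by simp
    then have "{p, q, r} = {p', q', r'}" using hull_inj[of "{p, q, r}" "{p', q', r'}"] e by (simp add: tri_def)
    then have "p = p' \<or> p = q' \<or> p = r'" "q = p' \<or> q = q' \<or> q = r'" "r = p' \<or> r = q' \<or> r = r'"
      "p' = p \<or> p' = q \<or> p' = r" by blast+
    then show "x = y" using e x y by auto
  qed
  show "(\<lambda>(p, q, r). convex hull {p, q, r}) ` T3 = simplices 2 K"
  proof (intro equalityI subsetI)
    fix F assume "F \<in> simplices 2 K"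
    then obtain A where A: "A \<in> vertex_sets K" "card A = 3" "F = convex hull A" by (auto simp: simplices_eq)
    then obtain a b c where abc: "A = {a, b, c}" "num a > num b" "num b > num c" using sorted3[OF A(1) subset_refl] by blast
    then have "tri a b c" using A by (auto simp: tri_def)
    then show "F \<in> (\<lambda>(p, q, r). convex hull {p, q, r}) ` T3" using A abc
      by (intro image_eqI[of _ _ "(a, b, c)"]) (auto simp: T3_def)
  next
    fix F assume "F \<in> (\<lambda>(p, q, r). convex hull {p, q, r}) ` T3"
    then obtain p q r where F: "F = convex hull {p, q, r}" "tri p q r" by (auto simp: T3_def)
    then show "F \<in> simplices 2 K" using hull3[of p q r] card3[of p q r] by (simp add: tri_def)
  qed
qed

lemma bij_simplices3: "bij_betw (\<lambda>(p, q, r, s). convex hull {p, q, r, s}) T4 (simplices 3 K)"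
proof (rule bij_betw_imageI)
  show "inj_on (\<lambda>(p, q, r, s). convex hull {p, q, r, s}) T4"
  proof (rule inj_onI)
    fix x y assume xy: "x \<in> T4" "y \<in> T4" "(\<lambda>(p, q, r, s). convex hull {p, q, r, s}) x = (\<lambda>(p, q, r, s). convex hull {p, q, r, s}) y"
    obtain p q r s where x: "x = (p, q, r, s)" by (cases x)
    obtain p' q' r' s' where y: "y = (p', q', r', s')" by (cases y)
    have "convex hull {p, q, r, s} = convex hull {p', q', r', s'}" using xy(3) x y by simp
    then have "{p, q, r, s} = {p', q', r', s'}"
      using hull_inj[of "{p, q, r, s}" "{p', q', r', s'}"] xy(1,2) x y by (simp add: T4_def tet_def)
    then show "x = y" using sorted4_unique[of p q r s p' q' r' s'] xy x y by simp
  qed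
  show "(\<lambda>(p, q, r, s). convex hull {p, q, r, s}) ` T4 = simplices 3 K"
  proof (intro equalityI subsetI)
    fix F assume "F \<in> simplices 3 K"
    then obtain A where A: "A \<in> vertex_sets K" "card A = 4" "F = convex hull A" by (auto simp: simplices_eq)
    then obtain a b c d where "(a, b, c, d) \<in> T4" "A = {a, b, c, d}" using sorted4[OF A(1)] by blast
    then show "F \<in> (\<lambda>(p, q, r, s). convex hull {p, q, r, s}) ` T4" using A
      by (intro image_eqI[of _ _ "(a, b, c, d)"]) auto
  next
    fix F assume "F \<in> (\<lambda>(p, q, r, s). convex hull {p, q, r, s}) ` T4"
    then obtain p q r s where F: "F = convex hull {p, q, r, s}" "tet p q r s" by (auto simp: T4_def)
    then show "F \<in> simplices 3 K" using hull4[of p q r s] card4[of p q r s] by (simp add: tet_def)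
  qed
qed

lemma tetrahedra_eq: "tetrahedra K num = T4"
proof -
  have "convex hull {a, b, c, d} \<in> simplices 3 K \<longleftrightarrow> tet a b c d" for a b c d
    by (simp only: hull4 card4 tet_def)
  then show ?thesis by (simp add: tetrahedra_def T4_def)
qed

lemma euler: "int (card (simplices 0 K)) - int (card (simplices 1 K)) + int (card (simplices 2 K)) - int (card (simplices 3 K)) = 0"
proof -
  have "bij_betw (\<lambda>v. {v}) {v. {v} \<in> vertex_sets K} {A \<in> vertex_sets K. card A = Suc 0}"
    by (rule bij_betw_imageI) (auto simp: inj_on_def card_1_singleton_iff)
  then have "card (simplices 0 K) = card {v. {v} \<in> vertex_sets K}"
    by (simp add: card_simplices bij_betw_same_card)
  moreover have "card (simplices 1 K) = card T2" "card (simplices 2 K) = card T3" "card (simplices 3 K) = card T4"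
    using bij_simplices1 bij_simplices2 bij_simplices3 by (auto dest: bij_betw_same_card)
  ultimately show ?thesis using euler_characteristic[OF vertex_links] by simp
qed

definition fl :: "'v \<times> 'v \<times> 'v \<Rightarrow> 'v set \<times> 'v set"
  where "fl = (\<lambda>(p, q, r). (convex hull {p, q}, convex hull {p, q, r}))"

lemma bij_fl: "bij_betw fl FL (flags K)"
proof (rule bij_betw_imageI)
  show "inj_on fl FL"
  proof (rule inj_onI)
    fix f f' assume f: "f \<in> FL" and f': "f' \<in> FL" and eq: "fl f = fl f'"
    obtain p q r where pqr: "f = (p, q, r)" by (cases f)
    obtain p' q' r' where pqr': "f' = (p', q', r')" by (cases f')
    have e: "tri p q r" "num p > num q" "tri p' q' r'" "num p' > num q'" using f f' pqr pqr' by (auto simp: FL_def)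
    have "convex hull {p, q} = convex hull {p', q'}" "convex hull {p, q, r} = convex hull {p', q', r'}"
      using eq pqr pqr' by (simp_all add: fl_def)
    then have "{p, q} = {p', q'}" "{p, q, r} = {p', q', r'}"
      using hull_inj e tri_edg[OF e(1)] tri_edg[OF e(3)] by (auto simp: edg_def tri_def)
    moreover from this(1) have "p = p' \<and> q = q'" using e by (auto simp: doubleton_eq_iff)
    moreover have "r \<in> {p', q', r'}" using calculation(2) by blast
    ultimately show "f = f'" using e(1) pqr pqr' by (auto simp: tri_def)
  qed
  show "fl ` FL = flags K"
  proof (intro equalityI subsetI)
    fix x assume "x \<in> fl ` FL"
    then obtain p q r where x: "x = fl (p, q, r)" "tri p q r" by (auto simp: FL_def)
    then have "convex hull {p, q} \<in> simplices 1 K" "convex hull {p, q, r} \<in> simplices 2 K"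
      using hull2[of p q] hull3[of p q r] card3[of p q r] tri_edg[OF x(2)] by (simp_all add: edg_def tri_def)
    moreover have "convex hull {p, q} \<subseteq> convex hull {p, q, r}" by (intro hull_mono) blast
    ultimately show "x \<in> flags K" using x(1) by (simp add: fl_def flags_def)
  next
    fix x assume "x \<in> flags K"
    then obtain E F where x: "x = (E, F)" "E \<in> simplices 1 K" "F \<in> simplices 2 K" "E \<subseteq> F" by (auto simp: flags_def)
    obtain A where A: "A \<in> vertex_sets K" "card A = 2" "E = convex hull A" using x(2) by (auto simp: simplices_eq)
    obtain B where B: "B \<in> vertex_sets K" "card B = 3" "F = convex hull B" using x(3) by (auto simp: simplices_eq)
    have "A \<subseteq> B"
    proof
      fix a assume a: "a \<in> A"
      then have "a \<in> convex hull A" by (rule hull_inc)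
      then have "a \<in> convex hull B" using x(4) A(3) B(3) by simp blast
      then show "a \<in> B" by (rule vertex_in_hull[OF B(1) vertex_mem[OF A(1) a]])
    qed
    obtain p q where pq: "A = {p, q}" "num p > num q" using sorted2[OF A(1) subset_refl A(2)] by blast
    have "card (B - A) = 1" using \<open>A \<subseteq> B\<close> A B vs_finite by (subst card_Diff_subset) auto
    then obtain r where r: "B - A = {r}" by (rule card_1_singletonE)
    then have "B = {p, q, r}" using pq \<open>A \<subseteq> B\<close> by blast
    then have "distinct [p, q, r]" using B(2) card3[of p q r] by blast
    then have "(p, q, r) \<in> FL" using B(1) pq \<open>B = {p, q, r}\<close> by (simp add: FL_def tri_def)
    then show "x \<in> fl ` FL"
      using x(1) A(3) B(3) pq \<open>B = {p, q, r}\<close> by (intro image_eqI[of _ _ "(p, q, r)"]) (simp_all add: fl_def)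
  qed
qed

section \<open>The choices of face orientations and edge directions\<close>

definition cyc_edges :: "'v \<times> 'v \<times> 'v \<Rightarrow> ('v \<times> 'v) set"
  where "cyc_edges = (\<lambda>(x, y, z). {(x, y), (y, z), (z, x)})"

text \<open>The orientation of the triangle is compared with the arrow of the numbering, not with
  \<open>dir\<close>; \<open>edge_factor\<close> accounts for the difference.\<close>

definition sg :: "'v \<times> 'v \<times> 'v \<Rightarrow> bool"
  where "sg = (\<lambda>(p, q, r). (p, q) \<in> cyc_edges (ori (convex hull {p, q, r})))"

text \<open>For a triangle of \<open>T3\<close>, the chosen orientation is an even permutation of
  the decreasing vertex order.\<close>

definition ev :: "'v \<times> 'v \<times> 'v \<Rightarrow> bool"
  where "ev = (\<lambda>(p, q, r). ori (convex hull {p, q, r}) \<in> {(p, q, r), (q, r, p), (r, p, q)})"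

lemma ori_cases:
  assumes "tri p q r"
  shows "ori (convex hull {p, q, r}) \<in> {(p, q, r), (q, r, p), (r, p, q), (p, r, q), (r, q, p), (q, p, r)}"
proof -
  obtain x y z where xyz: "ori (convex hull {p, q, r}) = (x, y, z)" by (cases "ori (convex hull {p, q, r})")
  have t: "{p, q, r} \<in> vertex_sets K" "card {p, q, r} = 3" using assms card3 by (auto simp: tri_def)
  then have F: "convex hull {p, q, r} \<in> simplices 2 K" using hull3 by blast
  then have h: "convex hull {p, q, r} = convex hull {x, y, z}"
    using choices xyz unfolding lattice_choices_def by fastforce
  then have v: "{x, y, z} \<in> vertex_sets K" "card {x, y, z} = 3" using F hull3[of x y z] by simp_all
  then have eq: "{x, y, z} = {p, q, r}" using hull_inj t(1) h by blast
  have "distinct [x, y, z]" using v(2) unfolding card3 .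
  moreover have "x = p \<or> x = q \<or> x = r" "y = p \<or> y = q \<or> y = r" "z = p \<or> z = q \<or> z = r" using eq by blast+
  ultimately have "(x, y, z) \<in> {(p, q, r), (q, r, p), (r, p, q), (p, r, q), (r, q, p), (q, p, r)}" by auto
  then show ?thesis by (simp only: xyz)
qed

lemma sg_slot:
  assumes "F \<in> T3" "k \<in> {0, 1, 2}"
  shows "sg (slot F k) \<longleftrightarrow> (ev F \<longleftrightarrow> k \<noteq> 2)"
proof -
  obtain p q r where F: "F = (p, q, r)" by (cases F)
  have t: "tri p q r" using assms F by (simp add: T3_def)
  have d: "p \<noteq> q" "q \<noteq> r" "p \<noteq> r" using t by (auto simp: tri_def)
  have h: "{q, r, p} = {p, q, r}" "{p, r, q} = {p, q, r}" by blast+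
  show ?thesis
    using ori_cases[OF t] assms(2) d unfolding F sg_def ev_def slot_def cyc_edges_def
    by (elim insertE emptyE) (simp_all add: h)
qed

lemma ori_flip:
  assumes "tri p q r"
  shows "(q, p) \<in> cyc_edges (ori (convex hull {p, q, r})) \<longleftrightarrow> (p, q) \<notin> cyc_edges (ori (convex hull {p, q, r}))"
proof -
  have "p \<noteq> q" "q \<noteq> r" "p \<noteq> r" using assms by (auto simp: tri_def)
  then show ?thesis
    using ori_cases[OF assms] unfolding cyc_edges_def by (elim insertE emptyE) simp_all
qed

lemma boundary_edges:
  assumes "tri p q r"
  shows "fst ` set (triangle_boundary ori dir (convex hull {p, q, r})) =
    {convex hull {p, q}, convex hull {q, r}, convex hull {p, r}}"
  using ori_cases[OF assms] unfolding triangle_boundary_def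
  by (elim insertE emptyE) (simp_all add: insert_commute)

lemma boundary_agrees:
  assumes "tri p q r"
  shows "(convex hull {p, q}, True) \<in> set (triangle_boundary ori dir (convex hull {p, q, r})) \<longleftrightarrow>
    dir (convex hull {p, q}) \<in> cyc_edges (ori (convex hull {p, q, r}))"
proof -
  obtain x y z where xyz: "ori (convex hull {p, q, r}) = (x, y, z)" by (cases "ori (convex hull {p, q, r})")
  have hull: "convex hull {u, w} = convex hull {p, q}" if "dir (convex hull {p, q}) = (u, w)" for u w
    using dir_cases[of p q] tri_edg[OF assms] that by (auto simp: edg_def insert_commute)
  have *: "convex hull {p, q} = convex hull {u, w} \<and> dir (convex hull {u, w}) = (u, w) \<longleftrightarrow>
      dir (convex hull {p, q}) = (u, w)" for u w
    using hull[of u w] by metis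
  have "(convex hull {p, q}, True) \<in> set (triangle_boundary ori dir (convex hull {p, q, r})) \<longleftrightarrow>
    (convex hull {p, q} = convex hull {x, y} \<and> dir (convex hull {x, y}) = (x, y)) \<or>
    (convex hull {p, q} = convex hull {y, z} \<and> dir (convex hull {y, z}) = (y, z)) \<or>
    (convex hull {p, q} = convex hull {z, x} \<and> dir (convex hull {z, x}) = (z, x))"
    by (simp add: triangle_boundary_def xyz)
  then show ?thesis unfolding * xyz cyc_edges_def by simp
qed

lemma slot_FL: "F \<in> T3 \<Longrightarrow> k \<in> {0, 1, 2} \<Longrightarrow> slot F k \<in> FL"
  using bij_betw_apply[OF bij_slot, of "(F, k)"] by simp

lemma flags_eq: "{(e, f). f \<in> simplices 2 K \<and> e \<in> fst ` set (triangle_boundary ori dir f)} = flags K"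
proof (intro equalityI subsetI)
  fix x assume "x \<in> {(e, f). f \<in> simplices 2 K \<and> e \<in> fst ` set (triangle_boundary ori dir f)}"
  then obtain e f where x: "x = (e, f)" "f \<in> simplices 2 K" "e \<in> fst ` set (triangle_boundary ori dir f)" by auto
  have "f \<in> (\<lambda>(p, q, r). convex hull {p, q, r}) ` T3" using x(2) bij_betw_imp_surj_on[OF bij_simplices2] by simp
  then obtain p q r where F: "(p, q, r) \<in> T3" "f = convex hull {p, q, r}" by auto
  have "e \<in> {convex hull {p, q}, convex hull {q, r}, convex hull {p, r}}"
    using x(3) boundary_edges[of p q r] F by (simp add: T3_def)
  moreover have "{q, r, p} = {p, q, r}" "{p, r, q} = {p, q, r}" by blast+
  ultimately have "x = fl (slot (p, q, r) 0) \<or> x = fl (slot (p, q, r) 1) \<or> x = fl (slot (p, q, r) 2)"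
    using x(1) F(2) by (auto simp: fl_def slot_def)
  moreover have "fl (slot (p, q, r) k) \<in> flags K" if "k \<in> {0, 1, 2}" for k
    using bij_betw_apply[OF bij_fl slot_FL[OF F(1) that]] .
  ultimately show "x \<in> flags K" by auto
next
  fix x assume "x \<in> flags K"
  then have "x \<in> fl ` FL" using bij_betw_imp_surj_on[OF bij_fl] by simp
  then obtain p q r where x: "tri p q r" "x = (convex hull {p, q}, convex hull {p, q, r})" by (auto simp: FL_def fl_def)
  have "convex hull {p, q, r} \<in> simplices 2 K" using hull3[of p q r] card3[of p q r] x(1) by (simp add: tri_def)
  then show "x \<in> {(e, f). f \<in> simplices 2 K \<and> e \<in> fst ` set (triangle_boundary ori dir f)}"
    using boundary_edges[OF x(1)] x(2) by simp
qed

end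

section \<open>Equality of the two state sums\<close>

locale manifold_state_sum = triangulated_manifold K pos num ori dir link + hopf_tensors C \<eta> \<Delta> \<epsilon> S
  for K :: "'v::euclidean_space set set" and pos num ori dir link
    and C :: "'x::finite \<Rightarrow> 'x \<Rightarrow> 'x \<Rightarrow> complex" and \<eta> \<Delta> \<epsilon> S
begin

sublocale state_sum "vertex_sets K" num pos lnk C \<eta> \<Delta> \<epsilon> S ..

lemma tet_weight_W:
  assumes "T \<in> T4"
  shows "tet_weight C \<Delta> S pos \<phi> T = W (\<lambda>f\<in>FL. \<phi> (fl f)) T"
proof -
  have FL: "mi T e \<in> FL" "pl T e \<in> FL" for e
    using bij_betw_apply[OF bij_mi, of "(T, e)"] bij_betw_apply[OF bij_pl, of "(T, e)"] assms by simp_all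
  have minus: "color_minus pos \<phi> (tedge T e) = (\<lambda>f\<in>FL. \<phi> (fl f)) (mi T e)" for e
    using FL(1)[of e] by (cases "tedge T e") (auto simp: color_minus_def fl_def mi_def)
  have plus: "color_plus pos \<phi> (tedge T e) = (\<lambda>f\<in>FL. \<phi> (fl f)) (pl T e)" for e
    using FL(2)[of e] by (cases "tedge T e") (auto simp: color_plus_def fl_def pl_def)
  obtain a b c d where T: "T = (a, b, c, d)" by (cases T)
  show ?thesis
  proof (cases "pos a b c d")
    case True
    then show ?thesis
      unfolding W_def minus[symmetric] plus[symmetric] unfolding T
      by (simp add: tet_weight_def tedge_def C4_def weight_plus_def)
  next
    case False
    then show ?thesis
      unfolding W_def minus[symmetric] plus[symmetric] unfolding T
      by (simp add: tet_weight_def tedge_def C4_def weight_minus_def)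
  qed
qed

lemma sum_tet_weight:
  "(\<Sum>col\<in>colorings K. \<Prod>T\<in>tetrahedra K num. tet_weight C \<Delta> S pos col T) =
   (\<Sum>col\<in>FL \<rightarrow>\<^sub>E UNIV. \<Prod>T\<in>T4. W col T)"
  unfolding sum_PiE_reindex[OF bij_fl] colorings_def tetrahedra_eq
  by (intro sum.cong prod.cong refl tet_weight_W)

definition cF :: "('v \<times> 'v \<times> 'v \<Rightarrow> 'x) \<Rightarrow> 'v \<times> 'v \<times> 'v \<Rightarrow> complex"
  where "cF \<zeta> F = (if ev F then tr3 (\<zeta> (slot F 0)) (\<zeta> (slot F 1)) (\<zeta> (slot F 2))
       else tr3 (\<zeta> (slot F 2)) (\<zeta> (slot F 1)) (\<zeta> (slot F 0)))"

lemma face_factor: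
  assumes "(p, q, r) \<in> T3"
  shows "cyclic_contraction C (map (\<lambda>(e, _). z (e, convex hull {p, q, r})) (triangle_boundary ori dir (convex hull {p, q, r}))) =
    cF (\<lambda>f\<in>FL. z (fl f)) (p, q, r)"
proof -
  let ?H = "convex hull {p, q, r}"
  let ?\<zeta> = "\<lambda>f\<in>FL. z (fl f)"
  have t: "tri p q r" using assms by (simp add: T3_def)
  then have d: "p \<noteq> q" "q \<noteq> r" "p \<noteq> r" by (auto simp: tri_def)
  have h: "{q, r, p} = {p, q, r}" "{p, r, q} = {p, q, r}" "{q, p} = {p, q}" "{r, q} = {q, r}" "{r, p} = {p, r}" by blast+
  define e0 where "e0 = z (convex hull {p, q}, ?H)"
  define e1 where "e1 = z (convex hull {q, r}, ?H)"
  define e2 where "e2 = z (convex hull {p, r}, ?H)"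
  have h3: "{q, r, p} = {p, q, r}" "{p, r, q} = {p, q, r}" by blast+
  have \<zeta>: "?\<zeta> (slot (p, q, r) 0) = e0" "?\<zeta> (slot (p, q, r) 1) = e1" "?\<zeta> (slot (p, q, r) 2) = e2"
    using slot_FL[OF assms, of 0] slot_FL[OF assms, of 1] slot_FL[OF assms, of 2]
    by (simp_all add: slot_def fl_def e0_def e1_def e2_def h3)
  have cF: "cF ?\<zeta> (p, q, r) = (if ev (p, q, r) then tr3 e0 e1 e2 else tr3 e2 e1 e0)"
    by (simp only: cF_def \<zeta>)
  have cyc: "tr3 e1 e2 e0 = tr3 e0 e1 e2" "tr3 e2 e0 e1 = tr3 e0 e1 e2" "tr3 e1 e0 e2 = tr3 e2 e1 e0" "tr3 e0 e2 e1 = tr3 e2 e1 e0"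
    using tr3_cyclic[of e0 e1 e2] tr3_cyclic[of e2 e0 e1] tr3_cyclic[of e2 e1 e0] tr3_cyclic[of e0 e2 e1] by simp_all
  have tb: "map (\<lambda>(e, _). z (e, ?H)) (triangle_boundary ori dir ?H) =
     (case ori ?H of (x, y, w) \<Rightarrow> [z (convex hull {x, y}, ?H), z (convex hull {y, w}, ?H), z (convex hull {w, x}, ?H)])"
    by (cases "ori ?H") (simp add: triangle_boundary_def)
  show ?thesis
    using ori_cases[OF t] unfolding cF tb ev_def
    by (elim insertE emptyE)
      (simp_all add: h d d[symmetric] cyclic_contraction_tr3 cyc flip: e0_def e1_def e2_def)
qed

text \<open>If \<open>dir\<close> opposes the arrow of the numbering, the star is listed backwards
  and all comparisons of arrows are negated, and \<open>hinge_factor_reverse\<close> shows that the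
  factor is unchanged.\<close>

lemma edge_factor:
  assumes "(p, q) \<in> T2"
  shows "hinge_factor \<Delta> S (map (\<lambda>f. (z (convex hull {p, q}, f), (convex hull {p, q}, True) \<in> set (triangle_boundary ori dir f)))
      (edge_star dir link (convex hull {p, q}))) =
    hinge_factor \<Delta> S (map (\<lambda>r. ((\<lambda>f\<in>FL. z (fl f)) (p, q, r), sg (p, q, r))) (lnk p q))"
proof -
  let ?E = "convex hull {p, q}"
  have e: "edg p q" "num p > num q" using assms by (auto simp: T2_def)
  have pq: "{p, q} \<in> vertex_sets K" "p \<noteq> q" using e by (auto simp: edg_def)
  define L where "L = map (\<lambda>r. ((\<lambda>f\<in>FL. z (fl f)) (p, q, r), sg (p, q, r))) (lnk p q)"
  have \<zeta>: "(\<lambda>f\<in>FL. z (fl f)) (p, q, r) = z (?E, convex hull {p, q, r})" "tri p q r" if "r \<in> set (lnk p q)" for r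
    using that set_link[OF e(1)] e by (simp_all add: FL_def fl_def)
  consider "dir ?E = (p, q)" | "dir ?E = (q, p)" using dir_cases[OF pq] by blast
  then have "hinge_factor \<Delta> S (map (\<lambda>f. (z (?E, f), (?E, True) \<in> set (triangle_boundary ori dir f))) (edge_star dir link ?E)) =
    hinge_factor \<Delta> S L"
  proof cases
    case 1
    then have l: "link ?E = lnk p q" by (simp add: lnk_def)
    have "map (\<lambda>f. (z (?E, f), (?E, True) \<in> set (triangle_boundary ori dir f))) (edge_star dir link ?E) = L"
      unfolding L_def edge_star_def 1 prod.case l map_map comp_def
    proof (rule map_cong[OF refl])
      fix r assume r: "r \<in> set (lnk p q)"
      show "(z (?E, convex hull {p, q, r}), (?E, True) \<in> set (triangle_boundary ori dir (convex hull {p, q, r}))) =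
        ((\<lambda>f\<in>FL. z (fl f)) (p, q, r), sg (p, q, r))"
        unfolding \<zeta>(1)[OF r] boundary_agrees[OF \<zeta>(2)[OF r]] 1 by (simp add: sg_def)
    qed
    then show ?thesis by (simp only:)
  next
    case 2
    then have l: "link ?E = rev (lnk p q)" using pq(2) by (simp add: lnk_def)
    have "map (\<lambda>f. (z (?E, f), (?E, True) \<in> set (triangle_boundary ori dir f))) (edge_star dir link ?E) =
      rev (map (apsnd Not) L)"
      unfolding L_def edge_star_def 2 prod.case l map_map comp_def rev_map[symmetric]
    proof (rule arg_cong[where f = rev], rule map_cong[OF refl])
      fix r assume r: "r \<in> set (lnk p q)"
      have h: "{q, p, r} = {p, q, r}" by blast
      show "(z (?E, convex hull {q, p, r}), (?E, True) \<in> set (triangle_boundary ori dir (convex hull {q, p, r}))) =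
        apsnd Not ((\<lambda>f\<in>FL. z (fl f)) (p, q, r), sg (p, q, r))"
        unfolding \<zeta>(1)[OF r] h boundary_agrees[OF \<zeta>(2)[OF r]] 2 ori_flip[OF \<zeta>(2)[OF r]] by (simp add: sg_def)
    qed
    moreover have "hinge_factor \<Delta> S (rev (map (apsnd Not) L)) = hinge_factor \<Delta> S L"
    proof (rule hinge_factor_reverse)
      obtain B where B: "B \<in> vertex_sets K" "{p, q} \<subseteq> B" "card B = 4" using pure3[OF chart pq(1)] by blast
      have "B \<noteq> {p, q}" using B(3) pq(2) by auto
      then obtain r where r: "r \<in> B" "r \<noteq> p" "r \<noteq> q" using B(2) by blast
      have "{p, q, r} \<in> vertex_sets K" by (rule vs_closed[OF B(1)]) (use B(2) r in auto)
      then have "r \<in> set (lnk p q)" using set_link[OF e(1)] pq(2) r by (simp add: tri_def)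
      then show "L \<noteq> []" by (auto simp: L_def)
    qed
    ultimately show ?thesis by (simp only:)
  qed
  then show ?thesis by (simp only: L_def)
qed

lemma state_sums_equal: "tetrahedral_state_sum C \<Delta> S K pos num = cfs_invariant C \<Delta> S K ori dir link"
proof -
  define Z where "Z = (\<Sum>w\<in>FL \<rightarrow>\<^sub>E UNIV. (\<Prod>F\<in>T3. GF w F) * (\<Prod>E\<in>T2. HF w E))"
  have "(\<Sum>z\<in>flags K \<rightarrow>\<^sub>E UNIV.
       (\<Prod>f\<in>simplices 2 K. cyclic_contraction C (map (\<lambda>(e, _). z (e, f)) (triangle_boundary ori dir f))) *
       (\<Prod>e\<in>simplices 1 K. hinge_factor \<Delta> S (map (\<lambda>f. (z (e, f), (e, True) \<in> set (triangle_boundary ori dir f))) (edge_star dir link e)))) =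
    (\<Sum>z\<in>flags K \<rightarrow>\<^sub>E UNIV. (\<Prod>F\<in>T3. cF (\<lambda>f\<in>FL. z (fl f)) F) *
       (\<Prod>(p, q)\<in>T2. hinge_factor \<Delta> S (map (\<lambda>r. ((\<lambda>f\<in>FL. z (fl f)) (p, q, r), sg (p, q, r))) (lnk p q))))"
  proof (intro sum.cong refl arg_cong2[where f = "(*)"])
    fix z :: "'v set \<times> 'v set \<Rightarrow> 'x"
    show "(\<Prod>f\<in>simplices 2 K. cyclic_contraction C (map (\<lambda>(e, _). z (e, f)) (triangle_boundary ori dir f))) =
      (\<Prod>F\<in>T3. cF (\<lambda>f\<in>FL. z (fl f)) F)"
      unfolding prod.reindex_bij_betw[OF bij_simplices2, symmetric]
    proof (rule prod.cong[OF refl])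
      fix F assume F: "F \<in> T3"
      obtain p q r where pqr: "F = (p, q, r)" by (cases F)
      show "cyclic_contraction C (map (\<lambda>(e, _). z (e, case F of (p, q, r) \<Rightarrow> convex hull {p, q, r}))
          (triangle_boundary ori dir (case F of (p, q, r) \<Rightarrow> convex hull {p, q, r}))) = cF (\<lambda>f\<in>FL. z (fl f)) F"
        using face_factor[of p q r z] F unfolding pqr by simp
    qed
    show "(\<Prod>e\<in>simplices 1 K. hinge_factor \<Delta> S (map (\<lambda>f. (z (e, f), (e, True) \<in> set (triangle_boundary ori dir f))) (edge_star dir link e))) =
      (\<Prod>(p, q)\<in>T2. hinge_factor \<Delta> S (map (\<lambda>r. ((\<lambda>f\<in>FL. z (fl f)) (p, q, r), sg (p, q, r))) (lnk p q)))"
      unfolding prod.reindex_bij_betw[OF bij_simplices1, symmetric]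
    proof (rule prod.cong[OF refl])
      fix E assume E: "E \<in> T2"
      obtain p q where pq: "E = (p, q)" by (cases E)
      show "hinge_factor \<Delta> S (map (\<lambda>f. (z (case E of (p, q) \<Rightarrow> convex hull {p, q}, f),
           (case E of (p, q) \<Rightarrow> convex hull {p, q}, True) \<in> set (triangle_boundary ori dir f)))
           (edge_star dir link (case E of (p, q) \<Rightarrow> convex hull {p, q}))) =
        (case E of (p, q) \<Rightarrow> hinge_factor \<Delta> S (map (\<lambda>r. ((\<lambda>f\<in>FL. z (fl f)) (p, q, r), sg (p, q, r))) (lnk p q)))"
        using edge_factor[of p q z] E unfolding pq prod.case by simp
    qed
  qed
  also have "\<dots> = (\<Sum>\<zeta>\<in>FL \<rightarrow>\<^sub>E UNIV. (\<Prod>F\<in>T3. cF \<zeta> F) *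
       (\<Prod>(p, q)\<in>T2. hinge_factor \<Delta> S (map (\<lambda>r. (\<zeta> (p, q, r), sg (p, q, r))) (lnk p q))))"
    by (rule sum_PiE_reindex[OF bij_fl, symmetric])
  also have "\<dots> = Z"
    unfolding Z_def by (rule sum_hinges[of sg ev cF]) (use sg_slot cF_def in blast)+
  finally have cfs: "cfs_invariant C \<Delta> S K ori dir link =
      of_nat CARD('x) powi (- int (card (simplices 1 K)) - int (card (simplices 3 K))) * Z"
    unfolding cfs_invariant_def cfs_sum_def flags_eq by simp
  have "card T3 = card (simplices 2 K)" using bij_betw_same_card[OF bij_simplices2] .
  then have "tetrahedral_state_sum C \<Delta> S K pos num =
      of_nat CARD('x) powi (- 2 * int (card (simplices 2 K)) - int (card (simplices 0 K))) *
      (of_nat CARD('x) powi int (card (simplices 2 K)) * Z)"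
    unfolding tetrahedral_state_sum_def sum_tet_weight sum_W Z_def by simp
  \<comment> \<open>The collapsed pillows contribute one factor |X| per triangle, which raises the
    exponent from -2 N2 - N0 to -N2 - N0; the Euler relation rewrites this as -N1 - N3.\<close>
  also have "\<dots> = of_nat CARD('x) powi ((- 2 * int (card (simplices 2 K)) - int (card (simplices 0 K))) + int (card (simplices 2 K))) * Z"
    by (subst power_int_add) (simp_all add: mult.assoc)
  also have "(- 2 * int (card (simplices 2 K)) - int (card (simplices 0 K))) + int (card (simplices 2 K)) =
      - int (card (simplices 1 K)) - int (card (simplices 3 K))"
    using euler by linarith
  finally show ?thesis using cfs by simp
qed

end

theorem proposition1:
  fixes scl :: "complex \<Rightarrow> 'a::ring_1 \<Rightarrow> 'a"
    and \<phi> :: "'x::finite \<Rightarrow> 'a"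
    and comult :: "'a \<Rightarrow> 'x \<Rightarrow> 'x \<Rightarrow> complex"
    and counit :: "'a \<Rightarrow> complex"
    and antipode :: "'a \<Rightarrow> 'a"
    and K :: "'v::euclidean_space set set"
    and pos :: "'v \<Rightarrow> 'v \<Rightarrow> 'v \<Rightarrow> 'v \<Rightarrow> bool"
    and num :: "'v \<Rightarrow> nat"
    and ori :: "'v set \<Rightarrow> 'v \<times> 'v \<times> 'v"
    and dir :: "'v set \<Rightarrow> 'v \<times> 'v"
    and link :: "'v set \<Rightarrow> 'v list"
  assumes "involutory_hopf_algebra scl \<phi> comult counit antipode"
    and "closed_triangulated_3_manifold K"
    and "orientation K pos"
    and "bij_betw num (vertices K) {1..card (simplices 0 K)}"
    and "lattice_choices K pos ori dir link"
  shows "tetrahedral_state_sum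
           (mult_const scl \<phi>) (comult_const \<phi> comult) (antipode_const scl \<phi> antipode) K pos num =
         cfs_invariant
           (mult_const scl \<phi>) (comult_const \<phi> comult) (antipode_const scl \<phi> antipode) K ori dir link"
proof -
  interpret A: involutory_hopf_algebra scl \<phi> comult counit antipode by (rule assms(1))
  interpret H: hopf_tensors "mult_const scl \<phi>" "coord scl \<phi> 1" "comult_const \<phi> comult"
    "\<lambda>x. counit (\<phi> x)" "antipode_const scl \<phi> antipode"
    by (rule A.hopf_tensors)
  interpret triangulated_manifold K pos num ori dir link
  proof
    show "simplicial_complex K" using assms(2) by (simp add: closed_triangulated_3_manifold_def)
    show "\<exists>U W :: (real ^ 3) set. openin (top_of_set (\<Union>K)) U \<and> x \<in> U \<and> open W \<and> U homeomorphic W"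
      if "x \<in> \<Union>K" for x
      using assms(2) that unfolding closed_triangulated_3_manifold_def by blast
    show "inj_on num (vertices K)" using assms(4) by (rule bij_betw_imp_inj_on)
  qed (rule assms)+
  interpret manifold_state_sum K pos num ori dir link "mult_const scl \<phi>" "coord scl \<phi> 1" "comult_const \<phi> comult"
    "\<lambda>x. counit (\<phi> x)" "antipode_const scl \<phi> antipode" ..
  show ?thesis by (rule state_sums_equal)
qed

end
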